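(* Let $k\geq 2$ and $r\geq 1$ be integers and let $\epsilon>0$. Suppose $h\in\mathbb{R}[x_1,\dots,x_n]$ is hyperbolic with respect to $\mathbf{e}\in\mathbb{R}^n$, and let $\mathbf{u}_1,\dots,\mathbf{u}_m\in\Lambda_+(h,\mathbf{e})$ be such that $\operatorname{tr}(\mathbf{u}_i)\leq\epsilon$ and $\operatorname{rk}(\mathbf{u}_i)\leq r$ for all $1\leq i\leq m$, and $\mathbf{u}_1+\mathbf{u}_2+\cdots+\mathbf{u}_m=\mathbf{e}$. Then there is a partition $S_1\cup S_2\cup\cdots\cup S_k=\{1,\dots,m\}$ (into pairwise disjoint sets) such that $$\Big\|\sum_{i\in S_j}\mathbf{u}_i\Big\|\leq \frac1k\,\delta(k\epsilon,m,rk)\quad\text{for each } j\in\{1,\dots,k\}.$$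
   Context: A homogeneous polynomial $h\in\mathbb{R}[x_1,\dots,x_n]$ of degree $d$ is hyperbolic with respect to $\mathbf{e}\in\mathbb{R}^n$ if $h(\mathbf{e})\neq0$ and for every $\mathbf{x}\in\mathbb{R}^n$ the univariate polynomial $t\mapsto h(t\mathbf{e}-\mathbf{x})$ has only real zeros. Then $h(t\mathbf{e}-\mathbf{x})=h(\mathbf{e})\prod_{j=1}^d(t-\lambda_j(\mathbf{x}))$ with $\lambda_1(\mathbf{x})\geq\cdots\geq\lambda_d(\mathbf{x})$ (the eigenvalues of $\mathbf{x}$ with respect to $\mathbf{e}$); $\lambda_{\max}=\lambda_1$, $\lambda_{\min}=\lambda_d$. The closed hyperbolicity cone is $\Lambda_+(h,\mathbf{e})=\{\mathbf{x}:\lambda_{\min}(\mathbf{x})\geq0\}$. Trace, rank and norm (w.r.t. $\mathbf{e}$): $\operatorname{tr}(\mathbf{x})=\sum_i\lambda_i(\mathbf{x})$, $\operatorname{rk}(\mathbf{x})=\#\{i:\lambda_i(\mathbf{x})\neq0\}$, $\|\mathbf{x}\|=\max_i|\lambda_i(\mathbf{x})|$. For a positive integer $r$, $U_r$ is the set of pairs $(\delta,\mu)$ of positive reals such that $$\delta-1\geq\frac{\delta}{\mu}\cdot\frac{\left(1+\frac{\delta}{r\mu}\right)^{r-1}-\left(\frac{\delta}{r\mu}\right)^{r-1}}{\left(1+\frac{\delta}{r\mu}\right)^{r}-\left(\frac{\delta}{r\mu}\right)^{r}},$$ and either $\mu>1$, or ($1\leq\delta\leq2$ and $\mu>1-\delta/r$).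 For $\epsilon>0$, positive integers $m$, $r$: $$\delta(\epsilon,m,r)=\inf\left\{\frac{\epsilon\mu+(1-\frac1m)\delta}{1-\frac1m+\frac{\mu}{m}}:(\delta,\mu)\in U_r\right\}.$$ *)

theory Defs
  imports
    "HOL-Analysis.Analysis"
    "HOL-Library.Poly_Mapping"
    "HOL-Computational_Algebra.Computational_Algebra"
begin

section \<open>Real polynomials in finitely many variables\<close>

text \<open>
  An element of \<open>\<real>[x\<^sub>1, \<dots>, x\<^sub>n]\<close> is a finitely supported map from exponent vectors to
  coefficients; the variables are indexed by a finite type \<open>'n\<close> with \<open>n = CARD('n)\<close>.
\<close>

type_synonym 'n rpoly = "('n \<Rightarrow>\<^sub>0 nat) \<Rightarrow>\<^sub>0 real"

definition mono_degree :: "('n::finite \<Rightarrow>\<^sub>0 nat) \<Rightarrow> nat" where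
  "mono_degree a = (\<Sum>i\<in>UNIV. Poly_Mapping.lookup a i)"

definition homogeneous :: "nat \<Rightarrow> 'n::finite rpoly \<Rightarrow> bool" where
  "homogeneous d h \<longleftrightarrow> (\<forall>a\<in>Poly_Mapping.keys h. mono_degree a = d)"

definition eval_rpoly :: "'n::finite rpoly \<Rightarrow> real ^ 'n \<Rightarrow> real" where
  "eval_rpoly h x =
     (\<Sum>a\<in>Poly_Mapping.keys h. Poly_Mapping.lookup h a * (\<Prod>i\<in>UNIV. x $ i ^ Poly_Mapping.lookup a i))"

text \<open>The univariate polynomial \<open>t \<mapsto> h(t e - x)\<close>, obtained by substituting \<open>e\<^sub>i t - x\<^sub>i\<close> for the
  \<open>i\<close>-th variable.\<close>

definition line_poly :: "'n::finite rpoly \<Rightarrow> real ^ 'n \<Rightarrow> real ^ 'n \<Rightarrow> real poly" where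
  "line_poly h e x =
     (\<Sum>a\<in>Poly_Mapping.keys h. smult (Poly_Mapping.lookup h a)
        (\<Prod>i\<in>UNIV. [:- (x $ i), e $ i:] ^ Poly_Mapping.lookup a i))"

lemma poly_line_poly: "poly (line_poly h e x) t = eval_rpoly h (t *\<^sub>R e - x)"
  by (simp add: line_poly_def eval_rpoly_def poly_sum poly_prod algebra_simps)


section \<open>Hyperbolic polynomials\<close>

definition hyperbolic :: "'n::finite rpoly \<Rightarrow> real ^ 'n \<Rightarrow> bool" where
  "hyperbolic h e \<longleftrightarrow>
     (\<exists>d. homogeneous d h) \<and> eval_rpoly h e \<noteq> 0 \<and>
     (\<forall>x. \<forall>z::complex. poly (map_poly complex_of_real (line_poly h e x)) z = 0 \<longrightarrow> z \<in> \<real>)"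

text \<open>The list \<open>[\<lambda>\<^sub>1(x), \<dots>, \<lambda>\<^sub>d(x)]\<close> in weakly decreasing order.\<close>

definition eigenvalues :: "'n::finite rpoly \<Rightarrow> real ^ 'n \<Rightarrow> real ^ 'n \<Rightarrow> real list" where
  "eigenvalues h e x =
     (THE ls. sorted_wrt (\<ge>) ls \<and>
        line_poly h e x = smult (eval_rpoly h e) (\<Prod>l\<leftarrow>ls. [:- l, 1:]))"

definition lambda_min :: "'n::finite rpoly \<Rightarrow> real ^ 'n \<Rightarrow> real ^ 'n \<Rightarrow> real" where
  "lambda_min h e x = last (eigenvalues h e x)"

definition hyp_cone :: "'n::finite rpoly \<Rightarrow> real ^ 'n \<Rightarrow> (real ^ 'n) set" where
  "hyp_cone h e = {x. lambda_min h e x \<ge> 0}"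

definition hyp_trace :: "'n::finite rpoly \<Rightarrow> real ^ 'n \<Rightarrow> real ^ 'n \<Rightarrow> real" where
  "hyp_trace h e x = sum_list (eigenvalues h e x)"

definition hyp_rank :: "'n::finite rpoly \<Rightarrow> real ^ 'n \<Rightarrow> real ^ 'n \<Rightarrow> nat" where
  "hyp_rank h e x = length (filter (\<lambda>l. l \<noteq> 0) (eigenvalues h e x))"

text \<open>The inserted \<open>0\<close> only matters for constant \<open>h\<close>, which has no eigenvalues: the norm is then \<open>0\<close>.\<close>

definition hyp_norm :: "'n::finite rpoly \<Rightarrow> real ^ 'n \<Rightarrow> real ^ 'n \<Rightarrow> real" where
  "hyp_norm h e x = Max (insert 0 (abs ` set (eigenvalues h e x)))"


section \<open>The bound\<close>

definition U :: "nat \<Rightarrow> (real \<times> real) set" where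
  "U r = {(\<delta>, \<mu>). \<delta> > 0 \<and> \<mu> > 0 \<and>
     \<delta> - 1 \<ge> \<delta> / \<mu> *
       (((1 + \<delta> / (real r * \<mu>)) ^ (r - 1) - (\<delta> / (real r * \<mu>)) ^ (r - 1)) /
        ((1 + \<delta> / (real r * \<mu>)) ^ r - (\<delta> / (real r * \<mu>)) ^ r)) \<and>
     (\<mu> > 1 \<or> (1 \<le> \<delta> \<and> \<delta> \<le> 2 \<and> \<mu> > 1 - \<delta> / real r))}"

definition delta_bound :: "real \<Rightarrow> nat \<Rightarrow> nat \<Rightarrow> real" where
  "delta_bound \<epsilon> m r =
     Inf {(\<epsilon> * \<mu> + (1 - 1 / real m) * \<delta>) / (1 - 1 / real m + \<mu> / real m) | \<delta> \<mu>. (\<delta>, \<mu>) \<in> U r}"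


section \<open>Well-definedness\<close>

lemma coeff_prod_linear_powers:
  fixes c b :: "'n::finite \<Rightarrow> real"
  assumes "finite A"
  shows "degree (\<Prod>i\<in>A. [:c i, b i:] ^ f i) \<le> (\<Sum>i\<in>A. f i) \<and>
         coeff (\<Prod>i\<in>A. [:c i, b i:] ^ f i) (\<Sum>i\<in>A. f i) = (\<Prod>i\<in>A. b i ^ f i)"
  using assms
proof (induction A rule: finite_induct)
  case (insert x A)
  have d: "degree ([:c x, b x:] ^ k) \<le> k \<and> coeff ([:c x, b x:] ^ k) k = b x ^ k" for k
  proof (induction k)
    case (Suc k)
    have "degree [:c x, b x:] \<le> 1" by simp
    moreover have "coeff ([:c x, b x:] * [:c x, b x:] ^ k) (Suc k) = b x * b x ^ k"
      using Suc by (simp add: coeff_eq_0)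
    ultimately show ?case
      using Suc degree_mult_le[of "[:c x, b x:]" "[:c x, b x:] ^ k"] by simp
  qed simp
  let ?p = "[:c x, b x:] ^ f x" and ?q = "\<Prod>i\<in>A. [:c i, b i:] ^ f i"
  have "coeff (?p * ?q) (f x + sum f A) = coeff ?p (f x) * coeff ?q (sum f A)"
  proof -
    have "coeff (?p * ?q) (f x + sum f A) =
            (\<Sum>i\<le>f x + sum f A. coeff ?p i * coeff ?q (f x + sum f A - i))"
      by (rule coeff_mult)
    also have "\<dots> = (\<Sum>i\<in>{f x}. coeff ?p i * coeff ?q (f x + sum f A - i))"
    proof (rule sum.mono_neutral_right)
      show "\<forall>i\<in>{..f x + sum f A} - {f x}. coeff ?p i * coeff ?q (f x + sum f A - i) = 0"
      proof
        fix i assume i: "i \<in> {..f x + sum f A} - {f x}"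
        show "coeff ?p i * coeff ?q (f x + sum f A - i) = 0"
        proof (cases "i < f x")
          case True
          then have "degree ?q < f x + sum f A - i" using insert.IH by linarith
          then show ?thesis by (simp add: coeff_eq_0)
        next
          case False
          then have "degree ?p < i" using i d[of "f x"] by auto
          then show ?thesis by (simp add: coeff_eq_0)
        qed
      qed
    qed auto
    finally show ?thesis by simp
  qed
  then show ?case
    using insert d[of "f x"] degree_mult_le[of ?p ?q] by simp
qed simp

lemma line_poly_degree:
  assumes "homogeneous d h" "eval_rpoly h e \<noteq> 0"
  shows "degree (line_poly h e x) = d" "lead_coeff (line_poly h e x) = eval_rpoly h e"
proof -
  have k: "degree (\<Prod>i\<in>UNIV. [:- (x $ i), e $ i:] ^ Poly_Mapping.lookup a i) \<le> d"
     "coeff (\<Prod>i\<in>UNIV. [:- (x $ i), e $ i:] ^ Poly_Mapping.lookup a i) d = (\<Prod>i\<in>UNIV. e $ i ^ Poly_Mapping.lookup a i)"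
    if "a \<in> Poly_Mapping.keys h" for a
    using coeff_prod_linear_powers[of UNIV "\<lambda>i. - (x $ i)" "\<lambda>i. e $ i" "Poly_Mapping.lookup a"] that assms(1)
    by (auto simp: homogeneous_def mono_degree_def)
  have c: "coeff (line_poly h e x) d = eval_rpoly h e"
    unfolding line_poly_def eval_rpoly_def coeff_sum by (intro sum.cong) (auto simp: k)
  have "degree (line_poly h e x) \<le> d"
    unfolding line_poly_def by (intro degree_sum_le) (auto intro: order.trans[OF degree_smult_le] k)
  moreover have "d \<le> degree (line_poly h e x)" using c assms(2) by (intro le_degree) simp
  ultimately show "degree (line_poly h e x) = d" by simp
  then show "lead_coeff (line_poly h e x) = eval_rpoly h e" using c by simp
qed

lemma real_rooted_factorization:
  fixes p :: "real poly"
  assumes "p \<noteq> 0" "\<And>z. poly (map_poly complex_of_real p) z = 0 \<Longrightarrow> z \<in> \<real>"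
  shows "\<exists>ls. p = smult (lead_coeff p) (\<Prod>l\<leftarrow>ls. [:- l, 1:])"
  using assms
proof (induction "degree p" arbitrary: p)
  case 0
  then obtain c where "p = [:c:]" using degree_eq_zeroE by metis
  then show ?case by (intro exI[of _ "[]"]) (simp add: one_pCons)
next
  case (Suc n p)
  have "degree (map_poly complex_of_real p) = degree p" by (simp add: degree_map_poly)
  then have "\<not> constant (poly (map_poly complex_of_real p))"
    using Suc.hyps(2) by (simp add: constant_degree)
  then obtain z where z: "poly (map_poly complex_of_real p) z = 0"
    using fundamental_theorem_of_algebra by blast
  then obtain r where r: "z = complex_of_real r" using Suc.prems(2) Reals_cases by blast
  have "complex_of_real (poly p r) = 0" using z unfolding r
    by (simp add: poly_altdef degree_map_poly coeff_map_poly)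
  then obtain q where q: "p = [:- r, 1:] * q" by (auto simp: poly_eq_0_iff_dvd elim: dvdE)
  have "q \<noteq> 0" using q Suc.prems by auto
  then have "degree p = Suc (degree q)" using q degree_mult_eq[of "[:- r, 1:]" q] by simp
  moreover have "w \<in> \<real>" if "poly (map_poly complex_of_real q) w = 0" for w
  proof (rule Suc.prems(2))
    have "map_poly complex_of_real p = map_poly complex_of_real [:- r, 1:] * map_poly complex_of_real q"
      unfolding q by (intro poly_eqI) (simp add: coeff_map_poly coeff_mult del: mult_pCons_left)
    then show "poly (map_poly complex_of_real p) w = 0" using that by simp
  qed
  ultimately obtain ls where "q = smult (lead_coeff q) (\<Prod>l\<leftarrow>ls. [:- l, 1:])"
    using Suc.hyps(1)[of q] Suc.hyps(2) \<open>q \<noteq> 0\<close> by auto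
  moreover have "lead_coeff p = lead_coeff q" unfolding q lead_coeff_mult by simp
  ultimately have "p = [:- r, 1:] * smult (lead_coeff p) (\<Prod>l\<leftarrow>ls. [:- l, 1:])"
    using q by simp
  then have "p = smult (lead_coeff p) (\<Prod>l\<leftarrow>r # ls. [:- l, 1:])"
    unfolding list.map prod_list.Cons mult_smult_right .
  then show ?case ..
qed

theorem eigenvalues_ex1:
  assumes "hyperbolic h e"
  shows "\<exists>!ls. sorted_wrt (\<ge>) ls \<and>
           line_poly h e x = smult (eval_rpoly h e) (\<Prod>l\<leftarrow>ls. [:- l, 1:])"
proof -
  from assms obtain d where d: "homogeneous d h" "eval_rpoly h e \<noteq> 0" by (auto simp: hyperbolic_def)
  note D = line_poly_degree[OF d, of x]
  have "line_poly h e x \<noteq> 0" using D d by auto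
  with assms obtain ls where ls: "line_poly h e x = smult (eval_rpoly h e) (\<Prod>l\<leftarrow>ls. [:- l, 1:])"
    using real_rooted_factorization[of "line_poly h e x"] D by (auto simp: hyperbolic_def)
  have P: "(\<Prod>l\<leftarrow>ls'. [:- l, 1:]) = (\<Prod>l\<in>#mset ls'. [:- l, 1:])" for ls' :: "real list"
    by (metis mset_map prod_mset_prod_list)
  have proots: "proots (\<Prod>l\<leftarrow>ls'. [:- l, 1:]) = mset ls'" for ls' :: "real list"
  proof (induction ls')
    case (Cons a ls')
    have "(\<Prod>l\<leftarrow>ls'. [:- l, 1:]) \<noteq> 0" by (auto simp: prod_list_zero_iff)
    then show ?case using Cons by (simp add: proots_mult del: mult_pCons_left)
  qed simp
  show ?thesis
  proof (rule ex1I[of _ "rev (sort ls)"])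
    have "sorted_wrt (\<ge>) (rev (sort ls))" by (simp add: sorted_wrt_rev)
    then show "sorted_wrt (\<ge>) (rev (sort ls)) \<and>
        line_poly h e x = smult (eval_rpoly h e) (\<Prod>l\<leftarrow>rev (sort ls). [:- l, 1:])"
      using ls P by simp
  next
    fix ls' assume *: "sorted_wrt (\<ge>) ls' \<and>
        line_poly h e x = smult (eval_rpoly h e) (\<Prod>l\<leftarrow>ls'. [:- l, 1:])"
    then have "mset ls' = mset ls" using ls d(2) proots[of ls] proots[of ls'] by (metis proots_smult)
    moreover have "sorted (rev ls')" using * by (simp add: sorted_wrt_rev)
    ultimately have "rev ls' = sort ls" by (metis mset_rev properties_for_sort)
    then show "ls' = rev (sort ls)" by (metis rev_rev_ident)
  qed
qed

lemma length_eigenvalues: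
  assumes "hyperbolic h e" "homogeneous d h"
  shows "length (eigenvalues h e x) = d"
proof -
  have ev: "line_poly h e x = smult (eval_rpoly h e) (\<Prod>l\<leftarrow>eigenvalues h e x. [:- l, 1:])"
    using theI'[OF eigenvalues_ex1[OF assms(1), of x]] by (simp add: eigenvalues_def)
  have "degree (\<Prod>l\<leftarrow>ls. [:- l, 1:]) = length ls" for ls :: "real list"
  proof (induction ls)
    case (Cons a ls)
    have "(\<Prod>l\<leftarrow>ls. [:- l, 1:]) \<noteq> 0" by (auto simp: prod_list_zero_iff)
    then show ?case using Cons by (simp add: degree_mult_eq del: mult_pCons_left)
  qed simp
  then have "degree (line_poly h e x) = length (eigenvalues h e x)"
    using ev assms(1) by (simp add: hyperbolic_def)
  then show ?thesis using line_poly_degree(1)[of d h e x] assms by (simp add: hyperbolic_def)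
qed

end

theory Submission
  imports Defs "HOL-Library.Function_Algebras"
begin

text \<open>
  Let \<open>P\<close> be the product of \<open>k\<close> copies of \<open>h\<close>, and let \<open>x\<^sub>i\<^sub>j\<close> be \<open>k u\<^sub>i\<close> placed in the \<open>j\<close>-th copy. The averages
  \<open>v\<^sub>i\<close> of \<open>x\<^sub>i\<^sub>1, \<dots>, x\<^sub>i\<^sub>k\<close> have trace at most \<open>k \<epsilon>\<close> and rank at most \<open>r k\<close>, and they sum up to the direction \<open>e'\<close>
  of \<open>P\<close>. If \<open>f\<close> is hyperbolic and \<open>v\<close> is in its closed cone, then \<open>f - y D\<^sub>v f\<close> is hyperbolic in the
  variables including \<open>y\<close>, and its cone consists for \<open>y \<ge> 0\<close> of the points of the cone of \<open>f\<close> where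
  \<open>y\<close> times the barrier \<open>D\<^sub>v f / f\<close> is less than 1. Starting from a multiple of \<open>e'\<close>, where the barriers
  are traces, one applies these operators for \<open>v\<^sub>1, \<dots>, v\<^sub>m\<close> one after the other; shifting the point by
  \<open>\<delta> v\<^sub>i\<close> keeps the other barriers from growing, because \<open>D\<^sub>v f / f\<close> has along \<open>v\<^sub>i\<close> a partial fraction
  decomposition with nonnegative coefficients and at most \<open>r k\<close> poles. Convexity of the cone then
  shows that \<open>T e'\<close> with all \<open>y\<^sub>i = 1\<close> is in the cone of the mixed polynomial for every \<open>T\<close> above the
  bound. Finally the operators are removed again: the barrier of \<open>v\<^sub>i\<close> is the average of the barriers
  of the \<open>x\<^sub>i\<^sub>j\<close>, so one of the latter is less than 1, and subtracting this \<open>x\<^sub>i\<^sub>j\<close> from the point does not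
  leave the cone. This leads to \<open>T e' - \<Sum> x\<^sub>i\<^sub>\<sigma>\<^sub>(\<^sub>i\<^sub>)\<close> in the cone of \<open>P\<close>, which is the assertion.
\<close>

section \<open>Real polynomial functions of complex vectors\<close>

text \<open>The coordinates are the weights of the \<open>u i\<close> in the copies of
  \<open>h\<close>, not the coordinates of \<open>real ^ 'n\<close>: the direction \<open>e'\<close>
  becomes an all-ones vector and each \<open>x_ij\<close> a multiple of a unit vector. Vectors are
  functions on an arbitrary index type, which leaves room for the auxiliary variables. The obstacle
  is to carry the rank through the operators. It is the degree of \<open>f\<close> along
  \<open>v_i\<close>, and it is read off from the growth of \<open>f\<close> on a ray. Up to the
  constant, growth bounds do not depend on the base point, and they pass to
  \<open>f - y D_v f\<close>, which is at most \<open>f\<close> on the cone of \<open>f\<close>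
  where \<open>y \<ge> 0\<close>. The signs in the partial fractions come from the upper half-plane:
  \<open>D_v f / f\<close> has imaginary part at most 0 at \<open>x + \<i> w\<close> for
  \<open>w\<close> in the cone. The factor \<open>1 / k\<close> undoes the scaling in
  \<open>x_ij = k u_i\<close>. The bound is an infimum, and a pair \<open>(\<delta>, \<mu>)\<close>
  only serves the \<open>T\<close> strictly above its value; as there are finitely many partitions,
  a best one satisfies the bound itself.\<close>

instantiation "fun" :: (type, real_vector) real_vector
begin

definition scaleR_fun :: "real \<Rightarrow> ('a \<Rightarrow> 'b) \<Rightarrow> 'a \<Rightarrow> 'b" where
  "scaleR_fun c f = (\<lambda>x. c *\<^sub>R f x)"

instance
  by standard (simp_all add: scaleR_fun_def fun_eq_iff scaleR_add_right scaleR_add_left)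

end

text \<open>Vectors stay atomic for the simplifier; identities between them are proved pointwise with \<open>vec_simps\<close>.\<close>

declare plus_fun_apply [simp del] minus_apply [simp del] zero_fun_apply [simp del]

lemma scaleR_fun_apply: "(c *\<^sub>R f) x = c *\<^sub>R f x"
  by (simp add: scaleR_fun_def)

lemma sum_fun_apply: "(\<Sum>i\<in>A. f i) x = (\<Sum>i\<in>A. f i x)"
  for f :: "'i \<Rightarrow> 'a \<Rightarrow> 'b :: comm_monoid_add"
  by (induction A rule: infinite_finite_induct) (auto simp: plus_fun_apply zero_fun_apply)

definition cvec :: "('j \<Rightarrow> real) \<Rightarrow> 'j \<Rightarrow> complex" where
  "cvec x = (\<lambda>j. complex_of_real (x j))"

definition cscale :: "complex \<Rightarrow> ('j \<Rightarrow> complex) \<Rightarrow> 'j \<Rightarrow> complex" (infixr "*\<^sub>C" 75) where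
  "c *\<^sub>C z = (\<lambda>j. c * z j)"

lemma cvec_apply: "cvec x j = complex_of_real (x j)" by (simp add: cvec_def)
lemma cscale_apply: "(c *\<^sub>C z) j = c * z j" by (simp add: cscale_def)

lemmas vec_simps = plus_fun_apply minus_apply zero_fun_apply scaleR_fun_apply fun_eq_iff cvec_apply cscale_apply

text \<open>Polynomials with real coefficients, as functions. The index type is arbitrary: besides the
  variables that weight the given vectors there is one auxiliary variable per vector.\<close>

inductive polyfn :: "(('j \<Rightarrow> complex) \<Rightarrow> complex) \<Rightarrow> bool" where
  const: "polyfn (\<lambda>z. complex_of_real c)"
| coord: "polyfn (\<lambda>z. z j)"
| add: "polyfn f \<Longrightarrow> polyfn g \<Longrightarrow> polyfn (\<lambda>z. f z + g z)"
| mult: "polyfn f \<Longrightarrow> polyfn g \<Longrightarrow> polyfn (\<lambda>z. f z * g z)"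

lemma polyfn_diff: assumes "polyfn f" "polyfn g" shows "polyfn (\<lambda>z. f z - g z)"
  using polyfn.add[OF assms(1) polyfn.mult[OF polyfn.const[of "-1"] assms(2)]] by simp

lemma polyfn_sum: "(\<And>i. i \<in> A \<Longrightarrow> polyfn (f i)) \<Longrightarrow> polyfn (\<lambda>z. \<Sum>i\<in>A. f i z)"
  by (induction A rule: infinite_finite_induct) (auto intro: polyfn.add polyfn.const[of 0, simplified])

lemma polyfn_prod: "(\<And>i. i \<in> A \<Longrightarrow> polyfn (f i)) \<Longrightarrow> polyfn (\<lambda>z. \<Prod>i\<in>A. f i z)"
  by (induction A rule: infinite_finite_induct) (auto intro: polyfn.mult polyfn.const[of 1, simplified])

lemma polyfn_power: "polyfn f \<Longrightarrow> polyfn (\<lambda>z. f z ^ n)"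
  by (induction n) (auto intro: polyfn.mult polyfn.const[of 1, simplified])

text \<open>Stated along curves \<open>g\<close> that are continuous in each coordinate, so that no
  topology on the space of vectors enters.\<close>

lemma polyfn_continuous_on:
  "polyfn f \<Longrightarrow> (\<And>j. continuous_on S (\<lambda>u. g u j)) \<Longrightarrow> continuous_on S (\<lambda>u. f (g u))"
  by (induction rule: polyfn.induct) (auto intro!: continuous_intros)

lemma polyfn_cnj: "polyfn f \<Longrightarrow> f (\<lambda>j. cnj (z j)) = cnj (f z)"
  by (induction rule: polyfn.induct) auto

definition reval :: "(('j \<Rightarrow> complex) \<Rightarrow> complex) \<Rightarrow> ('j \<Rightarrow> real) \<Rightarrow> real" where
  "reval f x = Re (f (cvec x))"

lemma polyfn_real: assumes "polyfn f" shows "f (cvec x) = complex_of_real (reval f x)"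
proof -
  have "cnj (f (cvec x)) = f (cvec x)"
    using polyfn_cnj[OF assms, of "cvec x"] by (simp add: cvec_def)
  then show ?thesis unfolding reval_def by (metis Reals_cnj_iff of_real_Re)
qed

lemma reval_eq_0_iff: "polyfn f \<Longrightarrow> f (cvec x) = 0 \<longleftrightarrow> reval f x = 0"
  by (simp add: polyfn_real)

lemma polyfn_line: assumes "polyfn f" shows "\<exists>p. \<forall>\<tau>. f (z + \<tau> *\<^sub>C a) = poly p \<tau>"
  using assms
proof induction
  case (const c) show ?case by (rule exI[of _ "[:of_real c:]"]) simp
next
  case (coord j) show ?case by (rule exI[of _ "[:z j, a j:]"]) (simp add: cscale_apply plus_fun_apply)
next
  case (add f g)
  then obtain p q where "\<forall>\<tau>. f (z + \<tau> *\<^sub>C a) = poly p \<tau>" "\<forall>\<tau>. g (z + \<tau> *\<^sub>C a) = poly q \<tau>" by blast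
  then show ?case by (intro exI[of _ "p + q"]) (simp only: poly_add, simp)
next
  case (mult f g)
  then obtain p q where "\<forall>\<tau>. f (z + \<tau> *\<^sub>C a) = poly p \<tau>" "\<forall>\<tau>. g (z + \<tau> *\<^sub>C a) = poly q \<tau>" by blast
  then show ?case by (intro exI[of _ "p * q"]) (simp only: poly_mult, simp)
qed

abbreviation rpoly_cx :: "real poly \<Rightarrow> complex poly" where
  "rpoly_cx \<equiv> map_poly complex_of_real"

lemma rpoly_cx_add: "rpoly_cx (p + q) = rpoly_cx p + rpoly_cx q"
  by (intro poly_eqI) (simp add: coeff_map_poly)

lemma rpoly_cx_mult: "rpoly_cx (p * q) = rpoly_cx p * rpoly_cx q"
  by (intro poly_eqI) (simp add: coeff_map_poly coeff_mult)

lemma poly_rpoly_cx_of_real: "poly (rpoly_cx p) (of_real s) = of_real (poly p s)"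
  by (simp add: poly_altdef degree_map_poly coeff_map_poly)

lemma polyfn_real_line:
  assumes "polyfn f" shows "\<exists>p. \<forall>\<tau>. f (cvec x + \<tau> *\<^sub>C cvec a) = poly (rpoly_cx p) \<tau>"
  using assms
proof induction
  case (const c) show ?case by (rule exI[of _ "[:c:]"]) (simp add: map_poly_pCons)
next
  case (coord j) show ?case by (rule exI[of _ "[:x j, a j:]"]) (simp add: vec_simps map_poly_pCons)
next
  case (add f g)
  then obtain p q where "\<forall>\<tau>. f (cvec x + \<tau> *\<^sub>C cvec a) = poly (rpoly_cx p) \<tau>"
    "\<forall>\<tau>. g (cvec x + \<tau> *\<^sub>C cvec a) = poly (rpoly_cx q) \<tau>" by blast
  then show ?case by (intro exI[of _ "p + q"]) (simp only: rpoly_cx_add poly_add, simp)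
next
  case (mult f g)
  then obtain p q where "\<forall>\<tau>. f (cvec x + \<tau> *\<^sub>C cvec a) = poly (rpoly_cx p) \<tau>"
    "\<forall>\<tau>. g (cvec x + \<tau> *\<^sub>C cvec a) = poly (rpoly_cx q) \<tau>" by blast
  then show ?case by (intro exI[of _ "p * q"]) (simp only: rpoly_cx_mult poly_mult, simp)
qed

section \<open>Directional derivatives of polynomial functions\<close>

definition dir_deriv :: "('j \<Rightarrow> real) \<Rightarrow> (('j \<Rightarrow> complex) \<Rightarrow> complex) \<Rightarrow> ('j \<Rightarrow> complex) \<Rightarrow> complex" where
  "dir_deriv v f z = deriv (\<lambda>\<tau>. f (z + \<tau> *\<^sub>C cvec v)) 0"

lemma dir_deriv_at_0:
  assumes "polyfn f"
  shows "((\<lambda>\<tau>. f (z + \<tau> *\<^sub>C cvec v)) has_field_derivative dir_deriv v f z) (at 0)"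
proof -
  obtain p where p: "\<And>\<tau>. f (z + \<tau> *\<^sub>C cvec v) = poly p \<tau>" using polyfn_line[OF assms] by blast
  have "(\<lambda>\<tau>. f (z + \<tau> *\<^sub>C cvec v)) = poly p" using p by auto
  then show ?thesis unfolding dir_deriv_def using poly_DERIV DERIV_imp_deriv by metis
qed

lemma dir_deriv_eqI:
  assumes "((\<lambda>\<tau>. f (z + \<tau> *\<^sub>C cvec v)) has_field_derivative D) (at 0)"
  shows "dir_deriv v f z = D"
  using assms unfolding dir_deriv_def by (rule DERIV_imp_deriv)

lemma dir_deriv_line:
  assumes "polyfn f"
  shows "((\<lambda>\<tau>. f (z + \<tau> *\<^sub>C cvec v)) has_field_derivative dir_deriv v f (z + s *\<^sub>C cvec v)) (at s)"
proof -
  have "(\<lambda>\<tau>. f (z + s *\<^sub>C cvec v + \<tau> *\<^sub>C cvec v)) = (\<lambda>\<tau>. f (z + (\<tau> + s) *\<^sub>C cvec v))"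
    by (intro ext arg_cong[of _ _ f]) (auto simp: vec_simps algebra_simps)
  then have "((\<lambda>\<tau>. f (z + (\<tau> + s) *\<^sub>C cvec v)) has_field_derivative dir_deriv v f (z + s *\<^sub>C cvec v)) (at 0)"
    using dir_deriv_at_0[OF assms, of "z + s *\<^sub>C cvec v" v] by simp
  then show ?thesis using DERIV_shift[of "\<lambda>\<tau>. f (z + \<tau> *\<^sub>C cvec v)" _ 0 s] by simp
qed

lemma dir_deriv_const: "dir_deriv v (\<lambda>z. c) z = 0"
  by (rule dir_deriv_eqI) simp

lemma dir_deriv_coord: "dir_deriv v (\<lambda>z. z j) z = of_real (v j)"
  by (rule dir_deriv_eqI) (auto simp: vec_simps intro!: derivative_eq_intros)

lemma dir_deriv_add: "polyfn f \<Longrightarrow> polyfn g \<Longrightarrow> dir_deriv v (\<lambda>z. f z + g z) z = dir_deriv v f z + dir_deriv v g z"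
  by (rule dir_deriv_eqI) (auto intro!: derivative_eq_intros dir_deriv_at_0)

lemma dir_deriv_diff: "polyfn f \<Longrightarrow> polyfn g \<Longrightarrow> dir_deriv v (\<lambda>z. f z - g z) z = dir_deriv v f z - dir_deriv v g z"
  by (rule dir_deriv_eqI) (auto intro!: derivative_eq_intros dir_deriv_at_0)

lemma dir_deriv_mult: "polyfn f \<Longrightarrow> polyfn g \<Longrightarrow> dir_deriv v (\<lambda>z. f z * g z) z = dir_deriv v f z * g z + f z * dir_deriv v g z"
proof (rule dir_deriv_eqI)
  assume fg: "polyfn f" "polyfn g"
  have Z: "z + 0 *\<^sub>C cvec v = z" by (simp add: vec_simps)
  from DERIV_mult'[OF dir_deriv_at_0[OF fg(1), of z v] dir_deriv_at_0[OF fg(2), of z v]]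
  show "((\<lambda>\<tau>. f (z + \<tau> *\<^sub>C cvec v) * g (z + \<tau> *\<^sub>C cvec v)) has_field_derivative
    dir_deriv v f z * g z + f z * dir_deriv v g z) (at 0)" 
    by (simp add: Z add.commute)
qed

lemma polyfn_dir_deriv: "polyfn f \<Longrightarrow> polyfn (dir_deriv v f)"
proof (induction rule: polyfn.induct)
  case (const c) then show ?case using polyfn.const[of 0] by (simp add: dir_deriv_const[abs_def])
next
  case (coord j) have "dir_deriv v (\<lambda>z. z j) = (\<lambda>z. of_real (v j))" by (simp add: fun_eq_iff dir_deriv_coord)
  then show ?case using polyfn.const by metis
next
  case (add f g) then have "dir_deriv v (\<lambda>z. f z + g z) = (\<lambda>z. dir_deriv v f z + dir_deriv v g z)"
    by (simp add: fun_eq_iff dir_deriv_add)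
  then show ?case using add polyfn.add by metis
next
  case (mult f g) then have "dir_deriv v (\<lambda>z. f z * g z) = (\<lambda>z. dir_deriv v f z * g z + f z * dir_deriv v g z)"
    by (simp add: fun_eq_iff dir_deriv_mult)
  then show ?case using mult by (auto intro!: polyfn.add polyfn.mult)
qed

text \<open>Structural induction over \<open>polyfn\<close> replaces an analytic argument about
  mixed second derivatives.\<close>

lemma dir_deriv_commute: "polyfn f \<Longrightarrow> dir_deriv v (dir_deriv w f) = dir_deriv w (dir_deriv v f)"
proof (induction rule: polyfn.induct)
  case (const c) then show ?case by (simp add: dir_deriv_const[abs_def])
next
  case (coord j)
  have "dir_deriv u (\<lambda>z. z j) = (\<lambda>z. of_real (u j))" for u by (simp add: fun_eq_iff dir_deriv_coord)
  then show ?case by (simp add: dir_deriv_const[abs_def])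
next
  case (add f g)
  have "dir_deriv u (\<lambda>z. f z + g z) = (\<lambda>z. dir_deriv u f z + dir_deriv u g z)" for u
    using add by (simp add: fun_eq_iff dir_deriv_add)
  moreover have "dir_deriv u (\<lambda>z. dir_deriv u' f z + dir_deriv u' g z) = (\<lambda>z. dir_deriv u (dir_deriv u' f) z + dir_deriv u (dir_deriv u' g) z)" for u u'
    using add by (simp add: fun_eq_iff dir_deriv_add polyfn_dir_deriv)
  ultimately show ?case using add.IH by simp
next
  case (mult f g)
  have 1: "dir_deriv u (\<lambda>z. f z * g z) = (\<lambda>z. dir_deriv u f z * g z + f z * dir_deriv u g z)" for u
    using mult by (simp add: fun_eq_iff dir_deriv_mult)
  have 2: "dir_deriv u (\<lambda>z. dir_deriv u' f z * g z + f z * dir_deriv u' g z) =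
    (\<lambda>z. (dir_deriv u (dir_deriv u' f) z * g z + dir_deriv u' f z * dir_deriv u g z) + (dir_deriv u f z * dir_deriv u' g z + f z * dir_deriv u (dir_deriv u' g) z))" for u u'
    using mult by (simp add: fun_eq_iff dir_deriv_mult dir_deriv_add polyfn_dir_deriv polyfn.mult)
  show ?case unfolding 1 2 using mult.IH by (simp add: fun_eq_iff algebra_simps)
qed

lemma dir_deriv_linear:
  assumes "polyfn f"
  shows "dir_deriv (v + w) f z = dir_deriv v f z + dir_deriv w f z" "dir_deriv (c *\<^sub>R v) f z = of_real c * dir_deriv v f z"
  using assms
  by (induction rule: polyfn.induct)
    (simp_all add: dir_deriv_const dir_deriv_coord dir_deriv_add dir_deriv_mult plus_fun_apply scaleR_fun_apply algebra_simps)

lemma dir_deriv_zero: "polyfn f \<Longrightarrow> dir_deriv 0 f z = 0"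
  using dir_deriv_linear(2)[of f 0 0 z] by simp

lemma dir_deriv_sum_dir: "polyfn f \<Longrightarrow> dir_deriv (\<Sum>i\<in>A. v i) f z = (\<Sum>i\<in>A. dir_deriv (v i) f z)"
  by (induction A rule: infinite_finite_induct) (simp_all add: dir_deriv_zero dir_deriv_linear)

section \<open>Homogeneity\<close>

definition homog :: "nat \<Rightarrow> (('j \<Rightarrow> complex) \<Rightarrow> complex) \<Rightarrow> bool" where
  "homog d f \<longleftrightarrow> (\<forall>c z. f (c *\<^sub>C z) = c ^ d * f z)"

lemma homogD: "homog d f \<Longrightarrow> f (c *\<^sub>C z) = c ^ d * f z" by (simp add: homog_def)

text \<open>The derivative has degree \<open>d - 1\<close>; the factor \<open>c\<close> on the left
  avoids a truncated subtraction for \<open>d = 0\<close>. In \<open>homog_mix_op\<close> this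
  factor is supplied by the variable in front of the derivative.\<close>

lemma homog_dir_deriv:
  assumes "polyfn f" "homog d f" shows "c * dir_deriv v f (c *\<^sub>C z) = c ^ d * dir_deriv v f z"
proof -
  have eq: "(\<lambda>\<tau>. f (c *\<^sub>C z + (c * \<tau>) *\<^sub>C cvec v)) = (\<lambda>\<tau>. c ^ d * f (z + \<tau> *\<^sub>C cvec v))"
  proof
    fix \<tau> have "c *\<^sub>C z + (c * \<tau>) *\<^sub>C cvec v = c *\<^sub>C (z + \<tau> *\<^sub>C cvec v)" by (simp add: vec_simps algebra_simps)
    then show "f (c *\<^sub>C z + (c * \<tau>) *\<^sub>C cvec v) = c ^ d * f (z + \<tau> *\<^sub>C cvec v)"
      using homogD[OF assms(2)] by simp
  qed
  have "((\<lambda>\<tau>. f (c *\<^sub>C z + (c * \<tau>) *\<^sub>C cvec v)) has_field_derivative dir_deriv v f (c *\<^sub>C z) * c) (at 0)"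
    using DERIV_chain2[of "\<lambda>\<tau>. f (c *\<^sub>C z + \<tau> *\<^sub>C cvec v)" "dir_deriv v f (c *\<^sub>C z)" "\<lambda>\<tau>. c * \<tau>" 0 c UNIV]
      dir_deriv_at_0[OF assms(1), of "c *\<^sub>C z" v] by (auto intro!: derivative_eq_intros)
  moreover have "((\<lambda>\<tau>. c ^ d * f (z + \<tau> *\<^sub>C cvec v)) has_field_derivative c ^ d * dir_deriv v f z) (at 0)"
    using DERIV_cmult[OF dir_deriv_at_0[OF assms(1), of z v]] .
  ultimately show ?thesis unfolding eq by (metis DERIV_unique mult.commute)
qed

lemma cvec_scaleR: "cvec (t *\<^sub>R x) = of_real t *\<^sub>C cvec x" by (simp add: vec_simps)

section \<open>Hyperbolicity cones\<close>

lemma poly_eqI_nz: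
  fixes p q :: "complex poly"
  assumes "\<And>\<tau>. \<tau> \<noteq> 0 \<Longrightarrow> poly p \<tau> = poly q \<tau>" shows "p = q"
proof (rule ccontr)
  assume "p \<noteq> q"
  then have "finite {\<tau>. poly (p - q) \<tau> = 0}" by (intro poly_roots_finite) simp
  moreover have "- {0} \<subseteq> {\<tau>. poly (p - q) \<tau> = 0}" using assms by auto
  moreover have "infinite (- {0 :: complex})" by (simp add: Finite_Set.finite_compl infinite_UNIV_char_0)
  ultimately show False using finite_subset by blast
qed

text \<open>By homogeneity \<open>f (z + \<tau> a) = \<tau>^d f (a + z / \<tau>)\<close>. Hence
  \<open>p\<close> is, up to powers of \<tau>, the reversal of the polynomial \<open>r\<close> on
  the line \<open>a + \<sigma> z\<close>, whose constant coefficient \<open>f a\<close> is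
  nonzero.\<close>

lemma line_degree:
  assumes "polyfn f" "homog d f" "f a \<noteq> 0" "\<And>\<tau>. f (z + \<tau> *\<^sub>C a) = poly p \<tau>"
  shows "degree p = d" "lead_coeff p = f a"
proof -
  obtain r where r: "\<And>\<sigma>. f (a + \<sigma> *\<^sub>C z) = poly r \<sigma>" using polyfn_line[OF assms(1)] by blast
  have "a + 0 *\<^sub>C z = a" by (simp add: vec_simps)
  then have r0: "coeff r 0 = f a" using r[of 0] by (simp add: poly_0_coeff_0)
  have "monom 1 (degree r) * p = monom 1 d * reflect_poly r"
  proof (rule poly_eqI_nz)
    fix \<tau> :: complex assume "\<tau> \<noteq> 0"
    then have "z + \<tau> *\<^sub>C a = \<tau> *\<^sub>C (a + inverse \<tau> *\<^sub>C z)" by (simp add: vec_simps field_simps)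
    then have "poly p \<tau> = \<tau> ^ d * poly r (inverse \<tau>)" by (metis assms(2,4) homogD r)
    then show "poly (monom 1 (degree r) * p) \<tau> = poly (monom 1 d * reflect_poly r) \<tau>"
      using \<open>\<tau> \<noteq> 0\<close> by (simp add: poly_monom poly_reflect_poly_nz)
  qed
  note eq = this
  have "p \<noteq> 0" using eq r0 assms(3) by auto
  then have "degree (monom 1 (degree r) * p) = degree r + degree p"
    by (subst degree_mult_eq) (auto simp: degree_monom_eq)
  moreover have "degree (monom 1 d * reflect_poly r) = d + degree r"
    using r0 assms(3) by (subst degree_mult_eq) (auto simp: degree_monom_eq)
  ultimately show "degree p = d" using eq by simp
  show "lead_coeff p = f a" using arg_cong[OF eq, of lead_coeff] r0 assms(3)
    by (simp add: lead_coeff_mult degree_monom_eq coeff_reflect_poly)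
qed

text \<open>With no root above the real axis, each linear factor has norm at least
  \<open>Im \<tau>\<close> at \<tau>. Unlike mere nonvanishing, this bound survives limits.\<close>

lemma norm_poly_ge_power_Im:
  fixes p :: "complex poly"
  assumes "p \<noteq> 0" "\<And>\<rho>. poly p \<rho> = 0 \<Longrightarrow> Im \<rho> \<le> 0" "Im \<tau> \<ge> 0"
  shows "norm (poly p \<tau>) \<ge> norm (lead_coeff p) * Im \<tau> ^ degree p"
proof -
  obtain A where A: "size A = degree p" "p = smult (lead_coeff p) (\<Prod>x\<in>#A. [:-x, 1:])"
    using alg_closed_imp_factorization[OF assms(1)] by blast
  have "Im x \<le> 0" if "x \<in># A" for x
  proof (rule assms(2))
    have "poly (\<Prod>x\<in>#A. [:-x, 1:]) x = 0"
      using that by (induction A) auto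
    then show "poly p x = 0" by (subst A(2)) simp
  qed
  then have "norm (poly (\<Prod>x\<in>#A. [:-x, 1:]) \<tau>) \<ge> Im \<tau> ^ size A"
  proof (induction A)
    case (add x A)
    have "Im \<tau> \<le> Im (\<tau> - x)" using add.prems[of x] by simp
    also have "\<dots> \<le> norm (\<tau> - x)" by (meson abs_Im_le_cmod abs_le_D1)
    finally have "Im \<tau> \<le> norm (\<tau> - x)" .
    then have "Im \<tau> * Im \<tau> ^ size A \<le> norm (\<tau> - x) * norm (poly (\<Prod>x\<in>#A. [:-x, 1:]) \<tau>)"
      using add assms(3) by (intro mult_mono) auto
    then show ?case by (simp add: norm_mult[symmetric] algebra_simps)
  qed simp
  then have "norm (lead_coeff p) * Im \<tau> ^ degree p \<le> norm (lead_coeff p) * norm (poly (\<Prod>x\<in>#A. [:-x, 1:]) \<tau>)"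
    using A(1) by (intro mult_left_mono) auto
  also have "\<dots> = norm (poly p \<tau>)" by (subst (3) A(2)) (simp add: norm_mult)
  finally show ?thesis .
qed

lemma closed_polyfn_zero:
  assumes "polyfn f" "\<And>j. continuous_on UNIV (\<lambda>u. g u j)"
  shows "closed {u. f (g u) = 0}"
  by (intro closed_Collect_eq polyfn_continuous_on[OF assms(1)] assms(2)) auto

text \<open>No root crosses the real line, so no root enters the upper half-plane. The set of bad \<open>\<theta>\<close> is
  closed as the projection of a compact set, the roots \<open>\<tau> = \<beta> / \<alpha>\<close> being kept in a compact set of
  homogeneous coordinates \<open>(\<alpha>, \<beta>)\<close>; its complement is closed because the absence of roots in the
  half-plane amounts to a lower bound on \<open>norm f\<close>.\<close>

lemma half_plane_path:
  assumes f: "polyfn f" "homog d f" and a: "f a \<noteq> 0"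
    and bd: "\<And>\<theta> r. 0 \<le> \<theta> \<Longrightarrow> \<theta> \<le> 1 \<Longrightarrow> f (y + of_real \<theta> *\<^sub>C z + of_real r *\<^sub>C a) \<noteq> 0"
    and start: "\<And>\<tau>. Im \<tau> > 0 \<Longrightarrow> f (y + \<tau> *\<^sub>C a) \<noteq> 0"
    and \<theta>: "0 \<le> \<theta>" "\<theta> \<le> 1" and \<tau>: "Im \<tau> > 0"
  shows "f (y + of_real \<theta> *\<^sub>C z + \<tau> *\<^sub>C a) \<noteq> 0"
proof -
  define w where "w \<theta> = y + complex_of_real \<theta> *\<^sub>C z" for \<theta>
  define bad where "bad = {\<theta>. \<theta> \<in> {0..1} \<and> (\<exists>\<tau>. Im \<tau> > 0 \<and> f (w \<theta> + \<tau> *\<^sub>C a) = 0)}"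
  define good where "good = {\<theta>. \<theta> \<in> {0..1} \<and>
    (\<forall>\<tau>. Im \<tau> > 0 \<longrightarrow> norm (f a) * Im \<tau> ^ d \<le> norm (f (w \<theta> + \<tau> *\<^sub>C a)))}"
  \<comment> \<open>The normalisation \<open>norm \<beta> = 1 - \<alpha>\<close> excludes \<alpha> =
    \<beta> = 0. It admits \<alpha> = 0, a root at infinity, which \<open>f a \<noteq> 0\<close>
    rules out below.\<close>
  define K where "K = (({0..1} \<times> {0..1} \<times> cball 0 1) \<inter> {(\<theta>,\<alpha>,\<beta>). f (of_real \<alpha> *\<^sub>C w \<theta> + \<beta> *\<^sub>C a) = 0})
      \<inter> {(\<theta>,\<alpha>,\<beta>). Im \<beta> \<ge> 0 \<and> norm \<beta> = 1 - \<alpha>}"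
  have "compact K" unfolding K_def
  proof (intro compact_Int_closed compact_Times)
    have "closed {u. f (of_real (fst (snd u)) *\<^sub>C w (fst u) + snd (snd u) *\<^sub>C a) = 0}"
      by (intro closed_polyfn_zero[OF f(1)]) (auto simp: w_def vec_simps intro!: continuous_intros)
    then show "closed {(\<theta>,\<alpha>,\<beta>). f (of_real \<alpha> *\<^sub>C w \<theta> + \<beta> *\<^sub>C a) = 0}" by (simp add: case_prod_unfold)
    have "closed {u :: real \<times> real \<times> complex. Im (snd (snd u)) \<ge> 0 \<and> norm (snd (snd u)) = 1 - fst (snd u)}"
      by (intro closed_Collect_conj closed_Collect_le closed_Collect_eq continuous_intros)
    then show "closed {(\<theta> :: real, \<alpha>,\<beta>). Im \<beta> \<ge> 0 \<and> norm \<beta> = 1 - \<alpha>}" by (simp add: case_prod_unfold)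
  qed auto
  have "bad = fst ` K"
  proof (intro equalityI subsetI)
    fix \<theta> assume "\<theta> \<in> bad"
    then obtain \<tau> where \<tau>: "\<theta> \<in> {0..1}" "Im \<tau> > 0" "f (w \<theta> + \<tau> *\<^sub>C a) = 0" by (auto simp: bad_def)
    define \<alpha> where "\<alpha> = 1 / (1 + norm \<tau>)"
    have pos: "1 + norm \<tau> > 0" by (simp add: add_pos_nonneg)
    have "of_real \<alpha> *\<^sub>C w \<theta> + (of_real \<alpha> * \<tau>) *\<^sub>C a = of_real \<alpha> *\<^sub>C (w \<theta> + \<tau> *\<^sub>C a)"
      by (simp add: vec_simps algebra_simps)
    then have "f (of_real \<alpha> *\<^sub>C w \<theta> + (of_real \<alpha> * \<tau>) *\<^sub>C a) = 0" using \<tau>(3) homogD[OF f(2)] by simp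
    moreover have "\<alpha> > 0" "\<alpha> \<le> 1" "\<alpha> * norm \<tau> = 1 - \<alpha>"
      using pos by (auto simp: \<alpha>_def field_simps)
    moreover from this have "norm (of_real \<alpha> * \<tau>) = 1 - \<alpha>" "Im (of_real \<alpha> * \<tau>) \<ge> 0"
      using \<tau>(2) by (auto simp: norm_mult)
    ultimately have "(\<theta>, \<alpha>, of_real \<alpha> * \<tau>) \<in> K" using \<tau>(1) unfolding K_def by auto
    then show "\<theta> \<in> fst ` K" by force
  next
    fix \<theta> assume "\<theta> \<in> fst ` K"
    then obtain \<alpha> \<beta> where *: "\<theta> \<in> {0..1}" "\<alpha> \<in> {0..1}" "f (of_real \<alpha> *\<^sub>C w \<theta> + \<beta> *\<^sub>C a) = 0"
      "Im \<beta> \<ge> 0" "norm \<beta> = 1 - \<alpha>" by (auto simp: K_def)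
    have "\<alpha> \<noteq> 0"
    proof
      assume "\<alpha> = 0"
      then have "of_real \<alpha> *\<^sub>C w \<theta> + \<beta> *\<^sub>C a = \<beta> *\<^sub>C a" by (simp add: vec_simps)
      then have "\<beta> ^ d * f a = 0" using * homogD[OF f(2)] by metis
      then have "\<beta> = 0" using a by simp
      then show False using *(5) \<open>\<alpha> = 0\<close> by simp
    qed
    then have al: "\<alpha> > 0" using *(2) by simp
    define \<tau> where "\<tau> = \<beta> / of_real \<alpha>"
    have "of_real \<alpha> *\<^sub>C w \<theta> + \<beta> *\<^sub>C a = of_real \<alpha> *\<^sub>C (w \<theta> + \<tau> *\<^sub>C a)"
      using al by (simp add: vec_simps \<tau>_def field_simps)
    then have "of_real \<alpha> ^ d * f (w \<theta> + \<tau> *\<^sub>C a) = 0" using *(3) homogD[OF f(2)] by metis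
    then have z: "f (w \<theta> + \<tau> *\<^sub>C a) = 0" using al by simp
    have "Im \<tau> \<ge> 0" using *(4) al by (simp add: \<tau>_def)
    moreover have "Im \<tau> \<noteq> 0"
    proof
      assume "Im \<tau> = 0"
      then have "\<tau> = of_real (Re \<tau>)" by (simp add: complex_eq_iff)
      then show False using bd[of \<theta> "Re \<tau>"] z *(1) unfolding w_def by auto
    qed
    ultimately show "\<theta> \<in> bad" using z *(1) by (auto simp: bad_def intro!: exI[of _ \<tau>])
  qed
  then have cb: "closed bad" using \<open>compact K\<close>
    by (simp add: compact_imp_closed compact_continuous_image continuous_on_fst)
  have cg: "closed good"
  proof -
    have "good = {0..1} \<inter> (\<Inter>\<tau>\<in>{\<tau>. Im \<tau> > 0}. {\<theta>. norm (f a) * Im \<tau> ^ d \<le> norm (f (w \<theta> + \<tau> *\<^sub>C a))})"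
      by (auto simp: good_def)
    also have "closed \<dots>"
      by (intro closed_Int closed_INT ballI closed_Collect_le polyfn_continuous_on[OF f(1)] continuous_intros)
        (auto simp: w_def vec_simps intro!: continuous_intros)
    finally show ?thesis .
  qed
  have un: "{0..1} \<subseteq> good \<union> bad"
  proof
    fix \<theta> :: real assume \<theta>: "\<theta> \<in> {0..1}"
    obtain p where p: "\<And>\<tau>. f (w \<theta> + \<tau> *\<^sub>C a) = poly p \<tau>" using polyfn_line[OF f(1)] by blast
    note D = line_degree[OF f a p]
    show "\<theta> \<in> good \<union> bad"
    proof (cases "\<theta> \<in> bad")
      case False
      have "p \<noteq> 0" using D(2) a by auto
      have "Im \<rho> \<le> 0" if "poly p \<rho> = 0" for \<rho>
        using that False \<theta> unfolding p[symmetric] bad_def by force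
      then have "norm (f a) * Im \<tau> ^ d \<le> norm (poly p \<tau>)" if "Im \<tau> > 0" for \<tau>
        using norm_poly_ge_power_Im[OF \<open>p \<noteq> 0\<close>, of \<tau>] that D by simp
      then have "\<theta> \<in> good" using \<theta> by (simp add: good_def p)
      then show ?thesis by simp
    qed simp
  qed
  have disj: "good \<inter> bad \<inter> {0..1} = {}"
  proof -
    have False if "\<theta> \<in> good" "\<theta> \<in> bad" for \<theta>
    proof -
      obtain \<tau> where \<tau>: "Im \<tau> > 0" "f (w \<theta> + \<tau> *\<^sub>C a) = 0" using \<open>\<theta> \<in> bad\<close> unfolding bad_def by blast
      then have "norm (f a) * Im \<tau> ^ d \<le> 0" using \<open>\<theta> \<in> good\<close> unfolding good_def by fastforce
      moreover have "norm (f a) * Im \<tau> ^ d > 0" using \<tau> a by simp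
      ultimately show False by linarith
    qed
    then show ?thesis by blast
  qed
  have "0 \<notin> bad"
  proof -
    have "w 0 = y" by (simp add: w_def vec_simps)
    then show ?thesis using start by (auto simp: bad_def)
  qed
  moreover have "(0::real) \<in> {0..1}" by simp
  ultimately have "good \<inter> {0..1} \<noteq> {}" using un by blast
  moreover have "connected {0..1::real}" by simp
  ultimately have "bad \<inter> {0..1} = {}"
    using cb cg un disj unfolding connected_closed by blast
  then have "\<theta> \<notin> bad" using \<theta> by (auto simp: bad_def)
  then show ?thesis using \<theta> \<tau> by (auto simp: bad_def w_def)
qed

text \<open>For homogeneous \<open>f\<close>, having no zero of the form \<open>x + \<i> e\<close> with \<open>x\<close> real is equivalent to
  hyperbolicity with respect to \<open>e\<close> (it includes \<open>f e \<noteq> 0\<close>, by \<open>x = 0\<close>).\<close>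

locale hyp_form =
  fixes f :: "('j \<Rightarrow> complex) \<Rightarrow> complex" and d :: nat and e :: "'j \<Rightarrow> real"
  assumes polyfn: "polyfn f" and homog: "homog d f"
    and hyp: "f (cvec x + \<i> *\<^sub>C cvec e) \<noteq> 0"

text \<open>As \<open>f (a + t e)\<close> is \<open>f e\<close> times the product of the
  \<open>t + \<lambda>\<close> over the eigenvalues \<lambda> of \<open>a\<close>, this says that
  all eigenvalues are positive; excluding only zeros with \<open>t > 0\<close>, as in
  \<open>closed_cone\<close>, says that they are nonnegative.\<close>

definition open_cone :: "(('j \<Rightarrow> complex) \<Rightarrow> complex) \<Rightarrow> ('j \<Rightarrow> real) \<Rightarrow> ('j \<Rightarrow> real) set" where
  "open_cone f e = {a. \<forall>t\<ge>0. f (cvec (a + t *\<^sub>R e)) \<noteq> 0}"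

definition closed_cone :: "(('j \<Rightarrow> complex) \<Rightarrow> complex) \<Rightarrow> ('j \<Rightarrow> real) \<Rightarrow> ('j \<Rightarrow> real) set" where
  "closed_cone f e = {v. \<forall>t>0. f (cvec (v + t *\<^sub>R e)) \<noteq> 0}"

lemma cone_add_e: assumes "a \<in> open_cone f e" "t \<ge> 0" shows "a + t *\<^sub>R e \<in> open_cone f e"
proof -
  have "f (cvec (a + t *\<^sub>R e + s *\<^sub>R e)) \<noteq> 0" if "s \<ge> 0" for s
  proof -
    have "a + t *\<^sub>R e + s *\<^sub>R e = a + (t + s) *\<^sub>R e" by (simp add: scaleR_add_left add.assoc)
    moreover have "f (cvec (a + (t + s) *\<^sub>R e)) \<noteq> 0" using assms that by (simp add: open_cone_def)
    ultimately show ?thesis by metis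
  qed
  then show ?thesis by (simp add: open_cone_def)
qed

lemma closed_coneI: "(\<And>t. t > 0 \<Longrightarrow> v + t *\<^sub>R e \<in> open_cone f e) \<Longrightarrow> v \<in> closed_cone f e"
  by (fastforce simp: open_cone_def closed_cone_def)

lemma closed_cone_add_e: assumes "v \<in> closed_cone f e" "t > 0" shows "v + t *\<^sub>R e \<in> open_cone f e"
proof -
  have "f (cvec (v + t *\<^sub>R e + s *\<^sub>R e)) \<noteq> 0" if "s \<ge> 0" for s
  proof -
    have "v + t *\<^sub>R e + s *\<^sub>R e = v + (t + s) *\<^sub>R e" by (simp add: scaleR_add_left add.assoc)
    moreover have "f (cvec (v + (t + s) *\<^sub>R e)) \<noteq> 0" using assms that by (simp add: closed_cone_def)
    ultimately show ?thesis by metis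
  qed
  then show ?thesis by (simp add: open_cone_def)
qed

lemma cone_nonzero: "a \<in> open_cone f e \<Longrightarrow> f (cvec a) \<noteq> 0"
  unfolding open_cone_def by (metis (mono_tags, lifting) add.right_neutral mem_Collect_eq order_refl scaleR_zero_left)

lemma cone_subset_closed_cone: "open_cone f e \<subseteq> closed_cone f e"
  by (auto simp: open_cone_def closed_cone_def)

section \<open>Change of the hyperbolic direction and convexity of the cone\<close>

context hyp_form
begin

lemma nonzero_e: "f (cvec e) \<noteq> 0"
proof -
  have "cvec 0 + \<i> *\<^sub>C cvec e = \<i> *\<^sub>C cvec e" by (simp add: vec_simps)
  then have "\<i> ^ d * f (cvec e) \<noteq> 0" using hyp[of 0] homogD[OF homog] by metis
  then show ?thesis by auto
qed

lemma e_cone: "e \<in> open_cone f e"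
proof -
  have "f (cvec (e + t *\<^sub>R e)) \<noteq> 0" if "t \<ge> 0" for t
  proof -
    have "cvec (e + t *\<^sub>R e) = of_real (1 + t) *\<^sub>C cvec e" by (simp add: vec_simps algebra_simps)
    then have "f (cvec (e + t *\<^sub>R e)) = of_real (1 + t) ^ d * f (cvec e)" using homogD[OF homog] by metis
    moreover have "complex_of_real (1 + t) \<noteq> 0" using that by (simp del: of_real_add)
    ultimately show ?thesis using nonzero_e by simp
  qed
  then show ?thesis by (simp add: open_cone_def)
qed

lemma cone_scaleR: assumes "a \<in> open_cone f e" "c > 0" shows "c *\<^sub>R a \<in> open_cone f e"
proof -
  have "f (cvec (c *\<^sub>R a + t *\<^sub>R e)) \<noteq> 0" if "t \<ge> 0" for t
  proof -
    have "cvec (c *\<^sub>R a + t *\<^sub>R e) = of_real c *\<^sub>C cvec (a + (t / c) *\<^sub>R e)"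
      using assms by (simp add: vec_simps field_simps)
    then have "f (cvec (c *\<^sub>R a + t *\<^sub>R e)) = of_real c ^ d * f (cvec (a + (t / c) *\<^sub>R e))"
      using homogD[OF homog] by metis
    then show ?thesis using assms that by (simp add: open_cone_def)
  qed
  then show ?thesis by (simp add: open_cone_def)
qed

lemma hyp_complex: assumes "Im \<sigma> \<noteq> 0" shows "f (cvec x + \<sigma> *\<^sub>C cvec e) \<noteq> 0"
proof -
  define x' where "x' = (1 / Im \<sigma>) *\<^sub>R (x + Re \<sigma> *\<^sub>R e)"
  have "cvec x + \<sigma> *\<^sub>C cvec e = of_real (Im \<sigma>) *\<^sub>C (cvec x' + \<i> *\<^sub>C cvec e)"
    using assms by (simp add: vec_simps x'_def field_simps complex_eq_iff)
  then have "f (cvec x + \<sigma> *\<^sub>C cvec e) = of_real (Im \<sigma>) ^ d * f (cvec x' + \<i> *\<^sub>C cvec e)"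
    using homogD[OF homog] by metis
  then show ?thesis using assms hyp by simp
qed

lemma cone_complex:
  assumes "a \<in> open_cone f e" "Im \<sigma> \<noteq> 0 \<or> Re \<sigma> \<ge> 0" shows "f (cvec a + \<sigma> *\<^sub>C cvec e) \<noteq> 0"
proof (cases "Im \<sigma> = 0")
  case True
  then have "cvec a + \<sigma> *\<^sub>C cvec e = cvec (a + Re \<sigma> *\<^sub>R e)" by (simp add: vec_simps complex_eq_iff)
  then show ?thesis using assms True by (simp add: open_cone_def)
qed (use hyp_complex in blast)

text \<open>The zeros \<tau> of \<open>f (e + \<tau> a)\<close> are reciprocals of zeros \<sigma> of
  \<open>f (a + \<sigma> e)\<close>, hence negative reals.\<close>

lemma cone_complex_reciprocal:
  assumes "a \<in> open_cone f e" "Im \<tau> \<noteq> 0 \<or> Re \<tau> > 0" shows "f (cvec e + \<tau> *\<^sub>C cvec a) \<noteq> 0"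
proof -
  have "\<tau> \<noteq> 0" using assms(2) by auto
  then have "cvec e + \<tau> *\<^sub>C cvec a = \<tau> *\<^sub>C (cvec a + (inverse \<tau>) *\<^sub>C cvec e)"
    by (simp add: vec_simps field_simps)
  then have "f (cvec e + \<tau> *\<^sub>C cvec a) = \<tau> ^ d * f (cvec a + inverse \<tau> *\<^sub>C cvec e)"
    using homogD[OF homog] by metis
  moreover have "Im (inverse \<tau>) \<noteq> 0 \<or> Re (inverse \<tau>) \<ge> 0" using assms(2) \<open>\<tau> \<noteq> 0\<close>
    by (auto simp: complex_eq_iff)
  ultimately show ?thesis using cone_complex[OF assms(1), of "inverse \<tau>"] \<open>\<tau> \<noteq> 0\<close> by (metis mult_eq_0_iff power_not_zero)
qed

text \<open>Homotopy from \<open>\<i> e + \<tau> a\<close>, whose roots are explicit, to \<open>x + \<i> e + \<tau> a\<close>.\<close>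

lemma garding_aux:
  assumes a: "a \<in> open_cone f e" and "Im \<tau> \<ge> 0"
  shows "f (cvec x + \<i> *\<^sub>C cvec e + \<tau> *\<^sub>C cvec a) \<noteq> 0"
proof -
  have re: "f (\<i> *\<^sub>C cvec e + of_real \<theta> *\<^sub>C cvec x + of_real r *\<^sub>C cvec a) \<noteq> 0" for \<theta> r
  proof -
    have "\<i> *\<^sub>C cvec e + of_real \<theta> *\<^sub>C cvec x + of_real r *\<^sub>C cvec a
      = cvec (\<theta> *\<^sub>R x + r *\<^sub>R a) + \<i> *\<^sub>C cvec e" by (simp add: vec_simps)
    then show ?thesis using hyp by metis
  qed
  \<comment> \<open>The real part of \<open>- \<i> * \<tau>\<close> is \<open>Im \<tau>\<close>, so
    the upper half-plane is turned into the right half-plane, where the reciprocal form has no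
    zeros.\<close>
  have start: "f (\<i> *\<^sub>C cvec e + \<tau> *\<^sub>C cvec a) \<noteq> 0" if "Im \<tau> > 0" for \<tau>
  proof -
    have "\<i> *\<^sub>C cvec e + \<tau> *\<^sub>C cvec a = \<i> *\<^sub>C (cvec e + (- \<i> * \<tau>) *\<^sub>C cvec a)" by (simp add: vec_simps algebra_simps)
    then have "f (\<i> *\<^sub>C cvec e + \<tau> *\<^sub>C cvec a) = \<i> ^ d * f (cvec e + (- \<i> * \<tau>) *\<^sub>C cvec a)"
      using homogD[OF homog] by metis
    then show ?thesis using cone_complex_reciprocal[OF a, of "- \<i> * \<tau>"] that by simp
  qed
  show ?thesis
  proof (cases "Im \<tau> = 0")
    case True
    then have "\<tau> = of_real (Re \<tau>)" by (simp add: complex_eq_iff)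
    then show ?thesis using re[of 1 "Re \<tau>"] by (simp add: add.commute cscale_def)
  next
    case False
    have "f (\<i> *\<^sub>C cvec e + of_real 1 *\<^sub>C cvec x + \<tau> *\<^sub>C cvec a) \<noteq> 0"
    proof (rule half_plane_path[OF polyfn homog cone_nonzero[OF a] re start])
      show "Im \<tau> > 0" using False assms(2) by simp
    qed simp_all
    moreover have "\<i> *\<^sub>C cvec e + of_real 1 *\<^sub>C cvec x + \<tau> *\<^sub>C cvec a = cvec x + \<i> *\<^sub>C cvec e + \<tau> *\<^sub>C cvec a"
      by (simp add: vec_simps)
    ultimately show ?thesis by metis
  qed
qed

text \<open>The summand \<open>\<i> e\<close> of \<open>garding_aux\<close> is scaled by \<beta>,
  and \<beta> tends to 0. Nonvanishing could get lost in the limit; the lower bound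
  \<open>norm (f a)\<close>, uniform in \<beta>, cannot.\<close>

lemma hyp_form_open_cone: assumes a: "a \<in> open_cone f e" shows "hyp_form f d a"
proof
  fix x
  have ge: "norm (f (cvec a)) \<le> norm (f (cvec x + of_real \<beta> *\<^sub>C \<i> *\<^sub>C cvec e + \<i> *\<^sub>C cvec a))" if "\<beta> > 0" for \<beta>
  proof -
    obtain p where p: "\<And>\<tau>. f (cvec x + of_real \<beta> *\<^sub>C \<i> *\<^sub>C cvec e + \<tau> *\<^sub>C cvec a) = poly p \<tau>"
      using polyfn_line[OF polyfn] by blast
    note D = line_degree[OF polyfn homog cone_nonzero[OF a] p]
    have "p \<noteq> 0" using D cone_nonzero[OF a] by auto
    have "Im \<rho> \<le> 0" if "poly p \<rho> = 0" for \<rho>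
    proof (rule ccontr)
      assume "\<not> Im \<rho> \<le> 0"
      have "cvec x + of_real \<beta> *\<^sub>C \<i> *\<^sub>C cvec e + \<rho> *\<^sub>C cvec a =
        of_real \<beta> *\<^sub>C (cvec ((1/\<beta>) *\<^sub>R x) + \<i> *\<^sub>C cvec e + (\<rho> / of_real \<beta>) *\<^sub>C cvec a)"
        using \<open>\<beta> > 0\<close> by (simp add: vec_simps field_simps)
      then have "of_real \<beta> ^ d * f (cvec ((1/\<beta>) *\<^sub>R x) + \<i> *\<^sub>C cvec e + (\<rho> / of_real \<beta>) *\<^sub>C cvec a) = 0"
        using that p homogD[OF homog] by metis
      then show False using garding_aux[OF a, of "\<rho> / of_real \<beta>"] \<open>\<beta> > 0\<close> \<open>\<not> Im \<rho> \<le> 0\<close> by simp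
    qed
    from norm_poly_ge_power_Im[OF \<open>p \<noteq> 0\<close> this, of \<i>] show ?thesis using D p by simp
  qed
  define g where "g \<beta> = norm (f (cvec x + complex_of_real \<beta> *\<^sub>C \<i> *\<^sub>C cvec e + \<i> *\<^sub>C cvec a))" for \<beta>
  have "continuous_on UNIV g" unfolding g_def
    by (intro continuous_on_norm polyfn_continuous_on[OF polyfn]) (auto simp: vec_simps intro!: continuous_intros)
  then have "isCont g 0" by (simp add: continuous_on_eq_continuous_at)
  then have "(g \<longlongrightarrow> g 0) (at_right 0)" unfolding isCont_def by (rule tendsto_within_subset) simp
  moreover have "eventually (\<lambda>\<beta>. norm (f (cvec a)) \<le> g \<beta>) (at_right 0)"
    unfolding eventually_at_right_field g_def using ge by (intro exI[of _ 1]) simp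
  ultimately have "norm (f (cvec a)) \<le> norm (f (cvec x + complex_of_real 0 *\<^sub>C \<i> *\<^sub>C cvec e + \<i> *\<^sub>C cvec a))"
    unfolding g_def by (rule tendsto_lowerbound) simp
  moreover have "cvec x + complex_of_real 0 *\<^sub>C \<i> *\<^sub>C cvec e + \<i> *\<^sub>C cvec a = cvec x + \<i> *\<^sub>C cvec a"
    by (simp add: vec_simps)
  ultimately show "f (cvec x + \<i> *\<^sub>C cvec a) \<noteq> 0" using cone_nonzero[OF a]
    by (metis norm_le_zero_iff norm_zero)
qed (use polyfn homog in auto)

text \<open>Homotopy from \<open>e\<close> to a point \<open>a\<close> of the cone: the roots \<open>\<tau>\<close> of \<open>f (a + \<tau> b)\<close> are real and cannot
  pass through \<open>0\<close>, hence stay negative.\<close>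

lemma cone_add: assumes a: "a \<in> open_cone f e" and b: "b \<in> open_cone f e" shows "a + b \<in> open_cone f e"
proof -
  have "f (cvec (a + b + t *\<^sub>R e)) \<noteq> 0" if "t \<ge> 0" for t
  proof -
    define a' where "a' = a + t *\<^sub>R e"
    have a': "a' \<in> open_cone f e" using cone_add_e[OF a that] by (simp add: a'_def)
    interpret b: hyp_form f d b using hyp_form_open_cone[OF b] .
    have seg: "f (cvec (e + \<theta> *\<^sub>R (a' - e))) \<noteq> 0" if "0 \<le> \<theta>" "\<theta> \<le> 1" for \<theta>
    proof (cases "\<theta> = 0")
      case False
      have "e + \<theta> *\<^sub>R (a' - e) = \<theta> *\<^sub>R (a' + ((1 - \<theta>) / \<theta>) *\<^sub>R e)" using False
        by (simp add: vec_simps field_simps)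
      moreover have "\<theta> *\<^sub>R (a' + ((1 - \<theta>) / \<theta>) *\<^sub>R e) \<in> open_cone f e"
        using False that by (intro cone_scaleR cone_add_e a') auto
      ultimately show ?thesis using cone_nonzero by metis
    qed (use nonzero_e in simp)
    \<comment> \<open>The rotation by \<open>- \<i>\<close> brings the right half-plane of
      coefficients of \<open>b\<close> to the upper half-plane of \<open>half_plane_path\<close>;
      the coefficient \<open>\<i>\<close> of \<open>B\<close> stands for \<open>b\<close>
      itself.\<close>
    define B where "B = (- \<i>) *\<^sub>C cvec b"
    have "f (cvec e + of_real 1 *\<^sub>C cvec (a' - e) + \<i> *\<^sub>C B) \<noteq> 0"
    proof (rule half_plane_path[OF polyfn homog])
      show "f B \<noteq> 0" unfolding B_def using cone_nonzero[OF b] by (simp add: homogD[OF homog])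
    next
      fix \<theta> r :: real assume \<theta>: "0 \<le> \<theta>" "\<theta> \<le> 1"
      have "cvec e + of_real \<theta> *\<^sub>C cvec (a' - e) + of_real r *\<^sub>C B = cvec (e + \<theta> *\<^sub>R (a' - e)) + (- \<i> * of_real r) *\<^sub>C cvec b"
        by (simp add: vec_simps B_def algebra_simps)
      moreover have "f (cvec (e + \<theta> *\<^sub>R (a' - e)) + (- \<i> * of_real r) *\<^sub>C cvec b) \<noteq> 0"
      proof (cases "r = 0")
        case True
        then have "cvec (e + \<theta> *\<^sub>R (a' - e)) + (- \<i> * of_real r) *\<^sub>C cvec b = cvec (e + \<theta> *\<^sub>R (a' - e))"
          by (simp add: vec_simps)
        then show ?thesis using seg[OF \<theta>] by simp
      qed (use b.hyp_complex in simp)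
      ultimately show "f (cvec e + of_real \<theta> *\<^sub>C cvec (a' - e) + of_real r *\<^sub>C B) \<noteq> 0" by metis
    next
      fix \<tau> :: complex assume "Im \<tau> > 0"
      have "cvec e + \<tau> *\<^sub>C B = cvec e + (- \<i> * \<tau>) *\<^sub>C cvec b" by (simp add: vec_simps B_def)
      then show "f (cvec e + \<tau> *\<^sub>C B) \<noteq> 0" using cone_complex_reciprocal[OF b, of "- \<i> * \<tau>"] \<open>Im \<tau> > 0\<close> by simp
    qed auto
    moreover have "cvec e + of_real 1 *\<^sub>C cvec (a' - e) + \<i> *\<^sub>C B = cvec (a + b + t *\<^sub>R e)"
      by (simp add: vec_simps B_def a'_def)
    ultimately show ?thesis by simp
  qed
  then show ?thesis by (simp add: open_cone_def)
qed

lemma cone_sum: "finite A \<Longrightarrow> A \<noteq> {} \<Longrightarrow> (\<And>i. i \<in> A \<Longrightarrow> x i \<in> open_cone f e) \<Longrightarrow> (\<Sum>i\<in>A. x i) \<in> open_cone f e"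
  by (induction A rule: finite_ne_induct) (auto intro: cone_add)

lemma nbhd_nonzero:
  assumes "f (cvec x) \<noteq> 0"
  shows "\<exists>\<eta>>0. \<forall>t. \<bar>t\<bar> \<le> \<eta> \<longrightarrow> f (cvec (x + t *\<^sub>R w)) \<noteq> 0"
proof -
  have "open (- {t. f (cvec (x + t *\<^sub>R w)) = 0})"
    by (intro open_Compl closed_polyfn_zero[OF polyfn]) (auto simp: vec_simps intro!: continuous_intros)
  moreover have "0 \<in> - {t. f (cvec (x + t *\<^sub>R w)) = 0}" using assms by simp
  ultimately obtain \<eta> where "\<eta> > 0" "cball 0 \<eta> \<subseteq> - {t. f (cvec (x + t *\<^sub>R w)) = 0}"
    using open_contains_cball_eq by blast
  then show ?thesis by (intro exI[of _ \<eta>]) (auto simp: subset_iff)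
qed

lemma cone_minus_e: assumes "a \<in> open_cone f e" shows "\<exists>\<alpha>>0. a - \<alpha> *\<^sub>R e \<in> open_cone f e"
proof -
  obtain \<eta> where \<eta>: "\<eta> > 0" "\<And>t. \<bar>t\<bar> \<le> \<eta> \<Longrightarrow> f (cvec (a + t *\<^sub>R e)) \<noteq> 0"
    using nbhd_nonzero[OF cone_nonzero[OF assms], of e] by blast
  have "f (cvec (a - \<eta> *\<^sub>R e + t *\<^sub>R e)) \<noteq> 0" if "t \<ge> 0" for t
  proof -
    have "a - \<eta> *\<^sub>R e + t *\<^sub>R e = a + (t - \<eta>) *\<^sub>R e" by (simp add: algebra_simps)
    moreover have "f (cvec (a + (t - \<eta>) *\<^sub>R e)) \<noteq> 0"
      using \<eta> that assms by (cases "t \<le> \<eta>") (auto simp: open_cone_def)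
    ultimately show ?thesis by metis
  qed
  then show ?thesis using \<eta>(1) by (auto simp: open_cone_def)
qed

text \<open>Small perturbations of \<open>e\<close> along \<open>v\<close> are no zeros of
  \<open>f\<close>; by homogeneity neither are the points \<open>s e - v\<close> for large
  \<open>s\<close>.\<close>

lemma cone_e_minus: "\<exists>\<beta>>0. \<beta> *\<^sub>R e - v \<in> open_cone f e"
proof -
  obtain \<eta> where \<eta>: "\<eta> > 0" "\<And>t. \<bar>t\<bar> \<le> \<eta> \<Longrightarrow> f (cvec (e + t *\<^sub>R v)) \<noteq> 0"
    using nbhd_nonzero[OF nonzero_e, of v] by blast
  have "f (cvec ((1 / \<eta>) *\<^sub>R e - v + t *\<^sub>R e)) \<noteq> 0" if "t \<ge> 0" for t
  proof -
    define s where "s = 1 / \<eta> + t"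
    have "1 / \<eta> > 0" "1 / \<eta> \<le> s" using that \<eta>(1) by (auto simp: s_def)
    then have s: "s > 0" "1 / s \<le> \<eta>" using frac_le[of 1 1 "1 / \<eta>" s] by (linarith, simp)
    have "cvec ((1 / \<eta>) *\<^sub>R e - v + t *\<^sub>R e) = of_real s *\<^sub>C cvec (e + (- (1 / s)) *\<^sub>R v)"
      using s by (simp add: vec_simps field_simps) (simp add: s_def algebra_simps)
    then have "f (cvec ((1 / \<eta>) *\<^sub>R e - v + t *\<^sub>R e)) = of_real s ^ d * f (cvec (e + (- (1 / s)) *\<^sub>R v))"
      using homogD[OF homog] by metis
    moreover have "f (cvec (e + (- (1 / s)) *\<^sub>R v)) \<noteq> 0" by (rule \<eta>(2)) (use s in simp)
    ultimately show ?thesis using s(1) by simp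
  qed
  then have "(1 / \<eta>) *\<^sub>R e - v \<in> open_cone f e" by (simp only: open_cone_def mem_Collect_eq) blast
  moreover have "1 / \<eta> > 0" using \<eta>(1) by simp
  ultimately show ?thesis by blast
qed

lemma cone_add_closed_cone: assumes a: "a \<in> open_cone f e" and v: "v \<in> closed_cone f e" shows "a + v \<in> open_cone f e"
proof -
  obtain \<alpha> where "\<alpha> > 0" "a - \<alpha> *\<^sub>R e \<in> open_cone f e" using cone_minus_e[OF a] by blast
  then have "(a - \<alpha> *\<^sub>R e) + (v + \<alpha> *\<^sub>R e) \<in> open_cone f e" using closed_cone_add_e[OF v, of \<alpha>] cone_add by blast
  then show ?thesis by (simp add: algebra_simps)
qed

lemma closed_cone_scaleR: assumes "v \<in> closed_cone f e" "c \<ge> 0" shows "c *\<^sub>R v \<in> closed_cone f e"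
proof (rule closed_coneI)
  fix t :: real assume "t > 0"
  show "c *\<^sub>R v + t *\<^sub>R e \<in> open_cone f e"
  proof (cases "c = 0")
    case False
    then have "c *\<^sub>R v + t *\<^sub>R e = c *\<^sub>R (v + (t / c) *\<^sub>R e)" by (simp add: algebra_simps)
    then show ?thesis using closed_cone_add_e[OF assms(1), of "t / c"] False assms(2) \<open>t > 0\<close> cone_scaleR by simp
  qed (use \<open>t > 0\<close> cone_scaleR[OF e_cone] in simp)
qed

lemma closed_cone_add: assumes "v \<in> closed_cone f e" "w \<in> closed_cone f e" shows "v + w \<in> closed_cone f e"
proof (rule closed_coneI)
  fix t :: real assume "t > 0"
  have "v + t *\<^sub>R e + w \<in> open_cone f e" using cone_add_closed_cone[OF closed_cone_add_e[OF assms(1) \<open>t > 0\<close>] assms(2)] .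
  then show "v + w + t *\<^sub>R e \<in> open_cone f e" by (simp add: algebra_simps)
qed

lemma zero_closed_cone: "0 \<in> closed_cone f e"
  using closed_cone_scaleR[of e 0] e_cone cone_subset_closed_cone by (metis order_refl scaleR_zero_left subsetD)

lemma closed_cone_sum: "(\<And>i. i \<in> A \<Longrightarrow> x i \<in> closed_cone f e) \<Longrightarrow> (\<Sum>i\<in>A. x i) \<in> closed_cone f e"
  by (induction A rule: infinite_finite_induct) (simp_all add: closed_cone_add zero_closed_cone)

text \<open>The point \<open>a\<close> dominates some \<alpha> e with \<alpha> > 0, and a multiple
  of \<open>e\<close> dominates \<open>v\<close>. So every point of the open cone is an order unit,
  which allows base points to be compared in \<open>line_growth\<close>.\<close>

lemma cone_absorb: assumes a: "a \<in> open_cone f e" shows "\<exists>C\<ge>1. C *\<^sub>R a - v \<in> open_cone f e"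
proof -
  obtain \<alpha> where \<alpha>: "\<alpha> > 0" "a - \<alpha> *\<^sub>R e \<in> open_cone f e" using cone_minus_e[OF a] by blast
  obtain \<beta> where \<beta>: "\<beta> > 0" "\<beta> *\<^sub>R e - v \<in> open_cone f e" using cone_e_minus by blast
  have "(\<beta> / \<alpha>) *\<^sub>R (a - \<alpha> *\<^sub>R e) + (\<beta> *\<^sub>R e - v) \<in> open_cone f e"
    using cone_add[OF cone_scaleR[OF \<alpha>(2)] \<beta>(2), of "\<beta> / \<alpha>"] \<alpha>(1) \<beta>(1) by simp
  also have "(\<beta> / \<alpha>) *\<^sub>R (a - \<alpha> *\<^sub>R e) + (\<beta> *\<^sub>R e - v) = (\<beta> / \<alpha>) *\<^sub>R a - v"
    using \<alpha>(1) by (simp add: algebra_simps)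
  finally have "(\<beta> / \<alpha>) *\<^sub>R a - v + 1 *\<^sub>R a \<in> open_cone f e" using cone_add[OF _ a] by (simp only: scaleR_one)
  moreover have "(\<beta> / \<alpha>) *\<^sub>R a - v + 1 *\<^sub>R a = (\<beta> / \<alpha> + 1) *\<^sub>R a - v" by (simp add: algebra_simps)
  moreover have "\<beta> / \<alpha> + 1 \<ge> 1" using \<alpha>(1) \<beta>(1) by simp
  ultimately show ?thesis by metis
qed

end

section \<open>Univariate real-rooted polynomials\<close>

lemma Im_of_real_mult: "Im (complex_of_real t * z) = t * Im z"
  by simp

lemma poly_lin_mult: "poly ([:b, 1:] * M) s = (s + b) * poly M s" for s :: "'a :: idom"
  by (simp add: algebra_simps)

lemma poly_pderiv_lin_mult:
  "poly (pderiv ([:b, 1:] * M)) s = poly M s + (s + b) * poly (pderiv M) s" for s :: "'a :: idom"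
  unfolding pderiv_mult by (simp add: pderiv_pCons algebra_simps)

lemma poly_cx_lin_mult: "poly (rpoly_cx ([:b, 1:] * M)) z = (z + of_real b) * poly (rpoly_cx M) z"
  unfolding rpoly_cx_mult by (simp add: map_poly_pCons algebra_simps)

text \<open>Roots are recorded by their negatives, which are positive on lines through the
  cone.\<close>

definition linprod :: "real list \<Rightarrow> real poly" where
  "linprod bs = (\<Prod>b\<leftarrow>bs. [:b, 1:])"

lemma linprod_Nil [simp]: "linprod [] = 1"
  and linprod_Cons: "linprod (b # bs) = [:b, 1:] * linprod bs"
  by (simp_all add: linprod_def)

lemma linprod_remove1: "b \<in> set bs \<Longrightarrow> linprod bs = [:b, 1:] * linprod (remove1 b bs)"
  by (induction bs) (auto simp: linprod_Cons simp del: mult_pCons_left)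

lemma linprod_nz: "linprod bs \<noteq> 0"
  by (auto simp: linprod_def prod_list_zero_iff)

lemma degree_linprod: "degree (linprod bs) = length bs"
  by (induction bs) (auto simp: linprod_Cons degree_mult_eq linprod_nz simp del: mult_pCons_left)

lemma lead_coeff_linprod: "coeff (linprod bs) (length bs) = 1"
proof -
  have "lead_coeff (linprod bs) = 1"
    by (induction bs) (auto simp: linprod_Cons lead_coeff_mult simp del: mult_pCons_left)
  then show ?thesis by (simp add: degree_linprod)
qed

lemma poly_linprod: "poly (linprod bs) s = (\<Prod>b\<leftarrow>bs. s + b)"
  by (induction bs) (auto simp: linprod_Cons add.commute simp del: mult_pCons_left)

lemma poly_linprod_eq_0: "poly (linprod bs) s = 0 \<longleftrightarrow> - s \<in> set bs"
proof -
  have "s + b = 0 \<longleftrightarrow> b = - s" for b by auto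
  then show ?thesis by (auto simp: poly_linprod prod_list_zero_iff)
qed

lemma linprod_pos: "(\<And>b. b \<in> set bs \<Longrightarrow> b > 0) \<Longrightarrow> s \<ge> 0 \<Longrightarrow> poly (linprod bs) s > 0"
  unfolding poly_linprod by (induction bs) (auto intro!: mult_pos_pos add_nonneg_pos)

lemma pderiv_linprod:
  "(\<And>b. b \<in> set bs \<Longrightarrow> s + b \<noteq> 0) \<Longrightarrow>
    poly (pderiv (linprod bs)) s = poly (linprod bs) s * (\<Sum>b\<leftarrow>bs. 1 / (s + b))"
proof (induction bs)
  case (Cons b bs)
  have "poly (pderiv (linprod (b # bs))) s = poly (linprod bs) s + (s + b) * poly (pderiv (linprod bs)) s"
    unfolding linprod_Cons by (rule poly_pderiv_lin_mult)
  moreover have "poly (linprod (b # bs)) s = (s + b) * poly (linprod bs) s"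
    unfolding linprod_Cons by (rule poly_lin_mult)
  ultimately show ?case using Cons by (simp add: field_simps)
qed (simp add: pderiv_1)

lemma linprod_count: "linprod bs = [:b, 1:] ^ count_list bs b * linprod (removeAll b bs)"
  by (induction bs) (auto simp: linprod_Cons mult_ac simp del: mult_pCons_left)

text \<open>Directions \<open>cis (\<pi> / 2N)\<close> and \<open>cis (3 \<pi> / 2N)\<close> at a pole of order \<open>N \<ge> 2\<close> give opposite signs.\<close>

lemma herglotz_root:
  fixes p r :: "real poly"
  assumes N: "N \<ge> 1" and nz: "poly p (-b) \<noteq> 0" "poly r (-b) \<noteq> 0"
    and Im: "\<And>z. Im z > 0 \<Longrightarrow> Im (poly (rpoly_cx p) z * cnj (poly (rpoly_cx ([:b, 1:] ^ N * r)) z)) \<le> 0"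
  shows "N = 1 \<and> poly p (-b) * poly r (-b) \<ge> 0"
proof -
  \<comment> \<open>Near the pole put \<open>z = - b + t w\<close>. Dividing by the positive
    \<open>t ^ N\<close> and letting \<open>t\<close> tend to 0 leaves the sign of the leading term,
    for every direction \<open>w\<close> of the upper half-plane.\<close>
  have lim: "poly p (-b) * poly r (-b) * Im (cnj (w ^ N)) \<le> 0" if w: "Im w > 0" for w
  proof -
    define g where "g t = Im (poly (rpoly_cx p) (of_real (-b) + of_real t * w) *
      cnj (w ^ N * poly (rpoly_cx r) (of_real (-b) + of_real t * w)))" for t :: real
    have "continuous_on UNIV g" unfolding g_def by (intro continuous_intros)
    then have "isCont g 0" by (simp add: continuous_on_eq_continuous_at)
    then have "(g \<longlongrightarrow> g 0) (at_right 0)" unfolding isCont_def by (rule tendsto_within_subset) simp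
    moreover have "eventually (\<lambda>t. g t \<le> 0) (at_right 0)"
      unfolding eventually_at_right_field
    proof (intro exI[of _ 1] conjI allI impI)
      fix t :: real assume t: "0 < t" "t < 1"
      let ?z = "of_real (-b) + of_real t * w"
      have lin: "poly (rpoly_cx ([:b, 1:] ^ N)) z = (z + of_real b) ^ N" for z
        by (induction N) (auto simp: rpoly_cx_mult map_poly_pCons add.commute simp del: mult_pCons_left)
      have "poly (rpoly_cx ([:b, 1:] ^ N * r)) ?z = of_real (t ^ N) * (w ^ N * poly (rpoly_cx r) ?z)"
        by (simp add: rpoly_cx_mult lin power_mult_distrib)
      then have "Im (of_real (t ^ N) * (poly (rpoly_cx p) ?z * cnj (w ^ N * poly (rpoly_cx r) ?z))) \<le> 0"
        using Im[of ?z] t w by (simp add: mult_ac)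
      then have "t ^ N * g t \<le> 0" unfolding g_def by (simp only: Im_of_real_mult)
      moreover have "t ^ N > 0" using t by simp
      ultimately show "g t \<le> 0" by (simp add: mult_le_0_iff)
    qed simp
    ultimately have "g 0 \<le> 0" by (rule tendsto_upperbound) simp
    moreover have "g 0 = poly p (-b) * poly r (-b) * Im (cnj (w ^ N))"
      by (simp add: g_def poly_rpoly_cx_of_real flip: of_real_minus) 
    ultimately show ?thesis by simp
  qed
  show ?thesis
  proof (cases "N = 1")
    case True
    then show ?thesis using lim[of \<i>] by (simp add: True)
  next
    case False
    then have N2: "N \<ge> 2" using N by simp
    define \<phi> where "\<phi> = pi / (2 * real N)"
    have \<phi>: "0 < \<phi>" "3 * \<phi> < pi" "real N * \<phi> = pi / 2" using N2 pi_gt_zero by (auto simp: \<phi>_def field_simps)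
    have "Im (cis \<phi>) > 0" "Im (cis (3 * \<phi>)) > 0" using \<phi> by (auto intro!: sin_gt_zero)
    moreover have "cis \<phi> ^ N = \<i>" by (simp only: Complex.DeMoivre \<phi>(3) cis_pi_half)
    moreover have "cis (3 * \<phi>) ^ N = - \<i>"
    proof -
      have "real N * (3 * \<phi>) = real 3 * (pi / 2)" by (subst \<phi>(3)[symmetric]) simp
      then have "cis (3 * \<phi>) ^ N = cis (pi / 2) ^ 3" by (simp only: Complex.DeMoivre)
      then show ?thesis by (simp add: eval_nat_numeral)
    qed
    ultimately have "poly p (-b) * poly r (-b) = 0" using lim[of "cis \<phi>"] lim[of "cis (3 * \<phi>)"] by simp
    then show ?thesis using nz by simp
  qed
qed

text \<open>The quotient \<open>p / linprod bs\<close> maps the upper half-plane to the closed lower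
  one, so its poles are simple with nonnegative residues, and by the degree bound it has a finite
  value \<open>c0\<close> at infinity. Repeated entries of \<open>bs\<close> are possible because
  common zeros are cancelled first; each value still contributes only one term.\<close>

lemma herglotz_partial_fractions:
  fixes p :: "real poly"
  assumes "degree p \<le> length bs"
    and "\<And>z. Im z > 0 \<Longrightarrow> Im (poly (rpoly_cx p) z * cnj (poly (rpoly_cx (linprod bs)) z)) \<le> 0"
  shows "\<exists>c0 c. (\<forall>b. c b \<ge> 0) \<and>
    p = smult c0 (linprod bs) + (\<Sum>b\<in>set bs. smult (c b) (linprod (remove1 b bs)))"
  using assms
proof (induction "length bs" arbitrary: bs p)
  case 0
  then have "degree p = 0" by simp
  then obtain a where "p = [:a:]" using degree_eq_zeroE by blast
  then show ?case using 0 by (intro exI[of _ a] exI[of _ "\<lambda>_. 0"]) (simp add: one_pCons)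
next
  case (Suc n)
  show ?case
  proof (cases "\<exists>b\<in>set bs. poly p (-b) = 0")
    case True
    then obtain b where b: "b \<in> set bs" "poly p (-b) = 0" by blast
    then obtain p1 where p1: "p = [:b, 1:] * p1" by (metis dvdE minus_minus poly_eq_0_iff_dvd)
    define bs' where "bs' = remove1 b bs"
    have len: "n = length bs'" using b Suc.hyps(2) by (simp add: bs'_def length_remove1)
    have L: "linprod bs = [:b, 1:] * linprod bs'" unfolding bs'_def using b linprod_remove1 by blast
    have "degree p1 \<le> length bs'"
    proof (cases "p1 = 0")
      case False
      then have "degree p = Suc (degree p1)" unfolding p1 by (subst degree_mult_eq) auto
      then show ?thesis using Suc.prems(1) Suc.hyps(2) len by simp
    qed simp
    moreover have "Im (poly (rpoly_cx p1) z * cnj (poly (rpoly_cx (linprod bs')) z)) \<le> 0" if "Im z > 0" for z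
    proof -
      have "z + of_real b \<noteq> 0" using that by (auto simp: complex_eq_iff)
      then have pos: "(cmod (z + of_real b))\<^sup>2 > 0" by simp
      have "poly (rpoly_cx p) z * cnj (poly (rpoly_cx (linprod bs)) z) =
        (z + of_real b) * cnj (z + of_real b) * (poly (rpoly_cx p1) z * cnj (poly (rpoly_cx (linprod bs')) z))"
        unfolding p1 L poly_cx_lin_mult by simp
      also have "\<dots> = of_real ((cmod (z + of_real b))\<^sup>2) * (poly (rpoly_cx p1) z * cnj (poly (rpoly_cx (linprod bs')) z))"
        using complex_norm_square[of "z + of_real b"] by simp
      finally have "(cmod (z + of_real b))\<^sup>2 * Im (poly (rpoly_cx p1) z * cnj (poly (rpoly_cx (linprod bs')) z)) \<le> 0"
        using Suc.prems(2)[OF that] by (simp only: Im_of_real_mult)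
      then show ?thesis using pos by (simp add: mult_le_0_iff)
    qed
    ultimately obtain c0 c where c: "\<And>b. c b \<ge> 0"
      "p1 = smult c0 (linprod bs') + (\<Sum>b\<in>set bs'. smult (c b) (linprod (remove1 b bs')))"
      using Suc.hyps(1)[OF len] by blast
    \<comment> \<open>The cancelled \<open>b\<close> need not occur in \<open>bs'\<close> any more;
      its coefficient is then 0.\<close>
    define c' where "c' x = (if x \<in> set bs' then c x else 0)" for x
    have "p = smult c0 ([:b, 1:] * linprod bs') + (\<Sum>x\<in>set bs'. smult (c x) ([:b, 1:] * linprod (remove1 x bs')))"
      unfolding p1 by (subst c(2)) (simp only: distrib_left sum_distrib_left mult_smult_right)
    also have "(\<Sum>x\<in>set bs'. smult (c x) ([:b, 1:] * linprod (remove1 x bs'))) =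
      (\<Sum>x\<in>set bs'. smult (c' x) (linprod (remove1 x bs)))"
    proof (rule sum.cong[OF refl])
      fix x assume x: "x \<in> set bs'"
      have "b \<in> set (remove1 x bs)"
        using b(1) x by (cases "x = b") (auto simp: bs'_def in_set_remove1)
      then have "linprod (remove1 x bs) = [:b, 1:] * linprod (remove1 b (remove1 x bs))"
        by (rule linprod_remove1)
      then show "smult (c x) ([:b, 1:] * linprod (remove1 x bs')) = smult (c' x) (linprod (remove1 x bs))"
        using x by (simp add: c'_def bs'_def remove1_commute del: mult_pCons_left)
    qed
    also have "\<dots> = (\<Sum>x\<in>set bs. smult (c' x) (linprod (remove1 x bs)))"
      by (rule sum.mono_neutral_left) (auto simp: c'_def bs'_def notin_set_remove1 dest: set_remove1_subset[THEN subsetD])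
    finally show ?thesis using c(1) L by (intro exI[of _ c0] exI[of _ c']) (simp add: c'_def del: mult_pCons_left)
  next
    case False
    have one: "count_list bs b = 1 \<and> poly p (-b) * poly (linprod (removeAll b bs)) (-b) \<ge> 0" if "b \<in> set bs" for b
    proof (rule herglotz_root)
      show "count_list bs b \<ge> 1" using that count_list_0_iff[of bs b] by simp
      show "poly p (-b) \<noteq> 0" using False that by blast
      show "poly (linprod (removeAll b bs)) (-b) \<noteq> 0" by (simp add: poly_linprod_eq_0)
    qed (use Suc.prems(2) linprod_count[of bs b] in simp)
    then have dist: "distinct bs"
      by (auto simp: distinct_count_atmost_1 count_mset count_list_0_iff)
    define c where "c b = (if b \<in> set bs then poly p (-b) / poly (linprod (remove1 b bs)) (-b) else 0)" for b
    have cpos: "c b \<ge> 0" for b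
      using one[of b] dist by (auto simp: c_def distinct_remove1_removeAll zero_le_divide_iff zero_le_mult_iff)
    \<comment> \<open>Without common zeros the entries are distinct and \<open>c b\<close> is the
      residue at \<open>- b\<close>. Both sides have degree at most \<open>length bs\<close>, the
      same coefficient there, and the same values at the \<open>length bs\<close> points
      \<open>- b\<close>.\<close>
    have "p = smult (coeff p (length bs)) (linprod bs) + (\<Sum>b\<in>set bs. smult (c b) (linprod (remove1 b bs)))" (is "_ = ?R")
    proof (rule poly_eqI_degree_lead_coeff)
      have "coeff (linprod (remove1 b bs)) (length bs) = 0" if "b \<in> set bs" for b
        using length_pos_if_in_set[OF that] that by (intro coeff_eq_0) (simp add: degree_linprod length_remove1)
      then show "coeff p (length bs) = coeff ?R (length bs)" by (simp add: coeff_sum lead_coeff_linprod)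
      show "length bs \<le> card (uminus ` set bs)" by (simp add: card_image distinct_card[OF dist])
      show "degree p \<le> length bs" by fact
      show "degree ?R \<le> length bs"
        by (intro degree_add_le degree_sum_le order.trans[OF degree_smult_le])
          (auto simp: degree_linprod length_remove1)
      fix z assume "z \<in> uminus ` set bs"
      then obtain b where b: "b \<in> set bs" "z = - b" by blast
      have "(\<Sum>x\<in>set bs. c x * poly (linprod (remove1 x bs)) z) = (\<Sum>x\<in>{b}. c x * poly (linprod (remove1 x bs)) z)"
      proof (rule sum.mono_neutral_right)
        show "\<forall>x\<in>set bs - {b}. c x * poly (linprod (remove1 x bs)) z = 0"
          using b by (auto simp: poly_linprod_eq_0 in_set_remove1)
      qed (use b in auto)
      also have "\<dots> = poly p z"
        using b dist by (simp add: c_def poly_linprod_eq_0 )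
      finally show "poly p z = poly ?R z" using b by (simp add: poly_sum poly_linprod_eq_0)
    qed
    then show ?thesis using cpos by blast
  qed
qed

text \<open>Jensen's inequality, through the tangent of \<open>x / (1 + \<delta> x)\<close> at \<open>S / N\<close>.\<close>

lemma sum_concave_bound:
  fixes \<delta> S :: real
  assumes "\<And>x. x \<in> set xs \<Longrightarrow> x > 0" "length xs \<le> N" "N \<ge> 1" "sum_list xs \<le> S" "S > 0" "\<delta> > 0"
  shows "(\<Sum>x\<leftarrow>xs. x / (1 + \<delta> * x)) \<le> S / (1 + \<delta> * S / N)"
proof -
  define y where "y = S / N"
  have y: "y > 0" "S = N * y" using assms by (auto simp: y_def)
  define A where "A = \<delta> * y\<^sup>2 / (1 + \<delta> * y)\<^sup>2"
  define B where "B = 1 / (1 + \<delta> * y)\<^sup>2"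
  have pos: "1 + \<delta> * y > 0" using y assms by (simp add: add_pos_pos)
  have AB: "A \<ge> 0" "B \<ge> 0" using assms by (auto simp: A_def B_def)
  have tan: "x / (1 + \<delta> * x) \<le> A + B * x" if "x > 0" for x
  proof -
    have px: "1 + \<delta> * x > 0" using that assms by (simp add: add_pos_pos)
    have "A + B * x - x / (1 + \<delta> * x) = \<delta> * (x - y)\<^sup>2 / ((1 + \<delta> * y)\<^sup>2 * (1 + \<delta> * x))"
      using px pos by (simp add: A_def B_def divide_simps) (simp add: power2_eq_square algebra_simps)
    also have "\<dots> \<ge> 0" using px assms by (intro divide_nonneg_nonneg mult_nonneg_nonneg) auto
    finally show ?thesis by simp
  qed
  have "(\<Sum>x\<leftarrow>xs. x / (1 + \<delta> * x)) \<le> length xs * A + B * sum_list xs"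
    using assms(1)
  proof (induction xs)
    case (Cons a xs)
    then have "a / (1 + \<delta> * a) + (\<Sum>x\<leftarrow>xs. x / (1 + \<delta> * x)) \<le> (A + B * a) + (length xs * A + B * sum_list xs)"
      using tan[of a] by (intro add_mono) auto
    then show ?case by (simp add: algebra_simps)
  qed simp
  also have "\<dots> \<le> N * A + B * S"
    using assms AB by (intro add_mono mult_right_mono mult_left_mono) auto
  also have "\<dots> = N * (A + B * y)" using y by (simp add: algebra_simps)
  also have "A + B * y = y / (1 + \<delta> * y)"
    using pos by (simp add: A_def B_def divide_simps) (simp add: power2_eq_square algebra_simps)
  finally show ?thesis using y assms(3) by simp
qed

section \<open>Consequences of the conditions defining \<open>U\<close>\<close>

lemma power_diff_ge: "(a :: real) \<ge> 0 \<Longrightarrow> (1 + a) ^ n - a ^ n \<ge> real n * a ^ (n - 1)"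
proof (induction n)
  case (Suc n)
  have "a ^ n \<le> (1 + a) ^ n" using Suc.prems by (intro power_mono) auto
  moreover have "a * ((1 + a) ^ n - a ^ n) \<ge> a * (real n * a ^ (n - 1))"
    using Suc by (intro mult_left_mono) auto
  moreover have "a * (real n * a ^ (n - 1)) = real n * a ^ n" by (cases n) auto
  moreover have "(1 + a) ^ Suc n - a ^ Suc n = ((1 + a) ^ n - a ^ n) + a * ((1 + a) ^ n - a ^ n) + a ^ n"
    by (simp add: algebra_simps)
  moreover have "(1 + a) ^ n - a ^ n \<ge> 0" using calculation(1) by simp
  ultimately have "(1 + a) ^ Suc n - a ^ Suc n \<ge> real n * a ^ n + a ^ n" by linarith
  then show ?case by (simp add: algebra_simps)
qed simp

text \<open>For \<open>r = n + 1\<close> and \<open>a = \<delta> / (r \<mu>)\<close> the term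
  \<open>(n + 1) a / n\<close> is \<open>\<delta> / (\<mu> (r - 1))\<close>. The right side is thus
  the factor that Jensen's inequality yields for \<open>r - 1\<close> poles, and the left side is
  the ratio in \<open>U r\<close>.\<close>

lemma U_ratio_ge:
  fixes a :: real
  assumes "a \<ge> 0" "n \<ge> 1"
  shows "((1 + a) ^ n - a ^ n) / ((1 + a) ^ Suc n - a ^ Suc n) \<ge> 1 / (1 + (real n + 1) * a / n)"
proof -
  define S where "S = (1 + a) ^ n - a ^ n"
  have T: "(1 + a) ^ Suc n - a ^ Suc n = S * (1 + a) + a ^ n" by (simp add: S_def algebra_simps)
  have S: "S \<ge> n * a ^ (n - 1)" using power_diff_ge[OF assms(1)] by (simp add: S_def)
  have "a ^ n < (1 + a) ^ n" using assms by (intro power_strict_mono) auto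
  then have Tpos: "S * (1 + a) + a ^ n > 0" using assms by (auto simp: S_def intro!: add_pos_nonneg mult_pos_pos)
  have "a * (n * a ^ (n - 1)) \<le> a * S" using S assms by (intro mult_left_mono) auto
  moreover have "a * (n * a ^ (n - 1)) = n * a ^ n" using assms(2) by (cases n) auto
  ultimately have "n * a ^ n \<le> a * S" by linarith
  then have "a ^ n \<le> a * S / n" using assms by (simp add: field_simps)
  then have "S * (1 + a) + a ^ n \<le> S * (1 + (real n + 1) * a / n)"
    using assms by (simp add: field_simps)
  moreover have "1 + (real n + 1) * a / n > 0" using assms by (intro add_pos_nonneg) auto
  ultimately show ?thesis unfolding T S_def[symmetric] using Tpos by (simp add: divide_simps mult.commute)
qed

text \<open>Jensen's inequality bounds the sum by \<open>1 / (\<mu> + \<delta> / r)\<close>, and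
  both alternatives in the last condition of \<open>U r\<close> make this less than 1. It ensures
  that the shifted point with new variable 1 lies in the cone of the mixed polynomial.\<close>

lemma U_sum_less_1:
  assumes U: "(\<delta>, \<mu>) \<in> U r" and r: "r \<ge> 1"
    and bs: "\<And>b. b \<in> set bs \<Longrightarrow> b > 0" "length bs \<le> r" "(\<Sum>b\<leftarrow>bs. 1 / b) \<le> 1 / \<mu>"
  shows "(\<Sum>b\<leftarrow>bs. 1 / (\<delta> + b)) < 1"
proof -
  have pos: "\<delta> > 0" "\<mu> > 0" using U by (auto simp: U_def)
  have "(\<Sum>b\<leftarrow>bs. 1 / (\<delta> + b)) = (\<Sum>x\<leftarrow>map (\<lambda>b. 1 / b) bs. x / (1 + \<delta> * x))"
    unfolding map_map comp_def
  proof (intro arg_cong[of _ _ sum_list] map_cong refl)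
    fix b assume "b \<in> set bs"
    then show "1 / (\<delta> + b) = 1 / b / (1 + \<delta> * (1 / b))" using bs(1)[of b] pos by (simp add: field_simps)
  qed
  also have "\<dots> \<le> (1 / \<mu>) / (1 + \<delta> * (1 / \<mu>) / r)"
    using bs pos r by (intro sum_concave_bound) auto
  also have "\<dots> < 1"
  proof -
    have "\<mu> > 1 \<or> \<mu> > 1 - \<delta> / r" using U by (auto simp: U_def)
    moreover have "\<delta> / r > 0" using pos r by simp
    ultimately have "\<mu> + \<delta> / r > 1" using pos by linarith
    moreover have "(1 / \<mu>) / (1 + \<delta> * (1 / \<mu>) / r) = 1 / (\<mu> + \<delta> / r)" using pos r by (simp add: field_simps)
    ultimately show ?thesis by simp
  qed
  finally show ?thesis .
qed

text \<open>This is all that the barrier argument needs from the inequality defining \<open>U r\<close>; it is weaker than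
  that inequality by \<open>U_ratio_ge\<close>.\<close>

lemma U_sum_others:
  assumes U: "(\<delta>, \<mu>) \<in> U r" and r: "r \<ge> 1"
    and bs: "\<And>b. b \<in> set bs \<Longrightarrow> b > 0" "length bs \<le> r - 1" "(\<Sum>b\<leftarrow>bs. 1 / b) \<le> 1 / \<mu>"
  shows "\<delta> * (\<Sum>b\<leftarrow>bs. 1 / (\<delta> + b)) \<le> \<delta> - 1"
proof (cases "r = 1")
  case True
  \<comment> \<open>There are no other poles, and for \<open>r = 1\<close> the numerator in
    \<open>U\<close> is \<open>1 - 1\<close>, which leaves \<delta> \<ge> 1.\<close>
  then show ?thesis using U bs by (auto simp: U_def)
next
  case False
  then obtain n where n: "r = Suc n" "n \<ge> 1" using r by (cases r) auto
  have pos: "\<delta> > 0" "\<mu> > 0" using U by (auto simp: U_def)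
  define a where "a = \<delta> / (real r * \<mu>)"
  have a: "a \<ge> 0" using pos by (simp add: a_def)
  have "(\<Sum>b\<leftarrow>bs. 1 / (\<delta> + b)) = (\<Sum>x\<leftarrow>map (\<lambda>b. 1 / b) bs. x / (1 + \<delta> * x))"
    unfolding map_map comp_def
  proof (intro arg_cong[of _ _ sum_list] map_cong refl)
    fix b assume "b \<in> set bs"
    then show "1 / (\<delta> + b) = 1 / b / (1 + \<delta> * (1 / b))" using bs(1)[of b] pos by (simp add: field_simps)
  qed
  also have "\<dots> \<le> (1 / \<mu>) / (1 + \<delta> * (1 / \<mu>) / n)"
    using bs pos n by (intro sum_concave_bound) auto
  also have "\<delta> * (1 / \<mu>) / n = (real n + 1) * a / n"
  proof -
    have "(real n + 1) * a = \<delta> / \<mu>" using n(1) by (simp add: a_def add.commute)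
    then show ?thesis by simp
  qed
  also have "(1 / \<mu>) / (1 + (real n + 1) * a / n) = (1 / \<mu>) * (1 / (1 + (real n + 1) * a / n))" by simp
  also have "\<dots> \<le> (1 / \<mu>) * (((1 + a) ^ n - a ^ n) / ((1 + a) ^ Suc n - a ^ Suc n))"
    using U_ratio_ge[OF a n(2)] pos by (intro mult_left_mono) auto
  finally have "\<delta> * (\<Sum>b\<leftarrow>bs. 1 / (\<delta> + b)) \<le> \<delta> * ((1 / \<mu>) * (((1 + a) ^ n - a ^ n) / ((1 + a) ^ Suc n - a ^ Suc n)))"
    using pos by (intro mult_left_mono) auto
  also have "\<dots> \<le> \<delta> - 1" using U n unfolding a_def by (simp add: U_def)
  finally show ?thesis .
qed

text \<open>Both sides are linear in \<open>p\<close> and agree for \<open>p = L\<close>. For \<open>p = L / (s + b)\<close> the claim reduces to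
  \<open>\<delta> - 1 \<ge> \<delta> \<Sum> 1 / (\<delta> + b')\<close>, the sum ranging over the other roots.\<close>

lemma barrier_univariate:
  assumes U: "(\<delta>, \<mu>) \<in> U r" and r: "r \<ge> 1"
    and bs: "\<And>b. b \<in> set bs \<Longrightarrow> b > 0" "length bs \<le> r" "(\<Sum>b\<leftarrow>bs. 1 / b) \<le> 1 / \<mu>"
    and c: "\<And>b. c b \<ge> 0"
    and p: "p = smult c0 (linprod bs) + (\<Sum>b\<in>set bs. smult (c b) (linprod (remove1 b bs)))"
  defines "L \<equiv> linprod bs"
  shows "poly (L - pderiv L) \<delta> > 0"
    and "poly (p - pderiv p) \<delta> * poly L 0 \<le> poly p 0 * poly (L - pderiv L) \<delta>"
proof -
  have \<delta>: "\<delta> > 0" using U by (auto simp: U_def)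
  have nz: "\<delta> + b \<noteq> 0" if "b \<in> set bs" for b using bs(1)[OF that] \<delta> by simp
  have "poly (L - pderiv L) \<delta> = poly L \<delta> * (1 - (\<Sum>b\<leftarrow>bs. 1 / (\<delta> + b)))"
    unfolding L_def using pderiv_linprod[of bs \<delta>] nz by (simp add: algebra_simps)
  then show pos: "poly (L - pderiv L) \<delta> > 0"
    using U_sum_less_1[OF U r bs] linprod_pos[of bs \<delta>] bs(1) \<delta> by (simp add: L_def)
  have each: "poly (linprod (remove1 b bs) - pderiv (linprod (remove1 b bs))) \<delta> * poly L 0
      \<le> poly (linprod (remove1 b bs)) 0 * poly (L - pderiv L) \<delta>" if b: "b \<in> set bs" for b
  proof -
    define M where "M = linprod (remove1 b bs)"
    have sub: "x \<in> set bs" if "x \<in> set (remove1 b bs)" for x using that notin_set_remove1 by metis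
    have LM: "L = [:b, 1:] * M" unfolding L_def M_def using linprod_remove1[OF b] .
    have M0: "poly M 0 > 0" "poly M \<delta> > 0" unfolding M_def using bs(1) sub \<delta> by (auto intro!: linprod_pos)
    have "(\<Sum>x\<leftarrow>bs. 1 / x) = 1 / b + (\<Sum>x\<leftarrow>remove1 b bs. 1 / x)" using b by (rule sum_list_map_remove1)
    then have "(\<Sum>x\<leftarrow>remove1 b bs. 1 / x) \<le> 1 / \<mu>" using bs(1)[OF b] bs(3) by (smt (verit) divide_nonneg_nonneg)
    then have "\<delta> * (\<Sum>x\<leftarrow>remove1 b bs. 1 / (\<delta> + x)) \<le> \<delta> - 1"
      using bs sub b by (intro U_sum_others[OF U r]) (auto simp: length_remove1)
    moreover have "poly (pderiv M) \<delta> = poly M \<delta> * (\<Sum>x\<leftarrow>remove1 b bs. 1 / (\<delta> + x))"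
      unfolding M_def by (intro pderiv_linprod nz sub)
    ultimately have "\<delta> * poly (pderiv M) \<delta> \<le> poly M \<delta> * (\<delta> - 1)"
      using M0 by (metis mult.left_commute mult_le_cancel_left_pos)
    then have *: "poly M \<delta> \<le> \<delta> * poly (M - pderiv M) \<delta>" by (simp add: algebra_simps)
    \<comment> \<open>By \<open>*\<close> the subtracted \<open>M\<close> is at most \<delta> times
      \<open>M - pderiv M\<close> at \<delta>, so the part with factor \<open>b\<close>
      remains.\<close>
    have "poly (L - pderiv L) \<delta> = (\<delta> + b) * poly (M - pderiv M) \<delta> - poly M \<delta>"
      unfolding LM poly_diff poly_pderiv_lin_mult poly_lin_mult by (simp add: algebra_simps)
    then have "b * poly (M - pderiv M) \<delta> \<le> poly (L - pderiv L) \<delta>" using * by (simp add: algebra_simps)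
    then have "poly M 0 * (b * poly (M - pderiv M) \<delta>) \<le> poly M 0 * poly (L - pderiv L) \<delta>"
      using M0 by (intro mult_left_mono) auto
    moreover have "poly L 0 = b * poly M 0" unfolding LM by simp
    ultimately show ?thesis by (simp add: M_def[symmetric] mult_ac)
  qed
  have "poly (p - pderiv p) \<delta> * poly L 0 = c0 * poly (L - pderiv L) \<delta> * poly L 0 +
      (\<Sum>b\<in>set bs. c b * (poly (linprod (remove1 b bs) - pderiv (linprod (remove1 b bs))) \<delta> * poly L 0))"
    unfolding p L_def[symmetric]
    by (simp add: pderiv_add pderiv_smult higher_pderiv_sum[of 1, simplified] poly_sum sum_distrib_left sum_distrib_right algebra_simps sum_subtractf)
  also have "\<dots> \<le> c0 * poly (L - pderiv L) \<delta> * poly L 0 +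
      (\<Sum>b\<in>set bs. c b * (poly (linprod (remove1 b bs)) 0 * poly (L - pderiv L) \<delta>))"
    by (intro add_left_mono sum_mono mult_left_mono each c) auto
  also have "\<dots> = poly p 0 * poly (L - pderiv L) \<delta>"
    unfolding p L_def[symmetric] by (simp add: poly_sum sum_distrib_left sum_distrib_right algebra_simps sum_subtractf)
  finally show "poly (p - pderiv p) \<delta> * poly L 0 \<le> poly p 0 * poly (L - pderiv L) \<delta>" .
qed

section \<open>Degree as growth on the positive half-line\<close>

lemma poly_growth:
  fixes p :: "real poly"
  assumes "degree p \<le> n"
  shows "\<exists>K. \<forall>s\<ge>0. \<bar>poly p s\<bar> \<le> K * (1 + s) ^ n"
proof (intro exI allI impI)
  fix s :: real assume s: "s \<ge> 0"
  have "\<bar>poly p s\<bar> \<le> (\<Sum>i\<le>degree p. \<bar>coeff p i * s ^ i\<bar>)" unfolding poly_altdef by (rule sum_abs)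
  also have "\<dots> \<le> (\<Sum>i\<le>degree p. \<bar>coeff p i\<bar> * (1 + s) ^ n)"
  proof (rule sum_mono)
    fix i assume "i \<in> {..degree p}"
    have "s ^ i \<le> (1 + s) ^ i" using s by (intro power_mono) auto
    also have "\<dots> \<le> (1 + s) ^ n" using \<open>i \<in> _\<close> assms s by (intro power_increasing) auto
    finally show "\<bar>coeff p i * s ^ i\<bar> \<le> \<bar>coeff p i\<bar> * (1 + s) ^ n" using s
      by (simp add: abs_mult mult_left_mono)
  qed
  finally show "\<bar>poly p s\<bar> \<le> (\<Sum>i\<le>degree p. \<bar>coeff p i\<bar>) * (1 + s) ^ n" by (simp add: sum_distrib_right)
qed

text \<open>For a larger degree the quotient of \<open>(1 + s) ^ n\<close> by \<open>p\<close> would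
  tend to 0, against the growth bound.\<close>

lemma degree_le_growth:
  fixes p :: "real poly"
  assumes "\<And>s. s \<ge> 0 \<Longrightarrow> \<bar>poly p s\<bar> \<le> K * (1 + s) ^ n"
  shows "degree p \<le> n"
proof (rule ccontr)
  assume *: "\<not> degree p \<le> n"
  define q where "q = ([:1, 1:] :: real poly) ^ n"
  have dq: "degree q = n" by (simp add: q_def degree_power_eq)
  have "((\<lambda>x. poly q x / poly p x) \<longlongrightarrow> 0) at_infinity"
    using * by (intro poly_divide_tendsto_0_at_infinity) (simp add: dq)
  then have "((\<lambda>x. poly q x / poly p x) \<longlongrightarrow> 0) at_top" by (rule tendsto_mono[OF at_top_le_at_infinity])
  moreover define K' where "K' = \<bar>K\<bar> + 1"
  ultimately have "eventually (\<lambda>x. dist (poly q x / poly p x) 0 < 1 / K') at_top"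
    by (intro tendstoD) auto
  moreover have "finite {x. poly p x = 0}" using * by (intro poly_roots_finite) auto
  then have "eventually (\<lambda>x. poly p x \<noteq> 0) at_top"
    using poly_roots_finite eventually_gt_at_top[of "Max (insert 0 {x. poly p x = 0})"]
    by (auto elim!: eventually_mono)
  ultimately have "eventually (\<lambda>x. dist (poly q x / poly p x) 0 < 1 / K' \<and> poly p x \<noteq> 0 \<and> x \<ge> 0) at_top"
    by (intro eventually_conj eventually_ge_at_top)
  then obtain x where x: "\<bar>poly q x / poly p x\<bar> < 1 / K'" "poly p x \<noteq> 0" "x \<ge> 0"
    by (auto dest!: eventually_happens)
  have q: "poly q x = (1 + x) ^ n" by (simp add: q_def)
  have "\<bar>poly p x\<bar> \<le> K * (1 + x) ^ n" using assms x by simp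
  also have "\<dots> \<le> K' * (1 + x) ^ n" using x(3) by (intro mult_right_mono) (auto simp: K'_def)
  finally have "\<bar>poly p x\<bar> \<le> K' * \<bar>poly q x\<bar>" using x(3) by (simp add: q)
  moreover have "K' * \<bar>poly q x\<bar> < \<bar>poly p x\<bar>" using x(1,2) by (simp add: K'_def field_simps abs_divide)
  ultimately show False by simp
qed

text \<open>The logarithmic derivative of \<open>P\<close> at 0 is the sum of the
  \<open>- 1 / x\<close>, each with negative imaginary part. Equality thus forces \<open>A\<close>
  to be empty and the derivative to be 0. Multiplying by the conjugate has the same sign as dividing
  by \<open>P\<close>.\<close>

lemma Im_logderiv_aux:
  assumes "\<And>x. x \<in># A \<Longrightarrow> Im x < 0"
  defines "P \<equiv> (\<Prod>x\<in>#A. [:-x, 1:])"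
  shows "Im (poly (pderiv P) 0 * cnj (poly P 0)) \<le> 0 \<and>
    (Im (poly (pderiv P) 0 * cnj (poly P 0)) = 0 \<longrightarrow> poly (pderiv P) 0 = 0) \<and> poly P 0 \<noteq> 0"
  using assms(1) unfolding P_def
proof (induction A)
  case empty then show ?case by (simp add: pderiv_1)
next
  case (add x A)
  define Q where "Q = (\<Prod>x\<in>#A. [:-x, 1:])"
  have IH: "Im (poly (pderiv Q) 0 * cnj (poly Q 0)) \<le> 0" "poly Q 0 \<noteq> 0"
    using add unfolding Q_def by auto
  have x: "Im x < 0" using add.prems by simp
  have P: "(\<Prod>x\<in>#add_mset x A. [:-x, 1:]) = [:-x, 1:] * Q" by (simp add: Q_def)
  have "poly (pderiv ([:-x, 1:] * Q)) 0 * cnj (poly ([:-x, 1:] * Q) 0) =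
     (poly Q 0 * cnj (poly Q 0)) * cnj (- x) + (x * cnj x) * (poly (pderiv Q) 0 * cnj (poly Q 0))"
    unfolding pderiv_mult by (simp add: pderiv_pCons algebra_simps)
  also have "\<dots> = of_real ((cmod (poly Q 0))\<^sup>2) * cnj (- x) + of_real ((cmod x)\<^sup>2) * (poly (pderiv Q) 0 * cnj (poly Q 0))"
    by (simp only: complex_norm_square)
  finally have "Im (poly (pderiv ([:-x, 1:] * Q)) 0 * cnj (poly ([:-x, 1:] * Q) 0)) =
    (cmod (poly Q 0))\<^sup>2 * Im x + (cmod x)\<^sup>2 * Im (poly (pderiv Q) 0 * cnj (poly Q 0))"
    by (simp only: plus_complex.sel Im_of_real_mult) simp
  also have "(cmod (poly Q 0))\<^sup>2 * Im x < 0" using IH(2) x by (simp add: mult_pos_neg)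
  then have "(cmod (poly Q 0))\<^sup>2 * Im x + (cmod x)\<^sup>2 * Im (poly (pderiv Q) 0 * cnj (poly Q 0)) < 0"
    using IH(1) by (intro add_neg_nonpos) (auto simp: mult_nonneg_nonpos)
  finally show ?case unfolding P using IH(2) x by auto
qed

lemma Im_logderiv:
  fixes p :: "complex poly"
  assumes "p \<noteq> 0" "\<And>\<rho>. poly p \<rho> = 0 \<Longrightarrow> Im \<rho> < 0"
  shows "Im (poly (pderiv p) 0 * cnj (poly p 0)) \<le> 0"
    and "Im (poly (pderiv p) 0 * cnj (poly p 0)) = 0 \<Longrightarrow> poly (pderiv p) 0 = 0"
proof -
  obtain A where A: "p = smult (lead_coeff p) (\<Prod>x\<in>#A. [:-x, 1:])"
    using alg_closed_imp_factorization[OF assms(1)] by blast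
  define P where "P = (\<Prod>x\<in>#A. [:-x, 1:])"
  have "Im x < 0" if "x \<in># A" for x
  proof (rule assms(2))
    have "poly (\<Prod>x\<in>#A. [:-x, 1:]) x = 0" using that by (induction A) auto
    then show "poly p x = 0" by (subst A) simp
  qed
  note aux = Im_logderiv_aux[of A, OF this, folded P_def]
  define l where "l = lead_coeff p"
  have pP: "p = smult l P" unfolding l_def P_def by (rule A)
  have l: "l \<noteq> 0" using assms(1) by (simp add: l_def)
  have "poly (pderiv p) 0 * cnj (poly p 0) = of_real ((cmod l)\<^sup>2) * (poly (pderiv P) 0 * cnj (poly P 0))"
    unfolding pP complex_norm_square by (simp add: pderiv_smult)
  then have *: "Im (poly (pderiv p) 0 * cnj (poly p 0)) = (cmod l)\<^sup>2 * Im (poly (pderiv P) 0 * cnj (poly P 0))"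
    by (simp only: Im_of_real_mult)
  show "Im (poly (pderiv p) 0 * cnj (poly p 0)) \<le> 0" unfolding * using aux by (simp add: mult_nonneg_nonpos)
  assume "Im (poly (pderiv p) 0 * cnj (poly p 0)) = 0"
  then show "poly (pderiv p) 0 = 0" unfolding * using aux l by (simp add: pP pderiv_smult)
qed

section \<open>The barrier function\<close>

lemma rpoly_cx_pderiv: "pderiv (rpoly_cx q) = rpoly_cx (pderiv q)"
  by (intro poly_eqI) (simp add: coeff_pderiv coeff_map_poly)

lemma rpoly_cx_smult: "rpoly_cx (smult c q) = smult (of_real c) (rpoly_cx q)"
  by (intro poly_eqI) (simp add: coeff_map_poly)

lemma dir_deriv_poly:
  assumes "polyfn f" "\<And>\<tau>. f (z + \<tau> *\<^sub>C cvec v) = poly q \<tau>"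
  shows "dir_deriv v f (z + \<tau> *\<^sub>C cvec v) = poly (pderiv q) \<tau>"
proof -
  have "(\<lambda>\<tau>. f (z + \<tau> *\<^sub>C cvec v)) = poly q" using assms(2) by auto
  then have "(poly q has_field_derivative dir_deriv v f (z + \<tau> *\<^sub>C cvec v)) (at \<tau>)"
    using dir_deriv_line[OF assms(1), of z v \<tau>] by simp
  then show ?thesis using poly_DERIV DERIV_unique by blast
qed

lemma reval_line:
  assumes "\<And>\<tau>. f (cvec x + \<tau> *\<^sub>C cvec v) = poly (rpoly_cx q) \<tau>"
  shows "reval f (x + s *\<^sub>R v) = poly q s"
proof -
  have "cvec (x + s *\<^sub>R v) = cvec x + of_real s *\<^sub>C cvec v" by (simp add: vec_simps)
  then show ?thesis using assms[of "of_real s"] by (simp add: reval_def poly_rpoly_cx_of_real)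
qed

lemma reval_homog: assumes "polyfn f" "homog d f" shows "reval f (c *\<^sub>R x) = c ^ d * reval f x"
proof -
  have "f (cvec (c *\<^sub>R x)) = of_real c ^ d * f (cvec x)" by (simp only: cvec_scaleR homogD[OF assms(2)])
  also have "\<dots> = of_real (c ^ d * reval f x)" by (simp add: polyfn_real[OF assms(1)])
  finally show ?thesis unfolding reval_def[of f "c *\<^sub>R x"] by (simp only: Re_complex_of_real)
qed

lemma linprod_mono: "(\<And>b. b \<in> set bs \<Longrightarrow> b > 0) \<Longrightarrow> 0 \<le> s \<Longrightarrow> s \<le> t \<Longrightarrow> poly (linprod bs) s \<le> poly (linprod bs) t"
proof (induction bs)
  case (Cons b bs)
  have "(s + b) * poly (linprod bs) s \<le> (t + b) * poly (linprod bs) t"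
    using Cons linprod_pos[of bs s] by (intro mult_mono) (auto simp: less_imp_le add_nonneg_nonneg)
  then show ?case by (simp only: linprod_Cons poly_lin_mult)
qed simp

text \<open>After division by the value at 0 this is the expansion of the product of the
  \<open>1 + 1 / b\<close> up to first order. It bounds the derivative along a direction by a later
  value of \<open>f\<close>.\<close>

lemma linprod_1_ge:
  "(\<And>b. b \<in> set bs \<Longrightarrow> b > 0) \<Longrightarrow> poly (linprod bs) 1 \<ge> poly (linprod bs) 0 * (1 + (\<Sum>b\<leftarrow>bs. 1 / b))"
proof (induction bs)
  case (Cons b bs)
  have b: "b > 0" and IH: "poly (linprod bs) 0 * (1 + (\<Sum>b\<leftarrow>bs. 1 / b)) \<le> poly (linprod bs) 1"
    and P: "poly (linprod bs) 0 > 0" and S: "(\<Sum>b\<leftarrow>bs. 1 / b) \<ge> 0"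
    using Cons linprod_pos[of bs 0] by (auto intro!: sum_list_nonneg simp: less_imp_le)
  have "b * poly (linprod bs) 0 * (1 + (1 / b + (\<Sum>b\<leftarrow>bs. 1 / b))) =
      b * (poly (linprod bs) 0 * (1 + (\<Sum>b\<leftarrow>bs. 1 / b))) + poly (linprod bs) 0"
    using b by (simp add: field_simps)
  also have "\<dots> \<le> b * (poly (linprod bs) 0 * (1 + (\<Sum>b\<leftarrow>bs. 1 / b))) + poly (linprod bs) 0 * (1 + (\<Sum>b\<leftarrow>bs. 1 / b))"
    using P S by (simp add: algebra_simps)
  also have "\<dots> = (1 + b) * (poly (linprod bs) 0 * (1 + (\<Sum>b\<leftarrow>bs. 1 / b)))" by (simp add: algebra_simps)
  also have "\<dots> \<le> (1 + b) * poly (linprod bs) 1" using IH b by (intro mult_left_mono) auto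
  finally show ?case by (simp only: linprod_Cons poly_lin_mult list.map sum_list.Cons add_0)
qed simp

definition barrier :: "('j \<Rightarrow> real) \<Rightarrow> (('j \<Rightarrow> complex) \<Rightarrow> complex) \<Rightarrow> ('j \<Rightarrow> real) \<Rightarrow> real" where
  "barrier v f x = reval (dir_deriv v f) x / reval f x"

section \<open>Restriction to rays of the cone\<close>

locale hyp_form_pos = hyp_form +
  assumes pos_e: "reval f e > 0"
begin

text \<open>The zeros are real because \<open>x\<close> is itself a hyperbolic direction, and
  negative because \<open>x + l v\<close> stays in the cone for \<open>l \<ge> 0\<close>. The number
  of factors may be below \<open>d\<close>, as \<open>v\<close> may lie on the boundary; this is
  where a rank bound takes effect.\<close>

lemma line_factor:
  assumes x: "x \<in> open_cone f e" and v: "v \<in> closed_cone f e"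
  obtains C bs where "C > 0" "\<And>b. b \<in> set bs \<Longrightarrow> b > 0"
    "\<And>\<tau>. f (cvec x + \<tau> *\<^sub>C cvec v) = poly (rpoly_cx (smult C (linprod bs))) \<tau>"
proof -
  have factor: "\<exists>C bs. (\<forall>b\<in>set bs. b > 0) \<and>
    (\<forall>\<tau>. f (cvec x + \<tau> *\<^sub>C cvec v) = poly (rpoly_cx (smult C (linprod bs))) \<tau>)"
    if x: "x \<in> open_cone f e" and v: "v \<in> closed_cone f e" for x v
  proof -
    interpret x: hyp_form f d x using hyp_form_open_cone[OF x] .
    obtain p where p: "\<And>\<tau>. f (cvec x + \<tau> *\<^sub>C cvec v) = poly (rpoly_cx p) \<tau>"
      using polyfn_real_line[OF polyfn] by blast
    have "cvec x + 0 *\<^sub>C cvec v = cvec x" by (simp add: vec_simps)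
    then have "p \<noteq> 0" using p[of 0] cone_nonzero[OF x] by auto
    moreover have "z \<in> \<real>" if "poly (rpoly_cx p) z = 0" for z
    proof (rule ccontr)
      assume "z \<notin> \<real>"
      then have z: "Im z \<noteq> 0" "z \<noteq> 0" by (auto simp: complex_is_Real_iff)
      have "cvec x + z *\<^sub>C cvec v = z *\<^sub>C (cvec v + inverse z *\<^sub>C cvec x)"
        using z by (simp add: vec_simps field_simps)
      then have "z ^ d * f (cvec v + inverse z *\<^sub>C cvec x) = 0" using that p homogD[OF homog] by metis
      moreover have "f (cvec v + inverse z *\<^sub>C cvec x) \<noteq> 0"
        by (rule x.hyp_complex) (use z in \<open>auto simp: complex_eq_iff\<close>)
      ultimately show False using z by simp
    qed
    ultimately obtain ls where ls: "p = smult (lead_coeff p) (\<Prod>l\<leftarrow>ls. [:- l, 1:])"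
      using real_rooted_factorization by blast
    have neg: "l < 0" if "l \<in> set ls" for l
    proof (rule ccontr)
      assume "\<not> l < 0"
      then have "x + l *\<^sub>R v \<in> open_cone f e" using x v by (intro cone_add_closed_cone closed_cone_scaleR) auto
      then have "reval f (x + l *\<^sub>R v) \<noteq> 0" using cone_nonzero reval_eq_0_iff[OF polyfn] by blast
      then have "poly p l \<noteq> 0" using reval_line[OF p] by simp
      moreover have "poly (\<Prod>l\<leftarrow>ls. [:- l, 1:]) l = 0" using that by (induction ls) auto
      then have "poly p l = 0" by (subst ls) simp
      ultimately show False by simp
    qed
    have "linprod (map uminus ls) = (\<Prod>l\<leftarrow>ls. [:- l, 1:])" by (simp add: linprod_def comp_def)
    then have "p = smult (lead_coeff p) (linprod (map uminus ls))" using ls by simp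
    then show ?thesis using p neg by (intro exI[of _ "lead_coeff p"] exI[of _ "map uminus ls"]) auto
  qed
  \<comment> \<open>On the line \<open>e + \<tau> x\<close> the leading coefficient is
    \<open>f x\<close> and the constant one \<open>f e\<close>; since the other factors are positive
    at 0, the two have the same sign.\<close>
  have pos: "reval f x > 0" if x: "x \<in> open_cone f e" for x
  proof -
    obtain C bs where bs: "\<And>b. b \<in> set bs \<Longrightarrow> b > 0"
      and eq: "\<And>\<tau>. f (cvec e + \<tau> *\<^sub>C cvec x) = poly (rpoly_cx (smult C (linprod bs))) \<tau>"
      using factor[OF e_cone] x cone_subset_closed_cone by blast
    have "reval f (e + 0 *\<^sub>R x) = C * poly (linprod bs) 0" using reval_line[OF eq, of 0] by simp
    then have "C * poly (linprod bs) 0 > 0" using pos_e by simp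
    then have "C > 0" using linprod_pos[of bs 0] bs by (simp add: zero_less_mult_iff)
    moreover have "lead_coeff (rpoly_cx (smult C (linprod bs))) = of_real C"
      using \<open>C > 0\<close> by (simp add: degree_map_poly coeff_map_poly degree_linprod lead_coeff_linprod)
    then have "f (cvec x) = of_real C"
      using line_degree(2)[OF polyfn homog cone_nonzero[OF x] eq] by simp
    ultimately show ?thesis by (simp add: reval_def)
  qed
  obtain C bs where bs: "\<And>b. b \<in> set bs \<Longrightarrow> b > 0"
    and eq: "\<And>\<tau>. f (cvec x + \<tau> *\<^sub>C cvec v) = poly (rpoly_cx (smult C (linprod bs))) \<tau>"
    using factor[OF x v] by blast
  have "reval f (x + 0 *\<^sub>R v) = C * poly (linprod bs) 0" using reval_line[OF eq, of 0] by simp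
  then have "C * poly (linprod bs) 0 > 0" using pos[OF x] by simp
  then have "C > 0" using linprod_pos[of bs 0] bs by (simp add: zero_less_mult_iff)
  then show thesis using that bs eq by blast
qed

lemma line_factor_real:
  assumes x: "x \<in> open_cone f e" and v: "v \<in> closed_cone f e"
  obtains C bs where "C > 0" "\<And>b. b \<in> set bs \<Longrightarrow> b > 0"
    "\<And>\<tau>. f (cvec x + \<tau> *\<^sub>C cvec v) = poly (rpoly_cx (smult C (linprod bs))) \<tau>"
    "\<And>s. reval f (x + s *\<^sub>R v) = C * poly (linprod bs) s"
    "\<And>s. reval (dir_deriv v f) (x + s *\<^sub>R v) = C * poly (pderiv (linprod bs)) s"
proof -
  obtain C bs where *: "C > 0" "\<And>b. b \<in> set bs \<Longrightarrow> b > 0"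
    "\<And>\<tau>. f (cvec x + \<tau> *\<^sub>C cvec v) = poly (rpoly_cx (smult C (linprod bs))) \<tau>"
    by (rule line_factor[OF assms], rule that)
  have D: "dir_deriv v f (cvec x + \<tau> *\<^sub>C cvec v) = poly (rpoly_cx (smult C (pderiv (linprod bs)))) \<tau>" for \<tau>
    using dir_deriv_poly[OF polyfn *(3)] by (simp add: rpoly_cx_pderiv pderiv_smult)
  show thesis
    by (rule that[OF *]) (use reval_line[OF *(3)] reval_line[OF D] in simp_all)
qed

lemma pos_cone: assumes "x \<in> open_cone f e" shows "reval f x > 0"
proof -
  obtain C bs where *: "C > 0" "\<And>b. b \<in> set bs \<Longrightarrow> b > 0"
    "\<And>s. reval f (x + s *\<^sub>R 0) = C * poly (linprod bs) s"
    by (rule line_factor_real[OF assms zero_closed_cone], rule that)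
  show ?thesis using *(3)[of 0] *(1) linprod_pos[of bs 0] *(2) by simp
qed

lemma reval_mono: assumes "x \<in> open_cone f e" "v \<in> closed_cone f e" shows "reval f x \<le> reval f (x + v)"
proof -
  obtain C bs where *: "C > 0" "\<And>b. b \<in> set bs \<Longrightarrow> b > 0"
    "\<And>s. reval f (x + s *\<^sub>R v) = C * poly (linprod bs) s"
    by (rule line_factor_real[OF assms], rule that)
  show ?thesis using *(3)[of 0] *(3)[of 1] *(1) linprod_mono[of bs 0 1] *(2) by simp
qed

lemma barrier_eq:
  assumes "C > 0" "\<And>b. b \<in> set bs \<Longrightarrow> b > 0" "s \<ge> 0"
    "\<And>s. reval f (x + s *\<^sub>R v) = C * poly (linprod bs) s"
    "\<And>s. reval (dir_deriv v f) (x + s *\<^sub>R v) = C * poly (pderiv (linprod bs)) s"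
  shows "barrier v f (x + s *\<^sub>R v) = (\<Sum>b\<leftarrow>bs. 1 / (s + b))"
proof -
  have "s + b \<noteq> 0" if "b \<in> set bs" for b using assms(2)[OF that] assms(3) by simp
  then show ?thesis unfolding barrier_def assms(4,5)
    using pderiv_linprod[of bs s] linprod_pos[of bs s] assms by simp
qed

text \<open>The upper bound transfers growth bounds from \<open>f\<close> to its derivative.\<close>

lemma D_bounds:
  assumes "x \<in> open_cone f e" "v \<in> closed_cone f e"
  shows "0 \<le> reval (dir_deriv v f) x" "reval (dir_deriv v f) x \<le> reval f (x + v)"
proof -
  obtain C bs where *: "C > 0" "\<And>b. b \<in> set bs \<Longrightarrow> b > 0"
    "\<And>s. reval f (x + s *\<^sub>R v) = C * poly (linprod bs) s"
    "\<And>s. reval (dir_deriv v f) (x + s *\<^sub>R v) = C * poly (pderiv (linprod bs)) s"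
    by (rule line_factor_real[OF assms], rule that)
  have d: "reval (dir_deriv v f) x = C * (poly (linprod bs) 0 * (\<Sum>b\<leftarrow>bs. 1 / b))"
    using *(4)[of 0] pderiv_linprod[of bs 0] *(2) by fastforce
  have P: "poly (linprod bs) 0 > 0" using linprod_pos *(2) by blast
  have S: "(\<Sum>b\<leftarrow>bs. 1 / b) \<ge> 0" using *(2) by (intro sum_list_nonneg) (auto simp: less_imp_le)
  show "0 \<le> reval (dir_deriv v f) x" using P S *(1) by (simp add: d)
  have "reval f (x + v) = C * poly (linprod bs) 1" using *(3)[of 1] by simp
  moreover have "poly (linprod bs) 0 * (\<Sum>b\<leftarrow>bs. 1 / b) \<le> poly (linprod bs) 1"
    using linprod_1_ge[of bs] *(2) P by (simp add: algebra_simps)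
  ultimately show "reval (dir_deriv v f) x \<le> reval f (x + v)" using *(1) d by simp
qed

text \<open>A zero at \<open>x - v\<close> means that 1 is among the \<open>b\<close>, and this term
  alone makes the sum of the \<open>1 / b\<close>, the barrier, at least 1.\<close>

lemma minus_nonzero:
  assumes "x \<in> open_cone f e" "v \<in> closed_cone f e" "barrier v f x < 1"
  shows "f (cvec (x - v)) \<noteq> 0"
proof -
  obtain C bs where *: "C > 0" "\<And>b. b \<in> set bs \<Longrightarrow> b > 0"
    "\<And>s. reval f (x + s *\<^sub>R v) = C * poly (linprod bs) s"
    "\<And>s. reval (dir_deriv v f) (x + s *\<^sub>R v) = C * poly (pderiv (linprod bs)) s"
    by (rule line_factor_real[OF assms(1,2)], rule that)
  have S: "(\<Sum>b\<leftarrow>bs. 1 / b) < 1" using barrier_eq[OF *(1,2) _ *(3,4), of 0] assms(3) by simp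
  have "1 \<notin> set bs"
  proof
    assume "1 \<in> set bs"
    then have "1 / 1 \<le> (\<Sum>b\<leftarrow>bs. 1 / b)"
      using *(2) by (intro member_le_sum_list) (auto simp: less_imp_le image_iff intro!: bexI[of _ 1])
    then show False using S by simp
  qed
  then have "poly (linprod bs) (-1) \<noteq> 0" by (simp add: poly_linprod_eq_0)
  moreover have "reval f (x - v) = C * poly (linprod bs) (-1)" using *(3)[of "-1"] by simp
  ultimately show ?thesis using *(1) by (simp add: reval_eq_0_iff[OF polyfn])
qed

text \<open>For \<open>Im \<rho> \<ge> 0\<close> the imaginary part of \<open>z + \<rho> v\<close>
  is in the open cone, so there is no zero. All zeros in \<rho> lie below the real axis and
  \<open>Im_logderiv\<close> applies.\<close>

lemma Im_barrier:
  assumes w: "w \<in> open_cone f e" and v: "v \<in> closed_cone f e"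
  fixes x defines "z \<equiv> cvec x + \<i> *\<^sub>C cvec w"
  shows "Im (dir_deriv v f z * cnj (f z)) \<le> 0" "Im (dir_deriv v f z * cnj (f z)) = 0 \<Longrightarrow> dir_deriv v f z = 0"
proof -
  obtain p where p: "\<And>\<tau>. f (z + \<tau> *\<^sub>C cvec v) = poly p \<tau>" using polyfn_line[OF polyfn] by blast
  have z0: "z + 0 *\<^sub>C cvec v = z" by (simp add: vec_simps)
  interpret w: hyp_form f d w using hyp_form_open_cone[OF w] .
  have p0: "poly p 0 = f z" using p[of 0] by (simp add: z0)
  then have "p \<noteq> 0" using w.hyp[of x] by (auto simp: z_def)
  have D: "poly (pderiv p) 0 = dir_deriv v f z" using dir_deriv_poly[OF polyfn p, of 0] by (simp add: z0)
  have "Im \<rho> < 0" if "poly p \<rho> = 0" for \<rho>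
  proof (rule ccontr)
    assume "\<not> Im \<rho> < 0"
    then have "w + Im \<rho> *\<^sub>R v \<in> open_cone f e" using w v by (intro cone_add_closed_cone closed_cone_scaleR) auto
    then interpret w': hyp_form f d "w + Im \<rho> *\<^sub>R v" by (rule hyp_form_open_cone)
    have "z + \<rho> *\<^sub>C cvec v = cvec (x + Re \<rho> *\<^sub>R v) + \<i> *\<^sub>C cvec (w + Im \<rho> *\<^sub>R v)"
      by (simp add: vec_simps z_def complex_eq_iff)
    then show False using w'.hyp that p by metis
  qed
  from Im_logderiv[OF \<open>p \<noteq> 0\<close> this]
  show "Im (dir_deriv v f z * cnj (f z)) \<le> 0" "Im (dir_deriv v f z * cnj (f z)) = 0 \<Longrightarrow> dir_deriv v f z = 0"
    unfolding p0 D by auto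
qed

text \<open>A limit along \<open>w + t e\<close>, in which only the weak inequality
  survives.\<close>

lemma Im_barrier_closed:
  assumes w: "w \<in> closed_cone f e" and v: "v \<in> closed_cone f e"
  fixes x defines "z \<equiv> cvec x + \<i> *\<^sub>C cvec w"
  shows "Im (dir_deriv v f z * cnj (f z)) \<le> 0"
proof -
  define g where "g t = Im (dir_deriv v f (z + (\<i> * of_real t) *\<^sub>C cvec e) * cnj (f (z + (\<i> * of_real t) *\<^sub>C cvec e)))" for t
  have "continuous_on UNIV g" unfolding g_def
    by (intro continuous_on_Im continuous_on_mult continuous_on_cnj
        polyfn_continuous_on[OF polyfn] polyfn_continuous_on[OF polyfn_dir_deriv[OF polyfn]])
      (auto simp: vec_simps intro!: continuous_intros)
  then have "isCont g 0" by (simp add: continuous_on_eq_continuous_at)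
  then have "(g \<longlongrightarrow> g 0) (at_right 0)" unfolding isCont_def by (rule tendsto_within_subset) simp
  moreover have "eventually (\<lambda>t. g t \<le> 0) (at_right 0)"
    unfolding eventually_at_right_field
  proof (intro exI[of _ 1] conjI allI impI)
    fix t :: real assume "0 < t" "t < 1"
    have "z + (\<i> * of_real t) *\<^sub>C cvec e = cvec x + \<i> *\<^sub>C cvec (w + t *\<^sub>R e)"
      by (simp add: vec_simps z_def algebra_simps)
    then show "g t \<le> 0" unfolding g_def using Im_barrier(1)[OF closed_cone_add_e[OF w \<open>0 < t\<close>] v, of x] by simp
  qed simp
  ultimately have "g 0 \<le> 0" by (rule tendsto_upperbound) simp
  moreover have "z + (\<i> * of_real 0) *\<^sub>C cvec e = z" by (simp add: vec_simps)
  ultimately show ?thesis by (simp add: g_def)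
qed

text \<open>Growth bounds along \<open>w\<close> replace the rank of \<open>w\<close>; here they are transported between base points.\<close>

lemma line_growth:
  assumes x: "x \<in> open_cone f e" and w: "w \<in> closed_cone f e" and s: "\<And>s. s \<ge> 0 \<Longrightarrow> reval f (x + s *\<^sub>R w) \<le> K * (1 + s) ^ n"
  shows "\<exists>K'. \<forall>s\<ge>0. reval f (y + s *\<^sub>R w) \<le> K' * (1 + s) ^ n \<or> y + s *\<^sub>R w \<notin> open_cone f e"
proof -
  obtain A where A: "A \<ge> 1" "A *\<^sub>R x - y \<in> open_cone f e" using cone_absorb[OF x] by blast
  have K: "K \<ge> 0" using s[of 0] pos_cone[OF x] by simp
  have "reval f (y + t *\<^sub>R w) \<le> (A ^ d * K) * (1 + t) ^ n" if t: "t \<ge> 0" "y + t *\<^sub>R w \<in> open_cone f e" for t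
  proof -
    \<comment> \<open>In the cone order \<open>y + t w\<close> lies below
      \<open>A (x + (t / A) w)\<close>. Monotonicity of \<open>f\<close> requires
      \<open>y + t w\<close> to be in the cone, hence the second disjunct of the conclusion.\<close>
    have "reval f (y + t *\<^sub>R w) \<le> reval f (y + t *\<^sub>R w + (A *\<^sub>R x - y))"
      using t(2) A(2) cone_subset_closed_cone by (intro reval_mono) auto
    also have "y + t *\<^sub>R w + (A *\<^sub>R x - y) = A *\<^sub>R (x + (t / A) *\<^sub>R w)"
      using A(1) by (simp add: vec_simps field_simps)
    also have "reval f \<dots> = A ^ d * reval f (x + (t / A) *\<^sub>R w)" by (rule reval_homog[OF polyfn homog])
    also have "\<dots> \<le> A ^ d * (K * (1 + t / A) ^ n)" using s[of "t / A"] t A(1) by (intro mult_left_mono) auto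
    also have "\<dots> \<le> A ^ d * (K * (1 + t) ^ n)"
    proof -
      have "t / A \<le> t / 1" using A(1) t(1) by (intro divide_left_mono) auto
      then show ?thesis using K A(1) t(1) by (intro mult_left_mono power_mono) auto
    qed
    finally show ?thesis by (simp add: mult_ac)
  qed
  then show ?thesis by (intro exI[of _ "A ^ d * K"]) auto
qed

text \<open>On the complex line the half-plane condition is \<open>Im_barrier_closed\<close>,
  because \<open>Im \<tau>\<close> times \<open>w\<close> is in the closed cone. The degree of the
  derivative along \<open>w\<close> is controlled through its growth.\<close>

lemma line_herglotz:
  assumes x: "x \<in> open_cone f e" and w: "w \<in> closed_cone f e" and v: "v \<in> closed_cone f e"
    and C: "C > 0" and bs: "\<And>b. b \<in> set bs \<Longrightarrow> b > 0"
    and eq: "\<And>\<tau>. f (cvec x + \<tau> *\<^sub>C cvec w) = poly (rpoly_cx (smult C (linprod bs))) \<tau>"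
  obtains p c0 c where "\<And>b. c b \<ge> (0::real)"
    "p = smult c0 (linprod bs) + (\<Sum>b\<in>set bs. smult (c b) (linprod (remove1 b bs)))"
    "\<And>\<tau>. dir_deriv v f (cvec x + \<tau> *\<^sub>C cvec w) = poly (rpoly_cx p) \<tau>"
proof -
  obtain p where p: "\<And>\<tau>. dir_deriv v f (cvec x + \<tau> *\<^sub>C cvec w) = poly (rpoly_cx p) \<tau>"
    using polyfn_real_line[OF polyfn_dir_deriv[OF polyfn]] by blast
  have req: "reval f (x + s *\<^sub>R w) = C * poly (linprod bs) s" for s using reval_line[OF eq] by simp
  have xs: "x + s *\<^sub>R w \<in> open_cone f e" if "s \<ge> 0" for s using x w that by (intro cone_add_closed_cone closed_cone_scaleR)
  obtain K0 where K0: "\<And>s. s \<ge> 0 \<Longrightarrow> \<bar>poly (linprod bs) s\<bar> \<le> K0 * (1 + s) ^ length bs"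
    using poly_growth[of "linprod bs" "length bs"] by (auto simp: degree_linprod)
  have "reval f (x + s *\<^sub>R w) \<le> (C * K0) * (1 + s) ^ length bs" if "s \<ge> 0" for s
  proof -
    have "C * poly (linprod bs) s \<le> C * (K0 * (1 + s) ^ length bs)" using K0[OF that] C by (intro mult_left_mono) auto
    then show ?thesis by (simp add: req mult_ac)
  qed
  \<comment> \<open>The base point is \<open>x + v\<close> because \<open>D_bounds\<close> compares
    the derivative at a point with \<open>f\<close> at that point plus \<open>v\<close>.\<close>
  from line_growth[OF x w this, of "x + v"] obtain K where
    K: "\<And>s. s \<ge> 0 \<Longrightarrow> x + v + s *\<^sub>R w \<in> open_cone f e \<Longrightarrow> reval f (x + v + s *\<^sub>R w) \<le> K * (1 + s) ^ length bs"
    by blast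
  have "degree p \<le> length bs"
  proof (rule degree_le_growth)
    fix s :: real assume s: "s \<ge> 0"
    have p': "poly p s = reval (dir_deriv v f) (x + s *\<^sub>R w)" using reval_line[OF p] by simp
    have eq': "x + s *\<^sub>R w + v = x + v + s *\<^sub>R w" by (simp add: ac_simps)
    have "x + v + s *\<^sub>R w \<in> open_cone f e" using cone_add_closed_cone[OF xs[OF s] v] by (simp add: eq')
    then show "\<bar>poly p s\<bar> \<le> K * (1 + s) ^ length bs"
      using D_bounds[OF xs[OF s] v] K[OF s] by (simp add: p' eq')
  qed
  moreover have "Im (poly (rpoly_cx p) \<tau> * cnj (poly (rpoly_cx (linprod bs)) \<tau>)) \<le> 0" if "Im \<tau> > 0" for \<tau>
  proof -
    have "cvec x + \<tau> *\<^sub>C cvec w = cvec (x + Re \<tau> *\<^sub>R w) + \<i> *\<^sub>C cvec (Im \<tau> *\<^sub>R w)"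
      by (simp add: vec_simps complex_eq_iff)
    then have "Im (poly (rpoly_cx p) \<tau> * cnj (poly (rpoly_cx (smult C (linprod bs))) \<tau>)) \<le> 0"
      using Im_barrier_closed[OF closed_cone_scaleR[OF w] v, of "Im \<tau>" "x + Re \<tau> *\<^sub>R w"] that
      unfolding p[symmetric] eq[symmetric] by simp
    moreover have "poly (rpoly_cx p) \<tau> * cnj (poly (rpoly_cx (smult C (linprod bs))) \<tau>) =
      of_real C * (poly (rpoly_cx p) \<tau> * cnj (poly (rpoly_cx (linprod bs)) \<tau>))"
      by (simp add: rpoly_cx_smult)
    ultimately have "C * Im (poly (rpoly_cx p) \<tau> * cnj (poly (rpoly_cx (linprod bs)) \<tau>)) \<le> 0"
      by (simp only: Im_of_real_mult)
    then show ?thesis using C by (simp add: mult_le_0_iff)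
  qed
  ultimately show thesis using herglotz_partial_fractions[of p bs] p that by blast
qed

text \<open>By the partial fractions the barrier is a constant plus nonnegative multiples of
  \<open>1 / (s + b)\<close>, which decrease in \<open>s\<close>.\<close>

lemma barrier_mono:
  assumes x: "x \<in> open_cone f e" and w: "w \<in> closed_cone f e" and v: "v \<in> closed_cone f e" and "s \<ge> 0"
  shows "barrier v f (x + s *\<^sub>R w) \<le> barrier v f x"
proof -
  obtain C bs where *: "C > 0" "\<And>b. b \<in> set bs \<Longrightarrow> b > 0"
    and eq: "\<And>\<tau>. f (cvec x + \<tau> *\<^sub>C cvec w) = poly (rpoly_cx (smult C (linprod bs))) \<tau>"
    and r: "\<And>s. reval f (x + s *\<^sub>R w) = C * poly (linprod bs) s"
    by (rule line_factor_real[OF x w], rule that)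
  obtain p c0 c where c: "\<And>b. c b \<ge> (0::real)"
    and p: "p = smult c0 (linprod bs) + (\<Sum>b\<in>set bs. smult (c b) (linprod (remove1 b bs)))"
    and Dp: "\<And>\<tau>. dir_deriv v f (cvec x + \<tau> *\<^sub>C cvec w) = poly (rpoly_cx p) \<tau>"
    by (rule line_herglotz[OF x w v *(1) _ eq], erule *(2), rule that)
  have ph: "barrier v f (x + t *\<^sub>R w) = c0 / C + (\<Sum>b\<in>set bs. c b / (t + b)) / C" if "t \<ge> 0" for t
  proof -
    have P: "poly (linprod bs) t > 0" using linprod_pos *(2) that by blast
    have "poly p t = poly (linprod bs) t * (c0 + (\<Sum>b\<in>set bs. c b / (t + b)))"
      unfolding p poly_add poly_smult poly_sum distrib_left sum_distrib_left
    proof (intro arg_cong2[of _ _ _ _ "(+)"] sum.cong refl)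
      fix b assume b: "b \<in> set bs"
      have "poly (linprod bs) t = (t + b) * poly (linprod (remove1 b bs)) t"
        unfolding linprod_remove1[OF b] by (rule poly_lin_mult)
      moreover have "t + b > 0" using that *(2)[OF b] by simp
      ultimately show "c b * poly (linprod (remove1 b bs)) t = poly (linprod bs) t * (c b / (t + b))" by simp
    qed simp
    then show ?thesis unfolding barrier_def r reval_line[OF Dp] using P *(1) by (simp add: add_divide_distrib)
  qed
  have "(\<Sum>b\<in>set bs. c b / (s + b)) / C \<le> (\<Sum>b\<in>set bs. c b / (0 + b)) / C"
    using c *(1,2) \<open>s \<ge> 0\<close> by (intro divide_right_mono sum_mono divide_left_mono) (auto intro!: mult_pos_pos add_nonneg_pos)
  then show ?thesis using ph[OF \<open>s \<ge> 0\<close>] ph[of 0] by simp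
qed

text \<open>The barrier decreases along \<open>e\<close>, so \<open>minus_nonzero\<close> applies on
  the whole ray.\<close>

lemma cone_minus:
  assumes x: "x \<in> open_cone f e" and v: "v \<in> closed_cone f e" and "barrier v f x < 1"
  shows "x - v \<in> open_cone f e"
proof -
  have "f (cvec (x - v + t *\<^sub>R e)) \<noteq> 0" if "t \<ge> 0" for t
  proof -
    have "barrier v f (x + t *\<^sub>R e) < 1"
      using barrier_mono[OF x _ v that, of e] e_cone cone_subset_closed_cone assms(3) by fastforce
    from minus_nonzero[OF cone_add_e[OF x that] v this]
    show ?thesis by (simp add: algebra_simps)
  qed
  then show ?thesis by (simp add: open_cone_def)
qed

end

text \<open>The operator \<open>1 - z\<^sub>k D\<^sub>v\<close>; keeping \<open>z\<^sub>k\<close> as a variable preserves homogeneity.\<close>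

definition mix_op :: "('j \<Rightarrow> real) \<Rightarrow> 'j \<Rightarrow> (('j \<Rightarrow> complex) \<Rightarrow> complex) \<Rightarrow> ('j \<Rightarrow> complex) \<Rightarrow> complex" where
  "mix_op v k f = (\<lambda>z. f z - z k * dir_deriv v f z)"

definition indep :: "'j \<Rightarrow> (('j \<Rightarrow> complex) \<Rightarrow> complex) \<Rightarrow> bool" where
  "indep k f \<longleftrightarrow> (\<forall>z z'. (\<forall>j. j \<noteq> k \<longrightarrow> z j = z' j) \<longrightarrow> f z = f z')"

lemma indepD: "indep k f \<Longrightarrow> (\<And>j. j \<noteq> k \<Longrightarrow> z j = z' j) \<Longrightarrow> f z = f z'"
  by (auto simp: indep_def)

lemma indep_dir_deriv: "indep k f \<Longrightarrow> indep k (dir_deriv v f)"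
  unfolding indep_def dir_deriv_def
proof (intro allI impI)
  fix z z' :: "'a \<Rightarrow> complex"
  assume f: "\<forall>z z'. (\<forall>j. j \<noteq> k \<longrightarrow> z j = z' j) \<longrightarrow> f z = f z'" and z: "\<forall>j. j \<noteq> k \<longrightarrow> z j = z' j"
  have "f (z + \<tau> *\<^sub>C cvec v) = f (z' + \<tau> *\<^sub>C cvec v)" for \<tau>
    using f z by (simp add: plus_fun_apply)
  then show "deriv (\<lambda>\<tau>. f (z + \<tau> *\<^sub>C cvec v)) 0 = deriv (\<lambda>\<tau>. f (z' + \<tau> *\<^sub>C cvec v)) 0" by simp
qed

lemma indep_mix_op: "indep k f \<Longrightarrow> k \<noteq> k' \<Longrightarrow> indep k (mix_op v k' f)"
  using indep_dir_deriv[of k f v] unfolding indep_def mix_op_def by metis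

lemma reval_indep: "indep k f \<Longrightarrow> (\<And>j. j \<noteq> k \<Longrightarrow> x j = x' j) \<Longrightarrow> reval f x = reval f x'"
  unfolding reval_def using indepD[of k f "cvec x" "cvec x'"] by (simp add: cvec_apply)

lemma polyfn_mix_op: "polyfn f \<Longrightarrow> polyfn (mix_op v k f)"
  unfolding mix_op_def by (intro polyfn_diff polyfn.mult polyfn.coord polyfn_dir_deriv)

lemma homog_mix_op: assumes "polyfn f" "homog d f" shows "homog d (mix_op v k f)"
  unfolding homog_def
proof (intro allI)
  fix c z show "mix_op v k f (c *\<^sub>C z) = c ^ d * mix_op v k f z"
    using homogD[OF assms(2), of c z] homog_dir_deriv[OF assms, of c v z]
    by (simp add: mix_op_def cscale_apply algebra_simps)
qed

lemma dir_deriv_mix_op: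
  assumes "polyfn f" "w k = 0"
  shows "dir_deriv w (mix_op v k f) = mix_op v k (dir_deriv w f)"
proof
  fix z
  have "dir_deriv w (mix_op v k f) z = dir_deriv w f z - (of_real (w k) * dir_deriv v f z + z k * dir_deriv w (dir_deriv v f) z)"
    unfolding mix_op_def
      dir_deriv_diff[OF assms(1) polyfn.mult[OF polyfn.coord polyfn_dir_deriv[OF assms(1)]]]
      dir_deriv_mult[OF polyfn.coord polyfn_dir_deriv[OF assms(1)]] dir_deriv_coord ..
  then show "dir_deriv w (mix_op v k f) z = mix_op v k (dir_deriv w f) z"
    using assms dir_deriv_commute[OF assms(1), of w v] by (simp add: mix_op_def)
qed

lemma mix_op_commute:
  assumes "polyfn f" "v k' = 0" "w k = 0"
  shows "mix_op v k (mix_op w k' f) = mix_op w k' (mix_op v k f)"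
proof -
  have "dir_deriv v (mix_op w k' f) = mix_op w k' (dir_deriv v f)" "dir_deriv w (mix_op v k f) = mix_op v k (dir_deriv w f)"
    using assms by (auto intro: dir_deriv_mix_op)
  then show ?thesis
    by (simp add: mix_op_def[of v k "mix_op w k' f"] mix_op_def[of w k' "mix_op v k f"])
      (simp add: mix_op_def fun_eq_iff dir_deriv_commute[OF assms(1), of w v] algebra_simps)
qed

lemma reval_mix_op: assumes "polyfn f" shows "reval (mix_op v k f) x = reval f x - x k * reval (dir_deriv v f) x"
  unfolding reval_def mix_op_def by (simp add: cvec_apply)

section \<open>The mixing operator and one barrier step\<close>

context hyp_form_pos
begin

text \<open>At \<open>z = x + \<i> e\<close> the variable \<open>z k\<close> is real since
  \<open>e k = 0\<close>. A zero would make the imaginary part in \<open>Im_barrier\<close> vanish;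
  the equality case there gives a zero derivative, and then \<open>f z = 0\<close>.\<close>

lemma hyp_mix_op:
  assumes v: "v \<in> closed_cone f e" and ek: "e k = 0"
  shows "hyp_form_pos (mix_op v k f) d e"
proof
  show "polyfn (mix_op v k f)" by (rule polyfn_mix_op[OF polyfn])
  show "homog d (mix_op v k f)" by (rule homog_mix_op[OF polyfn homog])
  show "reval (mix_op v k f) e > 0" using pos_e ek by (simp add: reval_mix_op[OF polyfn])
  fix x
  define z where "z = cvec x + \<i> *\<^sub>C cvec e"
  have zk: "z k = of_real (x k)" using ek by (simp add: z_def vec_simps)
  have fz: "f z \<noteq> 0" unfolding z_def by (rule hyp)
  show "mix_op v k f (cvec x + \<i> *\<^sub>C cvec e) \<noteq> 0"
    unfolding z_def[symmetric]
  proof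
    assume "mix_op v k f z = 0"
    then have eq: "f z = of_real (x k) * dir_deriv v f z" by (simp add: mix_op_def zk)
    then have "f z * cnj (f z) = of_real (x k) * (dir_deriv v f z * cnj (f z))" by simp
    then have "of_real ((cmod (f z))\<^sup>2) = of_real (x k) * (dir_deriv v f z * cnj (f z))"
      by (simp only: complex_norm_square)
    then have "Im (of_real (x k) * (dir_deriv v f z * cnj (f z))) = 0" by (metis Im_complex_of_real)
    then have "x k * Im (dir_deriv v f z * cnj (f z)) = 0" by (simp only: Im_of_real_mult)
    moreover have "x k \<noteq> 0" using eq fz by auto
    ultimately have "dir_deriv v f z = 0" using Im_barrier(2)[OF e_cone v, of x] unfolding z_def by simp
    then show False using eq fz by simp
  qed
qed

lemma closed_cone_mix_op:
  assumes "e k = 0" "u k = 0" shows "u \<in> closed_cone (mix_op v k f) e \<longleftrightarrow> u \<in> closed_cone f e"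
  using assms by (simp add: closed_cone_def mix_op_def vec_simps)

lemma open_cone_mix_opI:
  assumes x: "x \<in> open_cone f e" and v: "v \<in> closed_cone f e" and ek: "e k = 0"
    and xk: "x k \<ge> 0" "x k * barrier v f x < 1"
  shows "x \<in> open_cone (mix_op v k f) e"
proof -
  have "mix_op v k f (cvec (x + t *\<^sub>R e)) \<noteq> 0" if t: "t \<ge> 0" for t
  proof -
    have xt: "x + t *\<^sub>R e \<in> open_cone f e" using cone_add_e[OF x t] .
    have "barrier v f (x + t *\<^sub>R e) \<le> barrier v f x"
      using barrier_mono[OF x _ v t, of e] e_cone cone_subset_closed_cone by blast
    then have "x k * barrier v f (x + t *\<^sub>R e) < 1" using xk by (meson dual_order.strict_trans2 mult_left_mono order_le_less_trans)
    then have "x k * reval (dir_deriv v f) (x + t *\<^sub>R e) < reval f (x + t *\<^sub>R e)"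
      using pos_cone[OF xt] by (simp add: barrier_def field_simps)
    moreover have "(x + t *\<^sub>R e) k = x k" using ek by (simp add: vec_simps)
    ultimately have "reval (mix_op v k f) (x + t *\<^sub>R e) \<noteq> 0" by (simp add: reval_mix_op[OF polyfn])
    then show ?thesis using reval_eq_0_iff[OF polyfn_mix_op[OF polyfn]] by blast
  qed
  then show ?thesis by (simp add: open_cone_def)
qed

text \<open>The direction \<open>- unitv k\<close> lies in the closed cone of \<open>mix_op v k f\<close>, and moving along it to
  \<open>z\<^sub>k = 0\<close> turns \<open>mix_op v k f\<close> into \<open>f\<close>.\<close>

lemma open_cone_mix_opD:
  assumes x: "x \<in> open_cone (mix_op v k f) e" and v: "v \<in> closed_cone f e" and ek: "e k = 0"
    and ind: "indep k f" and xk: "x k \<ge> 0"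
  shows "x \<in> open_cone f e" "x k * barrier v f x < 1"
proof -
  interpret T: hyp_form_pos "mix_op v k f" d e using hyp_mix_op[OF v ek] .
  define u :: "'a \<Rightarrow> real" where "u = (\<lambda>j. if j = k then -1 else 0)"
  have "u \<in> closed_cone (mix_op v k f) e"
  proof -
    have "mix_op v k f (cvec (u + t *\<^sub>R e)) \<noteq> 0" if t: "t > 0" for t
    proof -
      have te: "t *\<^sub>R e \<in> open_cone f e" using cone_scaleR[OF e_cone t] .
      have "reval f (u + t *\<^sub>R e) = reval f (t *\<^sub>R e)" "reval (dir_deriv v f) (u + t *\<^sub>R e) = reval (dir_deriv v f) (t *\<^sub>R e)"
        by (intro reval_indep[OF ind] reval_indep[OF indep_dir_deriv[OF ind]]; simp add: u_def vec_simps)+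
      moreover have "(u + t *\<^sub>R e) k = -1" using ek by (simp add: u_def vec_simps)
      ultimately have "reval (mix_op v k f) (u + t *\<^sub>R e) > 0"
        using pos_cone[OF te] D_bounds(1)[OF te v] by (simp add: reval_mix_op[OF polyfn])
      then show ?thesis using reval_eq_0_iff[OF T.polyfn] by (metis less_irrefl)
    qed
    then show ?thesis by (simp add: closed_cone_def)
  qed
  then have Y: "x + x k *\<^sub>R u \<in> open_cone (mix_op v k f) e"
    using x xk by (intro T.cone_add_closed_cone T.closed_cone_scaleR)
  have "f (cvec (x + t *\<^sub>R e)) \<noteq> 0" if "t \<ge> 0" for t
  proof -
    have k0: "(x + x k *\<^sub>R u + t *\<^sub>R e) k = 0" using ek by (simp add: u_def vec_simps)
    have "mix_op v k f (cvec (x + x k *\<^sub>R u + t *\<^sub>R e)) \<noteq> 0" using Y that by (simp add: open_cone_def)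
    then have "f (cvec (x + x k *\<^sub>R u + t *\<^sub>R e)) \<noteq> 0" using k0 by (simp add: mix_op_def cvec_apply)
    moreover have "f (cvec (x + x k *\<^sub>R u + t *\<^sub>R e)) = f (cvec (x + t *\<^sub>R e))"
      by (rule indepD[OF ind]) (simp add: u_def vec_simps)
    ultimately show ?thesis by simp
  qed
  then show xc: "x \<in> open_cone f e" by (simp add: open_cone_def)
  have "reval (mix_op v k f) x > 0" using T.pos_cone[OF x] .
  then show "x k * barrier v f x < 1" using pos_cone[OF xc] by (simp add: reval_mix_op[OF polyfn] barrier_def field_simps)
qed

text \<open>As \<open>f\<close> is independent of variable \<open>k\<close>, setting it to 1 affects
  neither \<open>f\<close> nor its derivatives, and everything is read off on the line
  \<open>x + s w\<close>. There \<open>L\<close> stands for \<open>f\<close> and \<open>p\<close>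
  for its derivative along \<open>v\<close>, as in \<open>barrier_univariate\<close>.\<close>

lemma barrier_step:
  assumes x: "x \<in> open_cone f e" and w: "w \<in> closed_cone f e"
    and U: "(\<delta>, \<mu>) \<in> U r" and r: "r \<ge> 1"
    and ph: "barrier w f x \<le> 1 / \<mu>"
    and gr: "\<And>s. s \<ge> 0 \<Longrightarrow> reval f (x + s *\<^sub>R w) \<le> K * (1 + s) ^ r"
    and k: "indep k f" "w k = 0" "e k = 0" "x' k = 1" "\<And>j. j \<noteq> k \<Longrightarrow> x' j = (x + \<delta> *\<^sub>R w) j"
  shows "x' \<in> open_cone (mix_op w k f) e"
    and "v \<in> closed_cone f e \<Longrightarrow> v k = 0 \<Longrightarrow> barrier v (mix_op w k f) x' \<le> barrier v f x"
proof -
  have \<delta>: "\<delta> > 0" using U by (auto simp: U_def)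
  obtain C bs where C: "C > 0" and bs: "\<And>b. b \<in> set bs \<Longrightarrow> b > 0"
    and eq: "\<And>\<tau>. f (cvec x + \<tau> *\<^sub>C cvec w) = poly (rpoly_cx (smult C (linprod bs))) \<tau>"
    and rf: "\<And>s. reval f (x + s *\<^sub>R w) = C * poly (linprod bs) s"
    and rD: "\<And>s. reval (dir_deriv w f) (x + s *\<^sub>R w) = C * poly (pderiv (linprod bs)) s"
    by (rule line_factor_real[OF x w], rule that)
  \<comment> \<open>The growth bound takes the place of the rank: it limits the number of
    poles.\<close>
  have "degree (smult C (linprod bs)) \<le> r"
  proof (rule degree_le_growth)
    fix s :: real assume "s \<ge> 0"
    then show "\<bar>poly (smult C (linprod bs)) s\<bar> \<le> K * (1 + s) ^ r"
      using gr[of s] rf[of s] C linprod_pos[of bs s] bs by (simp add: abs_mult)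
  qed
  then have len: "length bs \<le> r" using C by (simp add: degree_linprod)
  have sum: "(\<Sum>b\<leftarrow>bs. 1 / b) \<le> 1 / \<mu>" using barrier_eq[OF C bs _ rf rD, of 0] ph by simp
  define L where "L = linprod bs"
  have L0: "poly L 0 > 0" unfolding L_def using bs linprod_pos by blast
  have xd: "x + \<delta> *\<^sub>R w \<in> open_cone f e" using x w \<delta> by (intro cone_add_closed_cone closed_cone_scaleR) auto
  have posL: "poly (L - pderiv L) \<delta> > 0"
    unfolding L_def by (rule barrier_univariate(1)[where c="\<lambda>_. 0", OF U r bs len sum]) simp_all
  have ind: "reval g x' = reval g (x + \<delta> *\<^sub>R w)" if "indep k g" for g
    by (rule reval_indep[OF that k(5)])
  have f': "reval f x' = C * poly L \<delta>" "reval (dir_deriv w f) x' = C * poly (pderiv L) \<delta>"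
    unfolding ind[OF k(1)] ind[OF indep_dir_deriv[OF k(1)]] L_def by (rule rf, rule rD)
  have x'f: "x' \<in> open_cone f e"
  proof -
    have "f (cvec (x' + t *\<^sub>R e)) = f (cvec (x + \<delta> *\<^sub>R w + t *\<^sub>R e))" for t
      by (rule indepD[OF k(1)]) (simp add: vec_simps k(5))
    then show ?thesis using xd by (simp add: open_cone_def)
  qed
  have Lpos: "poly L \<delta> > 0" unfolding L_def using bs linprod_pos \<delta> by (metis less_imp_le)
  show "x' \<in> open_cone (mix_op w k f) e"
  proof (rule open_cone_mix_opI[OF x'f w k(3)])
    show "x' k * barrier w f x' < 1" using k(4) posL Lpos C by (simp add: barrier_def f')
  qed (simp add: k(4))
  assume v: "v \<in> closed_cone f e" and vk: "v k = 0"
  obtain p c0 c where c: "\<And>b. c b \<ge> (0::real)"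
    and p: "p = smult c0 (linprod bs) + (\<Sum>b\<in>set bs. smult (c b) (linprod (remove1 b bs)))"
    and Dp: "\<And>\<tau>. dir_deriv v f (cvec x + \<tau> *\<^sub>C cvec w) = poly (rpoly_cx p) \<tau>"
    by (rule line_herglotz[OF x w v C _ eq], erule bs, rule that)
  have DDp: "dir_deriv w (dir_deriv v f) (cvec x + \<tau> *\<^sub>C cvec w) = poly (rpoly_cx (pderiv p)) \<tau>" for \<tau>
    using dir_deriv_poly[OF polyfn_dir_deriv[OF polyfn] Dp] by (simp add: rpoly_cx_pderiv)
  have v': "reval (dir_deriv v f) x' = poly p \<delta>" "reval (dir_deriv w (dir_deriv v f)) x' = poly (pderiv p) \<delta>"
    unfolding ind[OF indep_dir_deriv[OF k(1)]] ind[OF indep_dir_deriv[OF indep_dir_deriv[OF k(1)]]]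
    by (rule reval_line[OF Dp], rule reval_line[OF DDp])
  have top: "reval (mix_op w k f) x' = C * poly (L - pderiv L) \<delta>"
    by (simp add: reval_mix_op[OF polyfn] k(4) f' algebra_simps)
  have "reval (dir_deriv v (mix_op w k f)) x' = poly (p - pderiv p) \<delta>"
    unfolding dir_deriv_mix_op[of f v k, OF polyfn vk] by (simp add: reval_mix_op[OF polyfn_dir_deriv[OF polyfn]] k(4) v')
  then have "barrier v (mix_op w k f) x' = poly (p - pderiv p) \<delta> / (C * poly (L - pderiv L) \<delta>)"
    by (simp add: barrier_def top)
  also have "\<dots> \<le> poly p 0 / (C * poly L 0)"
    using barrier_univariate(2)[OF U r bs len sum c p] posL L0 C unfolding L_def[symmetric]
    by (simp add: divide_simps mult_ac del: poly_diff)
  also have "\<dots> = barrier v f x"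
    using reval_line[OF Dp, of 0] rf[of 0] by (simp add: barrier_def L_def)
  finally show "barrier v (mix_op w k f) x' \<le> barrier v f x" .
qed

end

section \<open>Mixed hyperbolic polynomials\<close>

definition unitv :: "'j \<Rightarrow> 'j \<Rightarrow> real" where
  "unitv k = (\<lambda>j. if j = k then 1 else 0)"

definition mix_ops :: "(nat \<Rightarrow> 'j \<Rightarrow> real) \<Rightarrow> (nat \<Rightarrow> 'j) \<Rightarrow> (('j \<Rightarrow> complex) \<Rightarrow> complex) \<Rightarrow> nat list \<Rightarrow>
    ('j \<Rightarrow> complex) \<Rightarrow> complex" where
  "mix_ops v k f l = foldr (\<lambda>i. mix_op (v i) (k i)) l f"

lemma mix_ops_Nil [simp]: "mix_ops v k f [] = f"
  and mix_ops_Cons: "mix_ops v k f (i # l) = mix_op (v i) (k i) (mix_ops v k f l)"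
  by (simp_all add: mix_ops_def)

lemma barrier_indep:
  "indep k f \<Longrightarrow> (\<And>j. j \<noteq> k \<Longrightarrow> x j = x' j) \<Longrightarrow> barrier v f x = barrier v f x'"
  unfolding barrier_def using reval_indep[of k f x x'] reval_indep[OF indep_dir_deriv, of k f x x' v] by simp

lemma open_cone_indep:
  assumes "indep k f" "\<And>j. j \<noteq> k \<Longrightarrow> x j = x' j" "x \<in> open_cone f e" shows "x' \<in> open_cone f e"
proof -
  have "f (cvec (x + t *\<^sub>R e)) = f (cvec (x' + t *\<^sub>R e))" for t
    by (rule indepD[OF assms(1)]) (simp add: vec_simps assms(2))
  then show ?thesis using assms(3) by (simp add: open_cone_def)
qed

text \<open>Here \<open>k i\<close> is the auxiliary variable reserved for \<open>v i\<close>; it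
  occurs neither in \<open>f\<close> nor in \<open>e\<close> nor in any of the directions.\<close>

locale mixed_form = hyp_form_pos +
  fixes I :: "nat set" and v :: "nat \<Rightarrow> 'a \<Rightarrow> real" and k :: "nat \<Rightarrow> 'a"
  assumes inj: "inj_on k I" and e_k: "\<And>i. i \<in> I \<Longrightarrow> e (k i) = 0"
    and indep_k: "\<And>i. i \<in> I \<Longrightarrow> indep (k i) f"
    and v_k: "\<And>i i'. i \<in> I \<Longrightarrow> i' \<in> I \<Longrightarrow> v i (k i') = 0"
    and v_cone: "\<And>i. i \<in> I \<Longrightarrow> v i \<in> closed_cone f e"
begin

abbreviation H where "H \<equiv> mix_ops v k f"

lemma polyfn_H: "polyfn (H l)"
  by (induction l) (simp_all add: polyfn mix_ops_Cons polyfn_mix_op)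

text \<open>Both claims go in one induction: the next operator preserves hyperbolicity only if its
  direction is in the closed cone of the polynomial reached so far. Directions without auxiliary
  components do not notice the operators.\<close>

lemma H_form:
  assumes "set l \<subseteq> I"
  shows "hyp_form_pos (H l) d e \<and> (\<forall>u. (\<forall>i\<in>I. u (k i) = 0) \<longrightarrow> (u \<in> closed_cone (H l) e \<longleftrightarrow> u \<in> closed_cone f e))"
  using assms
proof (induction l)
  case Nil show ?case using hyp_form_pos_axioms by simp
next
  case (Cons a l)
  then have a: "a \<in> I" by simp
  from Cons interpret L: hyp_form_pos "H l" d e by simp
  have va: "v a \<in> closed_cone (H l) e" using Cons v_cone v_k a by simp
  show ?case unfolding mix_ops_Cons
    using L.hyp_mix_op[OF va e_k[OF a]] L.closed_cone_mix_op[OF e_k[OF a]] Cons a by simp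
qed

lemma H_hyp: "set l \<subseteq> I \<Longrightarrow> hyp_form_pos (H l) d e" using H_form by blast

lemma H_closed_cone: "set l \<subseteq> I \<Longrightarrow> (\<And>i. i \<in> I \<Longrightarrow> u (k i) = 0) \<Longrightarrow> u \<in> closed_cone f e \<Longrightarrow> u \<in> closed_cone (H l) e"
  using H_form by blast

lemma v_closed_cone_H: "set l \<subseteq> I \<Longrightarrow> i \<in> I \<Longrightarrow> v i \<in> closed_cone (H l) e"
  by (rule H_closed_cone) (auto intro: v_k v_cone)

lemma indep_H: "set l \<subseteq> I \<Longrightarrow> i \<in> I \<Longrightarrow> i \<notin> set l \<Longrightarrow> indep (k i) (H l)"
proof (induction l)
  case (Cons a l)
  then have "k i \<noteq> k a" using inj by (auto simp: inj_on_def)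
  then show ?case using Cons by (simp add: mix_ops_Cons indep_mix_op)
qed (simp add: indep_k)

text \<open>The operators commute, so any index can be regarded as the last one treated.\<close>

lemma H_move: "set l \<subseteq> I \<Longrightarrow> i \<in> set l \<Longrightarrow> H l = mix_op (v i) (k i) (H (remove1 i l))"
proof (induction l)
  case (Cons a l)
  show ?case
  proof (cases "a = i")
    case False
    then have "H (a # l) = mix_op (v a) (k a) (mix_op (v i) (k i) (H (remove1 i l)))"
      using Cons by (simp add: mix_ops_Cons)
    also have "\<dots> = mix_op (v i) (k i) (mix_op (v a) (k a) (H (remove1 i l)))"
      using Cons.prems by (intro mix_op_commute polyfn_H v_k) auto
    finally show ?thesis using False by (simp add: mix_ops_Cons)
  qed (simp add: mix_ops_Cons)
qed simp

text \<open>The point reached once the indices of \<open>A\<close> have been treated. It does not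
  depend on their order.\<close>

definition shifted_point :: "real \<Rightarrow> real \<Rightarrow> nat set \<Rightarrow> 'a \<Rightarrow> real" where
  "shifted_point t \<delta> A = t *\<^sub>R e + (\<Sum>i\<in>A. \<delta> *\<^sub>R v i + unitv (k i))"

lemma shifted_point_k: "A \<subseteq> I \<Longrightarrow> a \<in> I \<Longrightarrow> a \<notin> A \<Longrightarrow> shifted_point t \<delta> A (k a) = 0"
proof -
  assume *: "A \<subseteq> I" "a \<in> I" "a \<notin> A"
  have "unitv (k i) (k a) = 0" if "i \<in> A" for i
    using * that inj by (auto simp: unitv_def inj_on_def)
  then have "(\<Sum>i\<in>A. (\<delta> *\<^sub>R v i + unitv (k i)) (k a)) = 0"
    using * v_k by (intro sum.neutral) (auto simp: plus_fun_apply scaleR_fun_apply)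
  then show ?thesis using e_k[OF *(2)] by (simp add: shifted_point_def plus_fun_apply scaleR_fun_apply sum_fun_apply)
qed

text \<open>The invariant is kept for all indices, treated or not, since \<open>barrier_step\<close>
  preserves every barrier. Growth is inherited because the operator subtracts a nonnegative
  derivative at points with \<open>k a\<close> coordinate 1.\<close>

lemma barrier_chain:
  assumes U: "(\<delta>, \<mu>) \<in> U r" and r: "r \<ge> 1" and t: "t > 0"
    and ph: "\<And>i. i \<in> I \<Longrightarrow> barrier (v i) f (t *\<^sub>R e) \<le> 1 / \<mu>"
    and gr: "\<And>i. i \<in> I \<Longrightarrow> \<exists>K. \<forall>s\<ge>0. reval f (t *\<^sub>R e + s *\<^sub>R v i) \<le> K * (1 + s) ^ r"
    and l: "distinct l" "set l \<subseteq> I"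
  shows "shifted_point t \<delta> (set l) \<in> open_cone (H l) e \<and>
    (\<forall>i\<in>I. barrier (v i) (H l) (shifted_point t \<delta> (set l)) \<le> 1 / \<mu> \<and>
      (\<exists>K. \<forall>s\<ge>0. reval (H l) (shifted_point t \<delta> (set l) + s *\<^sub>R v i) \<le> K * (1 + s) ^ r))"
  using l
proof (induction l)
  case Nil
  show ?case using ph gr cone_scaleR[OF e_cone t] by (simp add: shifted_point_def)
next
  case (Cons a l)
  define x where "x = shifted_point t \<delta> (set l)"
  define x' where "x' = shifted_point t \<delta> (set (a # l))"
  have a: "a \<in> I" "a \<notin> set l" and l: "set l \<subseteq> I" using Cons.prems by auto
  interpret L: hyp_form_pos "H l" d e using H_hyp[OF l] .
  have IH: "x \<in> open_cone (H l) e" "\<And>i. i \<in> I \<Longrightarrow> barrier (v i) (H l) x \<le> 1 / \<mu>"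
     "\<And>i. i \<in> I \<Longrightarrow> \<exists>K. \<forall>s\<ge>0. reval (H l) (x + s *\<^sub>R v i) \<le> K * (1 + s) ^ r"
    using Cons unfolding x_def by auto
  obtain K where K: "\<And>s. s \<ge> 0 \<Longrightarrow> reval (H l) (x + s *\<^sub>R v a) \<le> K * (1 + s) ^ r" using IH(3)[OF a(1)] by blast
  have x': "x' = x + \<delta> *\<^sub>R v a + unitv (k a)"
    using a(2) by (simp add: x'_def x_def shifted_point_def ac_simps)
  have xk: "x' (k a) = 1"
    using shifted_point_k[OF l a] v_k[OF a(1) a(1)] by (simp add: x' x_def unitv_def plus_fun_apply scaleR_fun_apply)
  have xj: "x' j = (x + \<delta> *\<^sub>R v a) j" if "j \<noteq> k a" for j
    using that by (simp add: x' unitv_def plus_fun_apply)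
  note va = v_closed_cone_H[OF l a(1)]
  note step = L.barrier_step[OF IH(1) va U r IH(2)[OF a(1)] K indep_H[OF l a]
      v_k[OF a(1) a(1)] e_k[OF a(1)] xk xj]
  have c1: "x' \<in> open_cone (H (a # l)) e" unfolding mix_ops_Cons by (rule step(1))
  have c2: "barrier (v i) (H (a # l)) x' \<le> 1 / \<mu>" if i: "i \<in> I" for i
  proof -
    have "barrier (v i) (H (a # l)) x' \<le> barrier (v i) (H l) x" unfolding mix_ops_Cons
      by (rule step(2)[OF _ _ v_closed_cone_H[OF l i] v_k[OF i a(1)]])
    then show ?thesis using IH(2)[OF i] by linarith
  qed
  have x'L: "x' \<in> open_cone (H l) e"
    using L.open_cone_mix_opD(1)[OF c1[unfolded mix_ops_Cons] va e_k[OF a(1)] indep_H[OF l a]] xk by simp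
  have c3: "\<exists>K. \<forall>s\<ge>0. reval (H (a # l)) (x' + s *\<^sub>R v i) \<le> K * (1 + s) ^ r" if i: "i \<in> I" for i
  proof -
    obtain K0 where K0: "\<And>s. s \<ge> 0 \<Longrightarrow> reval (H l) (x + s *\<^sub>R v i) \<le> K0 * (1 + s) ^ r" using IH(3)[OF i] by blast
    obtain K' where K': "\<And>s. s \<ge> 0 \<Longrightarrow> reval (H l) (x' + s *\<^sub>R v i) \<le> K' * (1 + s) ^ r \<or> x' + s *\<^sub>R v i \<notin> open_cone (H l) e"
      using L.line_growth[OF IH(1) v_closed_cone_H[OF l i] K0, of x'] by blast
    have "reval (H (a # l)) (x' + s *\<^sub>R v i) \<le> K' * (1 + s) ^ r" if s: "s \<ge> 0" for s
    proof -
      have c: "x' + s *\<^sub>R v i \<in> open_cone (H l) e"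
        using L.cone_add_closed_cone[OF x'L L.closed_cone_scaleR[OF v_closed_cone_H[OF l i] s]] .
      have "(x' + s *\<^sub>R v i) (k a) = 1" using xk v_k[OF i a(1)] by (simp add: plus_fun_apply scaleR_fun_apply)
      then have "reval (H (a # l)) (x' + s *\<^sub>R v i) \<le> reval (H l) (x' + s *\<^sub>R v i)"
        using L.D_bounds(1)[OF c va] by (simp add: mix_ops_Cons reval_mix_op[OF polyfn_H])
      then show ?thesis using K'[OF s] c by linarith
    qed
    then show ?thesis by blast
  qed
  show ?case using c1 c2 c3 unfolding x'_def by blast
qed

text \<open>Whichever \<open>i\<close> is treated last, the barrier bound allows \<open>z (k i) = \<mu>'\<close> for every \<open>\<mu>' < \<mu>\<close> and needs no
  shift along \<open>v i\<close>. By convexity the average over \<open>i\<close> of these points is in the cone, and rescaling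
  it so that all \<open>z (k i) = 1\<close> produces the denominator in the definition of \<open>delta_bound\<close>.\<close>

lemma mixed_bound:
  assumes U: "(\<delta>, \<mu>) \<in> U r" and r: "r \<ge> 1" and t: "t > 0"
    and ph: "\<And>i. i \<in> I \<Longrightarrow> barrier (v i) f (t *\<^sub>R e) \<le> 1 / \<mu>"
    and gr: "\<And>i. i \<in> I \<Longrightarrow> \<exists>K. \<forall>s\<ge>0. reval f (t *\<^sub>R e + s *\<^sub>R v i) \<le> K * (1 + s) ^ r"
    and l: "distinct l" "set l = I" and m: "length l = m" "m \<ge> 1"
    and sum: "(\<Sum>i\<in>I. v i) = e"
    and T: "T > (t + (1 - 1 / real m) * \<delta>) / (1 - 1 / real m + \<mu> / real m)"
  shows "T *\<^sub>R e + (\<Sum>i\<in>I. unitv (k i)) \<in> open_cone (H l) e"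
proof -
  have pos: "\<mu> > 0" "\<delta> > 0" using U by (auto simp: U_def)
  have fin: "finite I" "card I = m" using l m by (auto simp: distinct_card)
  define N where "N = real m * t + (real m - 1) * \<delta>"
  have N: "N > 0" using t m pos by (auto simp: N_def intro!: add_pos_nonneg mult_pos_pos)
  have den: "real m - 1 + \<mu> > 0" using m pos by simp
  have "(t + (1 - 1 / real m) * \<delta>) / (1 - 1 / real m + \<mu> / real m) = N / (real m - 1 + \<mu>)"
  proof -
    have "t + (1 - 1 / real m) * \<delta> = N / m" "1 - 1 / real m + \<mu> / real m = (real m - 1 + \<mu>) / m"
      using m by (simp_all add: N_def field_simps)
    then show ?thesis using m by simp
  qed
  then have TN: "T > N / (real m - 1 + \<mu>)" using T by simp
  then have Tpos: "T > 0" using N den by (meson divide_pos_pos less_trans)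
  define g where "g = T * (real m - 1 + \<mu>) - N"
  have g: "g > 0" using TN den by (simp add: g_def pos_divide_less_eq)
  \<comment> \<open>Lowering \<mu> by at most \<open>g / (2 * T)\<close> costs at most half of the
    gap \<open>g\<close>, and \<open>\<mu> / 2\<close> keeps the value positive.\<close>
  define \<mu>' where "\<mu>' = max (\<mu> / 2) (\<mu> - g / (2 * T))"
  have \<mu>': "0 < \<mu>'" "\<mu>' < \<mu>" using pos g Tpos by (auto simp: \<mu>'_def)
  have "T * \<mu> - g / 2 = T * (\<mu> - g / (2 * T))" using Tpos by (simp add: field_simps)
  also have "\<dots> \<le> T * \<mu>'" using Tpos by (intro mult_left_mono) (auto simp: \<mu>'_def)
  finally have "T * \<mu> - g / 2 \<le> T * \<mu>'" .
  moreover have "g = T * (real m - 1) + T * \<mu> - N" "T * (real m - 1 + \<mu>') = T * (real m - 1) + T * \<mu>'"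
    by (simp_all add: g_def distrib_left)
  ultimately have "T * (real m - 1 + \<mu>') > N" using g by linarith
  define c where "c = real m - 1 + \<mu>'"
  have c: "c > 0" using m \<mu>' by (simp add: c_def)
  have TT: "T - N / c > 0" using \<open>T * (real m - 1 + \<mu>') > N\<close> c by (simp add: c_def[symmetric] pos_divide_less_eq)
  interpret L: hyp_form_pos "H l" d e using H_hyp l by simp
  define Y where "Y i = shifted_point t \<delta> (I - {i}) + \<mu>' *\<^sub>R unitv (k i)" for i
  have Y: "Y i \<in> open_cone (H l) e" if i: "i \<in> I" for i
  proof -
    define l' where "l' = remove1 i l"
    have l': "distinct l'" "set l' = I - {i}" "i \<notin> set l'" using l by (auto simp: l'_def)
    then have sl': "set l' \<subseteq> I" by auto
    interpret L': hyp_form_pos "H l'" d e using H_hyp[OF sl'] .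
    note ch = barrier_chain[OF U r t ph gr l'(1) sl']
    have off: "shifted_point t \<delta> (set l') j = Y i j" if "j \<noteq> k i" for j
      using that by (simp add: Y_def l'(2) plus_fun_apply scaleR_fun_apply unitv_def)
    have Yk: "Y i (k i) = \<mu>'" using shifted_point_k[OF sl' i l'(3)]
      by (simp add: Y_def l'(2) plus_fun_apply scaleR_fun_apply unitv_def)
    have ind: "indep (k i) (H l')" using indep_H[OF sl' i l'(3)] .
    have "barrier (v i) (H l') (Y i) = barrier (v i) (H l') (shifted_point t \<delta> (set l'))"
      by (rule barrier_indep[OF ind, symmetric]) (rule off)
    then have "barrier (v i) (H l') (Y i) \<le> 1 / \<mu>" using ch i by simp
    then have "\<mu>' * barrier (v i) (H l') (Y i) \<le> \<mu>' * (1 / \<mu>)" using \<mu>' by (intro mult_left_mono) auto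
    also have "\<dots> < 1" using \<mu>' pos by simp
    finally have "Y i (k i) * barrier (v i) (H l') (Y i) < 1" by (simp add: Yk)
    moreover have "Y i \<in> open_cone (H l') e" using ch by (intro open_cone_indep[OF ind off]) auto
    ultimately have "Y i \<in> open_cone (mix_op (v i) (k i) (H l')) e"
      using \<mu>'(1) by (intro L'.open_cone_mix_opI v_closed_cone_H sl' i e_k) (auto simp: Yk)
    then show ?thesis using H_move[of l i] l i by (simp add: l'_def)
  qed
  have "I \<noteq> {}" using fin m by auto
  from L.cone_sum[OF fin(1) this Y] have sumY: "(\<Sum>i\<in>I. Y i) \<in> open_cone (H l) e" by simp
  define \<Omega> where "\<Omega> = (\<Sum>i\<in>I. unitv (k i))"
  \<comment> \<open>Each index is unshifted only in its own \<open>Y i\<close>: the sum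
    \<open>e\<close> of the directions occurs \<open>m - 1\<close> times with factor \<delta>, and
    every auxiliary coordinate adds up to \<open>m - 1\<close> ones and one
    \<open>\<mu>'\<close>.\<close>
  have "(\<Sum>i\<in>I. Y i) = N *\<^sub>R e + c *\<^sub>R \<Omega>"
  proof -
    have "Y i = t *\<^sub>R e + ((\<delta> *\<^sub>R e + \<Omega>) - (\<delta> *\<^sub>R v i + unitv (k i))) + \<mu>' *\<^sub>R unitv (k i)" if "i \<in> I" for i
    proof -
      have "(\<Sum>i\<in>I - {i}. \<delta> *\<^sub>R v i + unitv (k i)) =
        (\<Sum>i\<in>I. \<delta> *\<^sub>R v i + unitv (k i)) - (\<delta> *\<^sub>R v i + unitv (k i))"
        using fin that by (simp add: sum_diff1)
      also have "(\<Sum>i\<in>I. \<delta> *\<^sub>R v i + unitv (k i)) = \<delta> *\<^sub>R e + \<Omega>"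
        by (simp add: sum.distrib \<Omega>_def sum[symmetric] scaleR_sum_right)
      finally show ?thesis by (simp add: Y_def shifted_point_def)
    qed
    then have "(\<Sum>i\<in>I. Y i) = (\<Sum>i\<in>I. t *\<^sub>R e + ((\<delta> *\<^sub>R e + \<Omega>) - (\<delta> *\<^sub>R v i + unitv (k i))) + \<mu>' *\<^sub>R unitv (k i))"
      by (rule sum.cong[OF refl])
    also have "\<dots> = real m *\<^sub>R (t *\<^sub>R e + (\<delta> *\<^sub>R e + \<Omega>)) - (\<delta> *\<^sub>R e + \<Omega>) + \<mu>' *\<^sub>R \<Omega>"
      by (simp add: sum.distrib sum_subtractf sum_constant_scaleR fin scaleR_sum_right[symmetric] sum \<Omega>_def[symmetric]
          scaleR_add_right algebra_simps del: sum_constant)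
    also have "\<dots> = N *\<^sub>R e + c *\<^sub>R \<Omega>"
      by (simp add: vec_simps N_def c_def algebra_simps)
    finally show ?thesis .
  qed
  then have "(1 / c) *\<^sub>R (N *\<^sub>R e + c *\<^sub>R \<Omega>) \<in> open_cone (H l) e"
    using sumY c L.cone_scaleR by simp
  then have "(1 / c) *\<^sub>R (N *\<^sub>R e + c *\<^sub>R \<Omega>) + (T - N / c) *\<^sub>R e \<in> open_cone (H l) e"
    using TT by (intro cone_add_e) auto
  also have "(1 / c) *\<^sub>R (N *\<^sub>R e + c *\<^sub>R \<Omega>) + (T - N / c) *\<^sub>R e = T *\<^sub>R e + \<Omega>"
    using c by (simp add: vec_simps field_simps)
  finally show ?thesis by (simp add: \<Omega>_def)
qed

text \<open>No interlacing is needed: all candidates for \<open>x a j\<close> are tested against the same \<open>H l\<close>, at the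
  same point, and the barrier is linear in the direction.\<close>

lemma greedy_choice:
  assumes "finite J" "J \<noteq> {}"
    and avg: "\<And>i. i \<in> I \<Longrightarrow> v i = (1 / real (card J)) *\<^sub>R (\<Sum>j\<in>J. x i j)"
    and x_cone: "\<And>i j. i \<in> I \<Longrightarrow> j \<in> J \<Longrightarrow> x i j \<in> closed_cone f e"
    and x_k: "\<And>i i' j. i \<in> I \<Longrightarrow> i' \<in> I \<Longrightarrow> j \<in> J \<Longrightarrow> x i j (k i') = 0"
    and l: "distinct l" "set l \<subseteq> I"
    and X: "X \<in> open_cone (H l) e" "\<And>i. i \<in> set l \<Longrightarrow> X (k i) = 1"
  shows "\<exists>\<sigma>. (\<forall>i\<in>set l. \<sigma> i \<in> J) \<and> X - (\<Sum>i\<in>set l. x i (\<sigma> i)) \<in> open_cone f e"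
  using l X
proof (induction l arbitrary: X)
  case Nil
  then show ?case by simp
next
  case (Cons a l)
  have a: "a \<in> I" "a \<notin> set l" and l: "set l \<subseteq> I" "distinct l" using Cons.prems by auto
  interpret L: hyp_form_pos "H l" d e using H_hyp[OF l(1)] .
  have Xc: "X \<in> open_cone (H l) e" and ph: "barrier (v a) (H l) X < 1"
    using L.open_cone_mix_opD[OF Cons.prems(3)[unfolded mix_ops_Cons] v_closed_cone_H[OF l(1) a(1)] e_k[OF a(1)] indep_H[OF l(1) a]]
      Cons.prems(4)[of a] by auto
  have "\<exists>j\<in>J. barrier (x a j) (H l) X < 1"
  proof (rule ccontr)
    assume "\<not> ?thesis"
    then have ge: "\<And>j. j \<in> J \<Longrightarrow> barrier (x a j) (H l) X \<ge> 1" by force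
    have "dir_deriv (v a) (H l) z = of_real (1 / real (card J)) * (\<Sum>j\<in>J. dir_deriv (x a j) (H l) z)" for z
      unfolding avg[OF a(1)] dir_deriv_linear(2)[OF polyfn_H] dir_deriv_sum_dir[OF polyfn_H] ..
    then have "reval (dir_deriv (v a) (H l)) X = (1 / real (card J)) * (\<Sum>j\<in>J. reval (dir_deriv (x a j) (H l)) X)"
      unfolding reval_def by (simp only: Im_of_real_mult) (simp add: Re_sum Re_divide_of_nat)
    then have "barrier (v a) (H l) X = (1 / real (card J)) * (\<Sum>j\<in>J. barrier (x a j) (H l) X)"
      by (simp add: barrier_def sum_divide_distrib mult.commute)
    also have "\<dots> \<ge> (1 / real (card J)) * (\<Sum>j\<in>J. 1)"
      using ge by (intro mult_left_mono sum_mono) auto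
    finally show False using ph assms(1,2) by simp
  qed
  then obtain j where j: "j \<in> J" "barrier (x a j) (H l) X < 1" by blast
  have xaj: "x a j \<in> closed_cone (H l) e"
    by (rule H_closed_cone[OF l(1) _ x_cone[OF a(1) j(1)]]) (rule x_k[OF a(1) _ j(1)])
  have "X - x a j \<in> open_cone (H l) e" by (rule L.cone_minus[OF Xc xaj j(2)])
  moreover have "(X - x a j) (k i) = 1" if "i \<in> set l" for i
    using Cons.prems(4)[of i] x_k[OF a(1) _ j(1), of i] that l(1) by (auto simp: minus_apply)
  ultimately obtain \<sigma> where \<sigma>: "\<And>i. i \<in> set l \<Longrightarrow> \<sigma> i \<in> J" "(X - x a j) - (\<Sum>i\<in>set l. x i (\<sigma> i)) \<in> open_cone f e"
    using Cons.IH[OF l(2,1)] by blast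
  define \<sigma>' where "\<sigma>' = \<sigma>(a := j)"
  have "(\<Sum>i\<in>set l. x i (\<sigma>' i)) = (\<Sum>i\<in>set l. x i (\<sigma> i))"
    using a(2) by (intro sum.cong) (auto simp: \<sigma>'_def)
  then have "X - (\<Sum>i\<in>set (a # l). x i (\<sigma>' i)) = (X - x a j) - (\<Sum>i\<in>set l. x i (\<sigma> i))"
    using a(2) by (simp add: \<sigma>'_def algebra_simps)
  moreover have "\<forall>i\<in>set (a # l). \<sigma>' i \<in> J" using \<sigma>(1) j(1) by (auto simp: \<sigma>'_def)
  ultimately show ?case using \<sigma>(2) by metis
qed

end

section \<open>Partitioning the vectors\<close>

definition ceval :: "'n::finite rpoly \<Rightarrow> ('n \<Rightarrow> complex) \<Rightarrow> complex" where
  "ceval h z = (\<Sum>a\<in>Poly_Mapping.keys h.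
     of_real (Poly_Mapping.lookup h a) * (\<Prod>i\<in>UNIV. z i ^ Poly_Mapping.lookup a i))"

lemma polyfn_ceval: "(\<And>n. polyfn (\<lambda>z. g z n)) \<Longrightarrow> polyfn (\<lambda>z. ceval h (g z))"
  unfolding ceval_def
  by (intro polyfn_sum polyfn.mult[OF polyfn.const] polyfn_prod polyfn_power) auto

lemma ceval_of_real: "ceval h (\<lambda>n. of_real (x $ n)) = of_real (eval_rpoly h x)"
  by (simp add: ceval_def eval_rpoly_def)

lemma ceval_scale: assumes "homogeneous d h" shows "ceval h (\<lambda>n. c * z n) = c ^ d * ceval h z"
  unfolding ceval_def sum_distrib_left
proof (rule sum.cong[OF refl])
  fix a assume "a \<in> Poly_Mapping.keys h"
  then have "(\<Sum>i\<in>UNIV. Poly_Mapping.lookup a i) = d" using assms by (auto simp: homogeneous_def mono_degree_def)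
  then have "(\<Prod>i\<in>UNIV. c ^ Poly_Mapping.lookup a i) = c ^ d" by (simp flip: power_sum)
  then show "complex_of_real (Poly_Mapping.lookup h a) * (\<Prod>i\<in>UNIV. (c * z i) ^ Poly_Mapping.lookup a i) =
    c ^ d * (complex_of_real (Poly_Mapping.lookup h a) * (\<Prod>i\<in>UNIV. z i ^ Poly_Mapping.lookup a i))"
    by (simp add: power_mult_distrib prod.distrib)
qed

lemma eval_rpoly_scale: assumes "homogeneous d h" shows "eval_rpoly h (c *\<^sub>R x) = c ^ d * eval_rpoly h x"
proof -
  have "complex_of_real (eval_rpoly h (c *\<^sub>R x)) = of_real (c ^ d * eval_rpoly h x)"
    using ceval_scale[OF assms, of "of_real c" "\<lambda>n. of_real (x $ n)"]
    by (simp add: ceval_of_real[symmetric])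
  then show ?thesis by (simp only: of_real_eq_iff)
qed

lemma rpoly_cx_sum: "rpoly_cx (\<Sum>a\<in>A. p a) = (\<Sum>a\<in>A. rpoly_cx (p a))"
  by (induction A rule: infinite_finite_induct) (simp_all add: rpoly_cx_add)

lemma rpoly_cx_prod: "rpoly_cx (\<Prod>a\<in>A. p a) = (\<Prod>a\<in>A. rpoly_cx (p a))"
  by (induction A rule: infinite_finite_induct) (simp_all add: rpoly_cx_mult)

lemma rpoly_cx_power: "rpoly_cx (p ^ n) = rpoly_cx p ^ n"
  by (induction n) (simp_all add: rpoly_cx_mult)

lemma poly_cx_line_poly:
  "poly (rpoly_cx (line_poly h e x)) \<tau> = ceval h (\<lambda>n. \<tau> * of_real (e $ n) - of_real (x $ n))"
  by (simp add: line_poly_def ceval_def rpoly_cx_sum rpoly_cx_prod rpoly_cx_power rpoly_cx_smult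
      poly_sum poly_prod map_poly_pCons)

text \<open>The value is that of \<open>line_poly h e (- x)\<close> at the non-real point
  \<open>\<i>\<close>.\<close>

lemma hyperbolic_ceval:
  assumes "hyperbolic h e"
  shows "ceval h (\<lambda>n. of_real (x $ n) + \<i> * of_real (e $ n)) \<noteq> 0"
proof -
  have "\<i> \<notin> \<real>" by (simp add: complex_is_Real_iff)
  moreover have "z \<in> \<real>" if "poly (rpoly_cx (line_poly h e (- x))) z = 0" for z
    using assms that unfolding hyperbolic_def by blast
  ultimately have "poly (rpoly_cx (line_poly h e (- x))) \<i> \<noteq> 0" by blast
  then show ?thesis by (simp add: poly_cx_line_poly add.commute)
qed

lemma eigenvalues_spec:
  assumes "hyperbolic h e"
  shows "sorted_wrt (\<ge>) (eigenvalues h e x)"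
    and "line_poly h e x = smult (eval_rpoly h e) (\<Prod>l\<leftarrow>eigenvalues h e x. [:- l, 1:])"
  using theI'[OF eigenvalues_ex1[OF assms, of x]] by (simp_all add: eigenvalues_def)

lemma eval_rpoly_minus:
  assumes "hyperbolic h e"
  shows "eval_rpoly h (t *\<^sub>R e - x) = eval_rpoly h e * (\<Prod>l\<leftarrow>eigenvalues h e x. t - l)"
proof -
  have "poly (\<Prod>l\<leftarrow>ls. [:- l, 1:]) t = (\<Prod>l\<leftarrow>ls. t - l)" for ls :: "real list"
    by (induction ls) (auto simp: algebra_simps)
  then show ?thesis unfolding poly_line_poly[symmetric] by (subst eigenvalues_spec(2)[OF assms]) simp
qed

text \<open>The reversed factorization, from \<open>t = - 1 / s\<close> and homogeneity. Zero
  eigenvalues contribute the factor 1, so the degree in \<open>s\<close> is governed by the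
  rank.\<close>

lemma eval_rpoly_plus:
  assumes "hyperbolic h e"
  shows "eval_rpoly h (e + s *\<^sub>R x) = eval_rpoly h e * (\<Prod>l\<leftarrow>eigenvalues h e x. 1 + s * l)"
proof (cases "s = 0")
  case True then show ?thesis by (simp add: map_replicate_const)
next
  case False
  obtain d where d: "homogeneous d h" using assms by (auto simp: hyperbolic_def)
  have "e + s *\<^sub>R x = (- s) *\<^sub>R ((- 1 / s) *\<^sub>R e - x)" using False by (simp add: scaleR_diff_right)
  then have "eval_rpoly h (e + s *\<^sub>R x) = (- s) ^ d * (eval_rpoly h e * (\<Prod>l\<leftarrow>eigenvalues h e x. - 1 / s - l))"
    using eval_rpoly_scale[OF d, of "- s" "(- 1 / s) *\<^sub>R e - x"] eval_rpoly_minus[OF assms, of "- 1 / s" x] by simp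
  also have "(- s) ^ d = (- s) ^ length (eigenvalues h e x)" using length_eigenvalues[OF assms d] by simp
  also have "(- s) ^ length ls * (c * (\<Prod>l\<leftarrow>ls. - 1 / s - l)) = c * (\<Prod>l\<leftarrow>ls. 1 + s * l)" for ls :: "real list" and c
  proof (induction ls)
    case (Cons a ls)
    have "(- s) ^ length (a # ls) * (c * (\<Prod>l\<leftarrow>a # ls. - 1 / s - l)) =
      ((- s) * (- 1 / s - a)) * ((- s) ^ length ls * (c * (\<Prod>l\<leftarrow>ls. - 1 / s - l)))"
      by (simp add: mult_ac)
    also have "(- s) * (- 1 / s - a) = 1 + s * a" using False by (simp add: field_simps)
    finally have E: "(- s) ^ length (a # ls) * (c * (\<Prod>l\<leftarrow>a # ls. - 1 / s - l)) =
      (1 + s * a) * ((- s) ^ length ls * (c * (\<Prod>l\<leftarrow>ls. - 1 / s - l)))" .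
    show ?case unfolding E Cons.IH by (simp add: mult.left_commute)
  qed simp
  finally show ?thesis .
qed

lemma hyp_cone_eigenvalues:
  assumes "hyperbolic h e" "x \<in> hyp_cone h e" "l \<in> set (eigenvalues h e x)" shows "l \<ge> 0"
proof -
  define ls where "ls = eigenvalues h e x"
  have ls: "sorted_wrt (\<ge>) ls" "last ls \<ge> 0" "l \<in> set ls"
    using eigenvalues_spec(1)[OF assms(1)] assms(2,3) by (simp_all add: ls_def hyp_cone_def lambda_min_def)
  then show ?thesis by (cases ls rule: rev_cases) (auto simp: sorted_wrt_append intro: order.trans)
qed

lemma hyp_cone_eval_nonzero:
  assumes "hyperbolic h e" "x \<in> hyp_cone h e" "t > 0" shows "eval_rpoly h (x + t *\<^sub>R e) \<noteq> 0"
proof -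
  obtain d where d: "homogeneous d h" using assms by (auto simp: hyperbolic_def)
  have "x + t *\<^sub>R e = t *\<^sub>R (e + (1 / t) *\<^sub>R x)" using assms by (simp add: algebra_simps)
  moreover have "1 + 1 / t * l \<noteq> 0" if "l \<in> set (eigenvalues h e x)" for l
  proof -
    have "1 / t * l \<ge> 0" using hyp_cone_eigenvalues[OF assms(1,2) that] assms(3) by simp
    then show ?thesis by linarith
  qed
  then have "(\<Prod>l\<leftarrow>eigenvalues h e x. 1 + 1 / t * l) \<noteq> 0" by (force simp: prod_list_zero_iff)
  ultimately show ?thesis using eval_rpoly_plus[OF assms(1), of "1 / t" x] eval_rpoly_scale[OF d] assms
    by (simp add: hyperbolic_def)
qed

lemma degree_prod_lin_le:
  fixes ls :: "real list"
  shows "degree (\<Prod>l\<leftarrow>ls. [:1, c * l:]) \<le> length (filter (\<lambda>l. l \<noteq> 0) ls)"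
proof (induction ls)
  case (Cons a ls)
  have "degree ([:1, c * a:] * (\<Prod>l\<leftarrow>ls. [:1, c * l:])) \<le> degree [:1, c * a:] + degree (\<Prod>l\<leftarrow>ls. [:1, c * l:])"
    by (rule degree_mult_le)
  moreover have "degree [:1, c * a:] \<le> (if a = 0 then 0 else 1)" by (auto simp: degree_pCons_eq_if)
  ultimately have "degree ([:1, c * a:] * (\<Prod>l\<leftarrow>ls. [:1, c * l:])) \<le>
    (if a = 0 then 0 else 1) + length (filter (\<lambda>l. l \<noteq> 0) ls)" using Cons by linarith
  then show ?case by (cases "a = 0") (simp_all del: mult_pCons_left)
qed simp

lemma prod_lin_0:
  fixes ls :: "real list"
  shows "poly (\<Prod>l\<leftarrow>ls. [:1, c * l:]) 0 = 1" "poly (pderiv (\<Prod>l\<leftarrow>ls. [:1, c * l:])) 0 = c * sum_list ls"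
proof -
  show *: "poly (\<Prod>l\<leftarrow>ls. [:1, c * l:]) 0 = 1" for ls :: "real list" by (induction ls) auto
  show "poly (pderiv (\<Prod>l\<leftarrow>ls. [:1, c * l:])) 0 = c * sum_list ls"
  proof (induction ls)
    case (Cons a ls)
    have "poly (pderiv ([:1, c * a:] * (\<Prod>l\<leftarrow>ls. [:1, c * l:]))) 0 = c * a + poly (pderiv (\<Prod>l\<leftarrow>ls. [:1, c * l:])) 0"
      unfolding pderiv_mult by (simp add: pderiv_pCons *)
    then show ?case using Cons by (simp add: algebra_simps del: mult_pCons_left)
  qed (simp add: pderiv_1)
qed

lemma unitv_pair: "unitv (i, j) (a, b) = (if i = a \<and> j = b then 1 else 0)"
  by (auto simp: unitv_def)

section \<open>The product polynomial of a family of vectors\<close>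

locale vector_family =
  fixes h :: "'n::finite rpoly" and e :: "real ^ 'n" and u :: "nat \<Rightarrow> real ^ 'n"
    and k r m :: nat and \<epsilon> :: real
  assumes k: "k \<ge> 1" and r: "r \<ge> 1" and m: "m \<ge> 1" and \<epsilon>: "\<epsilon> > 0"
    and hyp_h: "hyperbolic h e"
    and u_cone: "\<And>i. i \<in> {1..m} \<Longrightarrow> u i \<in> hyp_cone h e"
    and u_trace: "\<And>i. i \<in> {1..m} \<Longrightarrow> hyp_trace h e (u i) \<le> \<epsilon>"
    and u_rank: "\<And>i. i \<in> {1..m} \<Longrightarrow> hyp_rank h e (u i) \<le> r"
    and u_sum: "(\<Sum>i=1..m. u i) = e"
begin

definition block :: "(nat \<times> nat \<Rightarrow> real) \<Rightarrow> nat \<Rightarrow> real ^ 'n" where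
  "block x j = (\<Sum>i=1..m. x (i, j) *\<^sub>R u i)"

text \<open>The product of \<open>k\<close> normalised copies of \<open>h\<close>: the variable \<open>(i, j)\<close> is the weight of \<open>u i\<close> in the \<open>j\<close>-th
  copy. The variables \<open>(i, 0)\<close> do not occur and are left for the mixing operators.\<close>

definition P :: "(nat \<times> nat \<Rightarrow> complex) \<Rightarrow> complex" where
  "P z = (\<Prod>j=1..k. of_real (1 / eval_rpoly h e) * ceval h (\<lambda>n. \<Sum>i=1..m. z (i, j) * of_real (u i $ n)))"

text \<open>The direction called \<open>e'\<close> in the overview: each of its blocks 1 to
  \<open>k\<close> is the sum of the \<open>u i\<close>, that is \<open>e\<close>.\<close>

definition ones :: "nat \<times> nat \<Rightarrow> real" where
  "ones = (\<lambda>(i, j). if i \<in> {1..m} \<and> j \<in> {1..k} then 1 else 0)"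

text \<open>The average of the \<open>k\<close> vectors
  \<open>real k *\<^sub>R unitv (i, j)\<close>, called \<open>v_i\<close> in the overview.\<close>

definition block_vec :: "nat \<Rightarrow> nat \<times> nat \<Rightarrow> real" where
  "block_vec i = (\<Sum>j=1..k. unitv (i, j))"

lemma eval_e_nonzero: "eval_rpoly h e \<noteq> 0" using hyp_h by (simp add: hyperbolic_def)

lemma polyfn_P: "polyfn P"
proof -
  have "polyfn (\<lambda>z. P z)" unfolding P_def
  proof (intro polyfn_prod polyfn.mult[OF polyfn.const] polyfn_ceval polyfn_sum)
    fix j n i
    show "polyfn (\<lambda>z. z (i, j) * complex_of_real (u i $ n))"
      by (rule polyfn.mult[OF polyfn.coord polyfn.const])
  qed
  then show ?thesis by simp
qed

lemma reval_P: "reval P x = (\<Prod>j=1..k. eval_rpoly h (block x j) / eval_rpoly h e)"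
proof -
  have "ceval h (\<lambda>n. \<Sum>i=1..m. cvec x (i, j) * of_real (u i $ n)) = of_real (eval_rpoly h (block x j))" for j
    by (simp add: ceval_of_real[symmetric] block_def cvec_apply)
  then have "P (cvec x) = of_real (\<Prod>j=1..k. eval_rpoly h (block x j) / eval_rpoly h e)"
    unfolding P_def by simp
  then show ?thesis by (simp only: reval_def Re_complex_of_real)
qed

lemma block_add: "block (x + y) j = block x j + block y j"
  by (simp add: block_def plus_fun_apply scaleR_add_left sum.distrib)

lemma block_scaleR: "block (c *\<^sub>R x) j = c *\<^sub>R block x j"
  by (simp add: block_def scaleR_fun_apply scaleR_sum_right)

lemma block_diff: "block (x - y) j = block x j - block y j"
  by (simp add: block_def minus_apply scaleR_diff_left sum_subtractf)

lemma block_sum: "block (\<Sum>a\<in>A. x a) j = (\<Sum>a\<in>A. block (x a) j)"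
  by (induction A rule: infinite_finite_induct) (simp_all add: block_add, simp_all add: block_def zero_fun_apply)

lemma block_ones: "j \<in> {1..k} \<Longrightarrow> block ones j = e"
  unfolding u_sum[symmetric] by (simp add: block_def ones_def)

lemma block_unitv: "i \<in> {1..m} \<Longrightarrow> block (unitv (i, j')) j = (if j = j' then u i else 0)"
proof -
  assume i: "i \<in> {1..m}"
  have "block (unitv (i, j')) j = (\<Sum>a=1..m. if a = i then (if j = j' then u i else 0) else 0)"
    unfolding block_def by (intro sum.cong) (auto simp: unitv_def)
  then show ?thesis using i by simp
qed

lemma block_block_vec: "i \<in> {1..m} \<Longrightarrow> j \<in> {1..k} \<Longrightarrow> block (block_vec i) j = u i"
  by (simp add: block_vec_def block_sum block_unitv)

lemma hyp_form_P: "\<exists>d. hyp_form_pos P d ones"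
proof -
  obtain d where d: "homogeneous d h" using hyp_h by (auto simp: hyperbolic_def)
  have "hyp_form_pos P (d * k) ones"
  proof
    show "polyfn P" by (rule polyfn_P)
    show "homog (d * k) P"
      unfolding homog_def
    proof (intro allI)
      fix c and z :: "nat \<times> nat \<Rightarrow> complex"
      have "ceval h (\<lambda>n. \<Sum>i=1..m. (c *\<^sub>C z) (i, j) * of_real (u i $ n)) =
        c ^ d * ceval h (\<lambda>n. \<Sum>i=1..m. z (i, j) * of_real (u i $ n))" for j
        unfolding ceval_scale[OF d, symmetric] by (simp add: cscale_apply sum_distrib_left mult.assoc)
      then have "P (c *\<^sub>C z) = (\<Prod>j=1..k. c ^ d * (of_real (1 / eval_rpoly h e) *
          ceval h (\<lambda>n. \<Sum>i=1..m. z (i, j) * of_real (u i $ n))))"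
        unfolding P_def by (intro prod.cong refl) (simp only: mult.left_commute)
      then show "P (c *\<^sub>C z) = c ^ (d * k) * P z"
        unfolding prod.distrib[of "\<lambda>_. c ^ d"] P_def[symmetric] by (simp only: prod_constant power_mult card_atLeastAtMost diff_Suc_1)
    qed
    show "reval P ones > 0" by (simp add: reval_P block_ones eval_e_nonzero)
    fix x
    have "ceval h (\<lambda>n. \<Sum>i=1..m. (cvec x + \<i> *\<^sub>C cvec ones) (i, j) * of_real (u i $ n)) \<noteq> 0" if "j \<in> {1..k}" for j
    proof -
      have "(\<Sum>i=1..m. (cvec x + \<i> *\<^sub>C cvec ones) (i, j) * of_real (u i $ n)) =
        of_real (block x j $ n) + \<i> * of_real (e $ n)" for n
      proof -
        have "(\<Sum>i=1..m. (cvec x + \<i> *\<^sub>C cvec ones) (i, j) * of_real (u i $ n)) =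
          of_real (block x j $ n) + \<i> * of_real (block ones j $ n)"
          by (simp add: block_def plus_fun_apply cvec_apply cscale_apply distrib_right sum.distrib sum_distrib_left mult.assoc)
        then show ?thesis using that by (simp add: block_ones)
      qed
      then show ?thesis using hyperbolic_ceval[OF hyp_h, of "block x j"] by simp
    qed
    then show "P (cvec x + \<i> *\<^sub>C cvec ones) \<noteq> 0" by (simp add: P_def eval_e_nonzero)
  qed
  then show ?thesis by blast
qed

lemma P_nonzero_iff: "P (cvec x) \<noteq> 0 \<longleftrightarrow> (\<forall>j\<in>{1..k}. eval_rpoly h (block x j) \<noteq> 0)"
  by (simp add: reval_eq_0_iff[OF polyfn_P] reval_P eval_e_nonzero)

lemma unitv_closed_cone:
  assumes "i \<in> {1..m}" "j \<in> {1..k}" shows "unitv (i, j) \<in> closed_cone P ones"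
proof -
  have "eval_rpoly h ((if j' = j then u i else 0) + t *\<^sub>R e) \<noteq> 0" if "t > 0" for t j'
  proof -
    obtain d where d: "homogeneous d h" using hyp_h by (auto simp: hyperbolic_def)
    have "eval_rpoly h (t *\<^sub>R e) \<noteq> 0" using eval_e_nonzero that by (simp add: eval_rpoly_scale[OF d])
    then show ?thesis using hyp_cone_eval_nonzero[OF hyp_h u_cone[OF assms(1)] that] by simp
  qed
  then show ?thesis unfolding closed_cone_def
    by (auto simp: P_nonzero_iff block_add block_scaleR block_ones block_unitv[OF assms(1)])
qed

text \<open>All \<open>k\<close> blocks of the point equal \<open>t e + s u i\<close>, so the
  restriction of \<open>P\<close> is a \<open>k\<close>-th power. This is the source of the factor
  \<open>k\<close> at the trace and of the rank \<open>r * k\<close>.\<close>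

lemma P_line:
  assumes i: "i \<in> {1..m}" and t: "t > 0"
  obtains A q where "A > 0" "q = smult A ((\<Prod>l\<leftarrow>eigenvalues h e (u i). [:1, (1 / t) * l:]) ^ k)"
    "\<And>s. reval P (t *\<^sub>R ones + s *\<^sub>R block_vec i) = poly q s"
proof -
  obtain d where d: "homogeneous d h" using hyp_h by (auto simp: hyperbolic_def)
  define ls where "ls = eigenvalues h e (u i)"
  define c where "c = 1 / t"
  have pl: "poly (\<Prod>l\<leftarrow>ls. [:1, c * l:]) s = (\<Prod>l\<leftarrow>ls. 1 + s * c * l)" for c s :: real and ls
    by (induction ls) (auto simp: algebra_simps)
  have "reval P (t *\<^sub>R ones + s *\<^sub>R block_vec i) = poly (smult ((t ^ d) ^ k) ((\<Prod>l\<leftarrow>ls. [:1, c * l:]) ^ k)) s" for s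
  proof -
    have "eval_rpoly h (block (t *\<^sub>R ones + s *\<^sub>R block_vec i) j) / eval_rpoly h e = t ^ d * poly (\<Prod>l\<leftarrow>ls. [:1, c * l:]) s"
      if "j \<in> {1..k}" for j
    proof -
      have "block (t *\<^sub>R ones + s *\<^sub>R block_vec i) j = t *\<^sub>R (e + (s * c) *\<^sub>R u i)"
        using that i t by (simp add: block_add block_scaleR block_ones block_block_vec algebra_simps c_def)
      then show ?thesis using eval_e_nonzero
        by (simp add: eval_rpoly_scale[OF d] eval_rpoly_plus[OF hyp_h] pl ls_def[symmetric])
    qed
    then have "reval P (t *\<^sub>R ones + s *\<^sub>R block_vec i) = (\<Prod>j=1..k. t ^ d * poly (\<Prod>l\<leftarrow>ls. [:1, c * l:]) s)"
      unfolding reval_P by (rule prod.cong[OF refl])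
    then show ?thesis by (simp add: power_mult_distrib)
  qed
  moreover have "(t ^ d) ^ k > 0" using t by simp
  ultimately show thesis using that unfolding ls_def c_def by blast
qed

lemma barrier_P:
  assumes i: "i \<in> {1..m}" and t: "t > 0"
  shows "barrier (block_vec i) P (t *\<^sub>R ones) = real k * hyp_trace h e (u i) / t"
proof -
  define L where "L = (\<Prod>l\<leftarrow>eigenvalues h e (u i). [:1, (1 / t) * l:])"
  obtain A q where A: "A > 0" "q = smult A (L ^ k)"
    and q: "\<And>s. reval P (t *\<^sub>R ones + s *\<^sub>R block_vec i) = poly q s"
    using P_line[OF i t] unfolding L_def by blast
  obtain p where p: "\<And>\<tau>. P (cvec (t *\<^sub>R ones) + \<tau> *\<^sub>C cvec (block_vec i)) = poly (rpoly_cx p) \<tau>"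
    using polyfn_real_line[OF polyfn_P] by blast
  have "poly p = poly q" using reval_line[OF p] q by auto
  then have pq: "p = q" by (simp add: poly_eq_poly_eq_iff)
  have D: "dir_deriv (block_vec i) P (cvec (t *\<^sub>R ones) + \<tau> *\<^sub>C cvec (block_vec i)) = poly (rpoly_cx (pderiv q)) \<tau>" for \<tau>
    using dir_deriv_poly[OF polyfn_P p] by (simp add: rpoly_cx_pderiv pq)
  have L0: "poly L 0 = 1" "poly (pderiv L) 0 = (1 / t) * hyp_trace h e (u i)"
    unfolding L_def hyp_trace_def by (rule prod_lin_0)+
  have "reval (dir_deriv (block_vec i) P) (t *\<^sub>R ones) = poly (pderiv q) 0" using reval_line[OF D, of 0] by simp
  also have "\<dots> = A * (real k * ((1 / t) * hyp_trace h e (u i)))"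
    unfolding A(2) pderiv_smult pderiv_power by (simp add: L0)
  finally have 1: "reval (dir_deriv (block_vec i) P) (t *\<^sub>R ones) = A * (real k * ((1 / t) * hyp_trace h e (u i)))" .
  have "reval P (t *\<^sub>R ones) = A" using q[of 0] by (simp add: A(2) L0)
  then show ?thesis unfolding barrier_def 1 using A(1) by simp
qed

lemma growth_P:
  assumes i: "i \<in> {1..m}" and t: "t > 0"
  shows "\<exists>K. \<forall>s\<ge>0. reval P (t *\<^sub>R ones + s *\<^sub>R block_vec i) \<le> K * (1 + s) ^ (r * k)"
proof -
  define L where "L = (\<Prod>l\<leftarrow>eigenvalues h e (u i). [:1, (1 / t) * l:])"
  obtain A q where A: "A > 0" "q = smult A (L ^ k)"
    and q: "\<And>s. reval P (t *\<^sub>R ones + s *\<^sub>R block_vec i) = poly q s"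
    using P_line[OF i t] unfolding L_def by blast
  have "degree L \<le> r"
    using degree_prod_lin_le[where c="1 / t" and ls="eigenvalues h e (u i)"] u_rank[OF i] by (simp add: L_def hyp_rank_def)
  then have "degree q \<le> r * k" unfolding A(2)
    using degree_power_le[of L k] by (meson degree_smult_le mult_le_mono1 order.trans)
  from poly_growth[OF this] show ?thesis unfolding q by (meson abs_le_D1)
qed

lemma indep_P: "indep (i, 0) P"
  unfolding indep_def P_def by (auto intro!: prod.cong sum.cong arg_cong[of _ _ "ceval h"] simp: fun_eq_iff)

text \<open>The greedy choice puts \<open>T e'\<close> minus the chosen multiples of unit vectors
  into the cone of \<open>P\<close>. Its block \<open>j\<close> is \<open>T e\<close> minus
  \<open>k\<close> times the sum of class \<open>j\<close>, which bounds the eigenvalues of that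
  sum.\<close>

lemma partition_exists:
  assumes U: "(\<delta>, \<mu>) \<in> U (r * k)"
    and T: "T > ((real k * \<epsilon>) * \<mu> + (1 - 1 / real m) * \<delta>) / (1 - 1 / real m + \<mu> / real m)"
  shows "\<exists>\<sigma>. (\<forall>i\<in>{1..m}. \<sigma> i \<in> {1..k}) \<and>
    (\<forall>j\<in>{1..k}. \<forall>l\<in>set (eigenvalues h e (\<Sum>i\<in>{i\<in>{1..m}. \<sigma> i = j}. u i)). 0 \<le> l \<and> real k * l < T)"
proof -
  obtain d where "hyp_form_pos P d ones" using hyp_form_P by blast
  then interpret P: hyp_form_pos P d ones .
  have pos: "\<mu> > 0" using U by (auto simp: U_def)
  \<comment> \<open>With this value the barrier \<open>k tr (u i) / t\<close> is at most
    \<open>k \<epsilon> / t = 1 / \<mu>\<close>.\<close>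
  define t where "t = real k * \<epsilon> * \<mu>"
  have t: "t > 0" using pos k \<epsilon> by (simp add: t_def)
  interpret M: mixed_form P d ones "{1..m}" block_vec "\<lambda>i. (i, 0)"
  proof
    fix i assume i: "i \<in> {1..m}"
    show "block_vec i \<in> closed_cone P ones" unfolding block_vec_def using i by (intro P.closed_cone_sum unitv_closed_cone)
    fix i' show "block_vec i (i', 0) = 0" by (simp add: block_vec_def sum_fun_apply unitv_def)
  qed (auto simp: inj_on_def ones_def indep_P)
  have sum_block_vec: "(\<Sum>i\<in>{1..m}. block_vec i) = ones"
  proof
    fix p :: "nat \<times> nat"
    obtain a b where p: "p = (a, b)" by fastforce
    have "(\<Sum>i\<in>{1..m}. block_vec i) p = (\<Sum>i\<in>{1..m}. \<Sum>j\<in>{1..k}. if i = a \<and> j = b then 1 else 0)"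
      by (simp add: sum_fun_apply block_vec_def unitv_pair p)
    also have "\<dots> = (\<Sum>x\<in>{1..m} \<times> {1..k}. if x = (a, b) then 1 else 0)"
      by (simp add: sum.cartesian_product case_prod_unfold prod_eq_iff)
    also have "\<dots> = ones p" by (simp add: ones_def p)
    finally show "(\<Sum>i\<in>{1..m}. block_vec i) p = ones p" .
  qed
  define l where "l = [1..<Suc m]"
  have l: "distinct l" "set l = {1..m}" "length l = m" by (auto simp: l_def)
  have rk: "r * k \<ge> 1" using r k by simp
  define \<Omega> where "\<Omega> = (\<Sum>i\<in>{1..m}. unitv (i, 0::nat))"
  define X where "X = T *\<^sub>R ones + \<Omega>"
  have "X \<in> open_cone (M.H l) ones" unfolding X_def \<Omega>_def
  proof (rule M.mixed_bound[OF U rk t _ _ l m sum_block_vec])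
    fix i assume i: "i \<in> {1..m}"
    have "real k * hyp_trace h e (u i) \<le> real k * \<epsilon>" using u_trace[OF i] by (intro mult_left_mono) auto
    then have "real k * hyp_trace h e (u i) / t \<le> (real k * \<epsilon>) / t" using t by (intro divide_right_mono) auto
    also have "\<dots> = 1 / \<mu>" using k \<epsilon> by (simp add: t_def)
    finally show "barrier (block_vec i) P (t *\<^sub>R ones) \<le> 1 / \<mu>" by (simp add: barrier_P[OF i t])
    show "\<exists>K. \<forall>s\<ge>0. reval P (t *\<^sub>R ones + s *\<^sub>R block_vec i) \<le> K * (1 + s) ^ (r * k)" by (rule growth_P[OF i t])
  qed (use T in \<open>simp add: t_def\<close>)
  define x where "x i j = real k *\<^sub>R unitv (i, j)" for i j :: nat
  have "\<exists>\<sigma>. (\<forall>i\<in>set l. \<sigma> i \<in> {1..k}) \<and> X - (\<Sum>i\<in>set l. x i (\<sigma> i)) \<in> open_cone P ones"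
  proof (rule M.greedy_choice[OF _ _ _ _ _ l(1) _ \<open>X \<in> open_cone (M.H l) ones\<close>])
    fix i
    show "block_vec i = (1 / real (card {1..k})) *\<^sub>R (\<Sum>j\<in>{1..k}. x i j)"
      using k by (simp add: x_def block_vec_def scaleR_sum_right[symmetric])
  next
    fix i j assume "i \<in> {1..m}" "j \<in> {1..k}"
    then show "x i j \<in> closed_cone P ones" unfolding x_def by (intro P.closed_cone_scaleR unitv_closed_cone) auto
  next
    fix i i' j assume "j \<in> {1..k}"
    then show "x i j (i', 0) = 0" by (auto simp: x_def unitv_def scaleR_fun_apply)
  next
    fix i assume i: "i \<in> set l"
    have "\<Omega> (i, 0) = (\<Sum>a\<in>{1..m}. if a = i then 1 else 0)"
      by (simp add: \<Omega>_def sum_fun_apply unitv_pair)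
    then show "X (i, 0) = 1" using i by (simp add: X_def plus_fun_apply scaleR_fun_apply ones_def l(2))
  qed (use k in \<open>auto simp: l(2)\<close>)
  then obtain \<sigma> where \<sigma>: "\<And>i. i \<in> {1..m} \<Longrightarrow> \<sigma> i \<in> {1..k}"
    and Z: "X - (\<Sum>i\<in>{1..m}. x i (\<sigma> i)) \<in> open_cone P ones" unfolding l(2) by blast
  obtain d' where d': "homogeneous d' h" using hyp_h by (auto simp: hyperbolic_def)
  have "0 \<le> y \<and> real k * y < T"
    if j: "j \<in> {1..k}" and y: "y \<in> set (eigenvalues h e (\<Sum>i\<in>{i\<in>{1..m}. \<sigma> i = j}. u i))" for j y
  proof -
    define w where "w = (\<Sum>i\<in>{i\<in>{1..m}. \<sigma> i = j}. u i)"
    have root: "eval_rpoly h (y *\<^sub>R e - w) = 0"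
      using y unfolding eval_rpoly_minus[OF hyp_h] w_def by (auto simp: prod_list_zero_iff)
    have blkx: "block (\<Sum>i\<in>{1..m}. unitv (i, \<sigma> i)) j = w"
    proof -
      have "block (\<Sum>i\<in>{1..m}. unitv (i, \<sigma> i)) j = (\<Sum>i\<in>{1..m}. if \<sigma> i = j then u i else 0)"
        unfolding block_sum by (intro sum.cong) (auto simp: block_unitv)
      then show ?thesis unfolding w_def by (simp only: sum.inter_filter[OF finite_atLeastAtMost])
    qed
    have "y \<ge> 0"
    proof (rule ccontr)
      assume "\<not> y \<ge> 0"
      then have ny: "- y > 0" by simp
      have "(\<Sum>i\<in>{1..m}. unitv (i, \<sigma> i)) \<in> closed_cone P ones" using \<sigma> by (intro P.closed_cone_sum unitv_closed_cone)
      then have "P (cvec ((\<Sum>i\<in>{1..m}. unitv (i, \<sigma> i)) + (- y) *\<^sub>R ones)) \<noteq> 0" using ny unfolding closed_cone_def by blast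
      then have "eval_rpoly h (w + (- y) *\<^sub>R e) \<noteq> 0"
        using j unfolding P_nonzero_iff block_add block_scaleR using block_ones blkx by metis
      moreover have "y *\<^sub>R e - w = (-1) *\<^sub>R (w + (- y) *\<^sub>R e)" by simp
      then have "eval_rpoly h (w + (- y) *\<^sub>R e) = 0" using root eval_rpoly_scale[OF d', of "-1" "w + (- y) *\<^sub>R e"] by simp
      ultimately show False by simp
    qed
    moreover have "real k * y < T"
    proof (rule ccontr)
      assume "\<not> real k * y < T"
      \<comment> \<open>Moving by \<open>k y - T\<close> along \<open>ones\<close> brings block
        \<open>j\<close> to \<open>k (y e - w)\<close>, a zero of \<open>h\<close> on a ray without
        zeros of \<open>P\<close>. The auxiliary part \<Omega> lives in the variables
        \<open>(i, 0)\<close>, which do not enter block \<open>j\<close>.\<close>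
      then have s: "real k * y - T \<ge> 0" by simp
      have sx: "(\<Sum>i\<in>{1..m}. x i (\<sigma> i)) = real k *\<^sub>R (\<Sum>i\<in>{1..m}. unitv (i, \<sigma> i))"
        by (simp add: x_def scaleR_sum_right)
      have block\<Omega>: "block \<Omega> j = 0" using j unfolding \<Omega>_def block_sum by (intro sum.neutral) (auto simp: block_unitv)
      have "P (cvec (X - (\<Sum>i\<in>{1..m}. x i (\<sigma> i)) + (real k * y - T) *\<^sub>R ones)) \<noteq> 0"
        using Z s unfolding open_cone_def by blast
      then have "eval_rpoly h (block (X - (\<Sum>i\<in>{1..m}. x i (\<sigma> i)) + (real k * y - T) *\<^sub>R ones) j) \<noteq> 0"
        using j P_nonzero_iff by blast
      moreover have "block (X - (\<Sum>i\<in>{1..m}. x i (\<sigma> i)) + (real k * y - T) *\<^sub>R ones) j = real k *\<^sub>R (y *\<^sub>R e - w)"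
        unfolding X_def sx block_add block_diff block_scaleR blkx block\<Omega> block_ones[OF j] by (simp add: algebra_simps)
      ultimately show False using root eval_rpoly_scale[OF d'] by simp
    qed
    ultimately show ?thesis by simp
  qed
  then show ?thesis using \<sigma> by blast
qed

end

text \<open>For \<delta> = \<mu> = 2 both \<open>\<delta> - 1\<close> and
  \<open>\<delta> / \<mu>\<close> are 1, so a ratio of at most 1 suffices. Nonemptiness makes the
  infimum meaningful.\<close>

lemma U_nonempty: "r \<ge> 1 \<Longrightarrow> (2, 2) \<in> U r"
proof -
  assume r: "r \<ge> 1"
  then obtain n where n: "r = Suc n" by (cases r) auto
  define D M :: real where "D = 2" and "M = 2"
  define a where "a = D / (real r * M)"
  have a: "a \<ge> 0" by (simp add: a_def D_def M_def)
  have le: "a ^ n \<le> (1 + a) ^ n" using a by (intro power_mono) auto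
  have "(1 + a) ^ Suc n - a ^ Suc n = ((1 + a) ^ n - a ^ n) + a * ((1 + a) ^ n - a ^ n) + a ^ n"
    by (simp add: algebra_simps)
  moreover have "a * ((1 + a) ^ n - a ^ n) \<ge> 0" "a ^ n \<ge> 0" using a le by simp_all
  ultimately have "(1 + a) ^ n - a ^ n \<le> (1 + a) ^ Suc n - a ^ Suc n" by linarith
  moreover have "a ^ Suc n < (1 + a) ^ Suc n" using a by (intro power_strict_mono) auto
  ultimately have "((1 + a) ^ n - a ^ n) / ((1 + a) ^ Suc n - a ^ Suc n) \<le> 1" by simp
  then have "((1 + a) ^ (r - 1) - a ^ (r - 1)) / ((1 + a) ^ r - a ^ r) \<le> 1" by (simp add: n)
  moreover have "D / M = 1" "D - 1 = 1" by (simp_all add: D_def M_def)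
  ultimately have "(D, M) \<in> U r" unfolding U_def mem_Collect_eq prod.case a_def[symmetric]
    by (simp add: D_def M_def)
  then show ?thesis by (simp add: D_def M_def)
qed

theorem theorem1p3:
  fixes h :: "'n::finite rpoly"
    and e :: "real ^ 'n"
    and u :: "nat \<Rightarrow> real ^ 'n"
    and k r m :: nat
    and \<epsilon> :: real
  assumes "k \<ge> 2" and "r \<ge> 1" and "m \<ge> 1" and "\<epsilon> > 0"
    and "hyperbolic h e"
    and "\<And>i. i \<in> {1..m} \<Longrightarrow> u i \<in> hyp_cone h e"
    and "\<And>i. i \<in> {1..m} \<Longrightarrow> hyp_trace h e (u i) \<le> \<epsilon>"
    and "\<And>i. i \<in> {1..m} \<Longrightarrow> hyp_rank h e (u i) \<le> r"
    and "(\<Sum>i=1..m. u i) = e"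
  shows "\<exists>S :: nat \<Rightarrow> nat set.
           (\<Union>j\<in>{1..k}. S j) = {1..m} \<and> disjoint_family_on S {1..k} \<and>
           (\<forall>j\<in>{1..k}. hyp_norm h e (\<Sum>i\<in>S j. u i) \<le> 1 / real k * delta_bound (real k * \<epsilon>) m (r * k))"
proof -
  interpret vector_family h e u k r m \<epsilon>
    using assms by unfold_locales auto
  define V where "V = {(real k * \<epsilon> * \<mu> + (1 - 1 / real m) * \<delta>) / (1 - 1 / real m + \<mu> / real m) | \<delta> \<mu>. (\<delta>, \<mu>) \<in> U (r * k)}"
  have db: "delta_bound (real k * \<epsilon>) m (r * k) = Inf V" by (simp add: delta_bound_def V_def)
  have "(2, 2) \<in> U (r * k)" using assms(1,2) by (intro U_nonempty) simp
  then have ne: "V \<noteq> {}" unfolding V_def by blast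
  have "y \<ge> 0" if "y \<in> V" for y
  proof -
    have "1 - 1 / real m \<ge> 0" using m by simp
    then show ?thesis using that \<epsilon> unfolding V_def U_def by (auto intro!: divide_nonneg_nonneg add_nonneg_nonneg)
  qed
  then have Inf0: "Inf V \<ge> 0" using ne by (intro cInf_greatest) auto
  define \<Sigma> where "\<Sigma> = {1..m} \<rightarrow>\<^sub>E {1..k}"
  define S where "S \<sigma> j = {i\<in>{1..m}. \<sigma> i = j}" for \<sigma> :: "nat \<Rightarrow> nat" and j
  define N where "N \<sigma> = Max ((\<lambda>j. hyp_norm h e (\<Sum>i\<in>S \<sigma> j. u i)) ` {1..k})" for \<sigma>
  have fin: "finite \<Sigma>" unfolding \<Sigma>_def by (intro finite_PiE) auto
  have "(\<lambda>i\<in>{1..m}. 1) \<in> \<Sigma>" using k by (auto simp: \<Sigma>_def)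
  then have "\<Sigma> \<noteq> {}" by blast
  define N0 where "N0 = Min (N ` \<Sigma>)"
  have "N0 \<in> N ` \<Sigma>" unfolding N0_def using fin \<open>\<Sigma> \<noteq> {}\<close> by (intro Min_in) auto
  then obtain \<sigma> where \<sigma>: "\<sigma> \<in> \<Sigma>" "N \<sigma> = N0" by auto
  \<comment> \<open>\<open>N0\<close> is the least norm bound over the finitely many partitions. If
    it exceeded the infimum, \<open>partition_exists\<close> with \<open>T = k N0\<close> would give
    a strictly better partition.\<close>
  have "real k * N0 \<le> Inf V"
  proof (rule ccontr)
    assume "\<not> real k * N0 \<le> Inf V"
    then have less: "Inf V < real k * N0" by simp
    then obtain y where "y \<in> V" "y < real k * N0" using cInf_lessD[OF ne] by blast
    then obtain \<tau> where \<tau>: "\<And>i. i \<in> {1..m} \<Longrightarrow> \<tau> i \<in> {1..k}"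
      "\<And>j l. j \<in> {1..k} \<Longrightarrow> l \<in> set (eigenvalues h e (\<Sum>i\<in>{i\<in>{1..m}. \<tau> i = j}. u i)) \<Longrightarrow> 0 \<le> l \<and> real k * l < real k * N0"
      using partition_exists[of _ _ "real k * N0"] unfolding V_def by blast
    define \<tau>' where "\<tau>' = restrict \<tau> {1..m}"
    have \<tau>'\<Sigma>: "\<tau>' \<in> \<Sigma>" using \<tau>(1) by (auto simp: \<tau>'_def \<Sigma>_def)
    have S: "S \<tau>' j = {i\<in>{1..m}. \<tau> i = j}" for j by (auto simp: S_def \<tau>'_def)
    have k0: "real k > 0" using k by simp
    \<comment> \<open>\<open>hyp_norm\<close> is a maximum over a set containing 0, so strict bounds
      on the eigenvalues give a strict bound on the norm only for positive
      \<open>N0\<close>.\<close>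
    have N0pos: "N0 > 0" using less Inf0 k0 by (metis less_le_trans not_less zero_less_mult_pos order_le_less_trans)
    have "hyp_norm h e (\<Sum>i\<in>S \<tau>' j. u i) < N0" if "j \<in> {1..k}" for j
      unfolding hyp_norm_def using N0pos \<tau>(2)[OF that] k0 by (auto simp: S)
    then have "N \<tau>' < N0" unfolding N_def using k by auto
    moreover have "N0 \<le> N \<tau>'" unfolding N0_def using fin \<tau>'\<Sigma> by (intro Min_le) auto
    ultimately show False by simp
  qed
  then have bound: "N0 \<le> 1 / real k * delta_bound (real k * \<epsilon>) m (r * k)"
    unfolding db using k by (simp add: pos_le_divide_eq mult.commute)
  show ?thesis
  proof (intro exI[of _ "S \<sigma>"] conjI ballI)
    show "(\<Union>j\<in>{1..k}. S \<sigma> j) = {1..m}" using \<sigma>(1) by (fastforce simp: S_def \<Sigma>_def)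
    show "disjoint_family_on (S \<sigma>) {1..k}" by (auto simp: disjoint_family_on_def S_def)
    fix j assume "j \<in> {1..k}"
    then have "hyp_norm h e (\<Sum>i\<in>S \<sigma> j. u i) \<le> N \<sigma>" unfolding N_def by (intro Max_ge) auto
    then show "hyp_norm h e (\<Sum>i\<in>S \<sigma> j. u i) \<le> 1 / real k * delta_bound (real k * \<epsilon>) m (r * k)"
      using \<sigma>(2) bound by simp
  qed
qed

end
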